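(* Let $n\ge 2$, $r\ge0$ and $k$ be integers, let $G=sS(U(n,1)\times U(r))$, and let $\Gamma\le G$ be a lattice such that $\Gamma\backslash G$ is not compact. Let $(\eta,t_0,\Xi)$ be fundamental domain data for $\Gamma$ (as defined in the context), let $f\in sM_k(\Gamma)$ and $g\in\Xi$, and write $$f|_g\big|_{R^{-1}}=\sum_{I\in\wp(r)}q_I\,\vartheta^I,\qquad q_I\in\mathcal O(H).$$ Let $\gamma_0\in \big(g^{-1}\Gamma g\cap N'Z(G')\big)\setminus Z(G')$ with $$R\gamma_0R^{-1}=n'_{\lambda_0,\mathbf 0}\begin{pmatrix}\varepsilon\,1_{n+1}&0\\0&E\end{pmatrix},\qquad \lambda_0\in\mathbb R\setminus\{0\},\ \varepsilon\in U(1),\ E\in U(r),\ \varepsilon^{n+1}=\det E,$$ where $E$ is diagonal. Let $\chi\in\mathbb R$ with $\varepsilon^{-1}=e^{2\pi i\chi}$, let $D=\mathrm{diag}(d_1,\dots,d_r)$ be a real diagonal matrix with $E=\exp(2\pi iD)$, and put $\mathrm{tr}_I D:=\sum_{j\in I}d_j$ for $I\in\wp(r)$. Then: (i) There exist unique entire functions $c_{I,m}\in\mathcal O(\mathbb C^{n-1})$, for $I\in\wp(r)$ and $m\in\frac1{\lambda_0}\big(\mathbb Z-\mathrm{tr}_ID-(k+|I|)\chi\big)$, such that $$q_I(\mathbf w)=\sum_{m\in\frac1{\lambda_0}(\mathbb Z-\mathrm{tr}_ID-(k+|I|)\chi)}c_{I,m}(\mathbf w_2)\,e^{2\pi m w_1}$$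 for all $\mathbf w=(w_1,\mathbf w_2)\in H$ and all $I\in\wp(r)$, and so $$f|_g\big|_{R^{-1}}(\mathbf w,\vartheta)=\sum_{I\in\wp(r)}\ \sum_{m\in\frac1{\lambda_0}(\mathbb Z-\mathrm{tr}_ID-(k+|I|)\chi)}c_{I,m}(\mathbf w_2)\,e^{2\pi m w_1}\,\vartheta^I ,$$ where the convergence is absolute and uniform on compact subsets of $H$. (ii) $c_{I,m}=0$ for all $I\in\wp(r)$ and all $m>0$; and if $\mathrm{tr}_ID+(k+|I|)\chi\in\mathbb Z$, then $c_{I,0}$ is a constant. (iii) Let $I\in\wp(r)$ and $s\in[1,\infty]$. If $\mathrm{tr}_ID+(k+|I|)\chi\notin\mathbb Z$, then $$q_I\,\Delta'(\mathbf w,\mathbf w)^{\frac{k+|I|}2}\in L^s(R\,\eta A_{>t_0}\mathbf 0)$$ with respect to the measure $\Delta'(\mathbf w,\mathbf w)^{-(n+1)}dV_{\mathrm{Leb}}$ on $H$. If $\mathrm{tr}_ID+(k+|I|)\chi\in\mathbb Z$ and $k\ge 2n-|I|$, then $$q_I\,\Delta'(\mathbf w,\mathbf w)^{\frac{k+|I|}2}\in L^s(R\,\eta A_{>t_0}\mathbf 0)$$ with respect to the same measure if and only if $c_{I,0}=0$.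
   Context: **Groups.** A lattice is a discrete subgroup of finite covolume. $U(n,1)$ is the group of complex $(n+1)\times(n+1)$ matrices preserving the Hermitian form $\mathrm{diag}(1,\dots,1,-1)$, $SU(n,1)$ its determinant-$1$ subgroup, and $$G=sS(U(n,1)\times U(r))=\left\{\begin{pmatrix}g'&0\\0&E\end{pmatrix}: g'\in U(n,1),\ E\in U(r),\ \det g'=\det E\right\}.$$ $G'=SU(n,1)$ is regarded as a subgroup of $G$ via $g'\mapsto\begin{pmatrix}g'&0\\0&1\end{pmatrix}$; more generally $SL(n+1,\mathbb C)$ is embedded in $GL(n+1,\mathbb C)\times GL(r,\mathbb C)$ in this way. $K=\{\mathrm{diag}(A_0,d,E):A_0\in U(n),d\in U(1),E\in U(r),\det(A_0)d=\det E\}$. $Z(G')=\left\{\begin{pmatrix}\varepsilon 1_{n+1}&0\\0&E\end{pmatrix}:\varepsilon\in U(1),E\in U(r),\varepsilon^{n+1}=\det E\right\}$ is the centralizer of $G'$ in $G$. With block sizes $1,n-1,1$ put $$a_t=\begin{pmatrix}\cosh t&0&\sinh t\\0&1&0\\ \sinh t&0&\cosh t\end{pmatrix},\quad R=\begin{pmatrix}\tfrac1{\sqrt2}&0&\tfrac1{\sqrt2}\\0&1&0\\-\tfrac1{\sqrt2}&0&\tfrac1{\sqrt2}\end{pmatrix},\quad n'_{\lambda,\mathbf u}=\begin{pmatrix}1&\mathbf u^*&i\lambda+\tfrac12\mathbf u^*\mathbf u\\0&1&\mathbf u\\0&0&1\end{pmatrix},$$ $A_{>t_0}=\{a_\tau:\tau>t_0\}$,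 $N=\{R^{-1}n'_{\lambda,\mathbf u}R:\lambda\in\mathbb R,\mathbf u\in\mathbb C^{n-1}\}\le G'$ (the unipotent part of the Iwasawa decomposition $G=NAK$, $A=\{a_t:t\in\mathbb R\}$), and $N'=[N,N]=\{R^{-1}n'_{\lambda,\mathbf 0}R:\lambda\in\mathbb R\}$. **Fundamental domain data for $\Gamma$.** A triple $(\eta,t_0,\Xi)$ with $\eta\subset N$ open and relatively compact, $t_0\in\mathbb R$, $\Xi\subset G'$ finite such that, with $\Omega=\bigcup_{g\in\Xi}g\,\eta A_{>t_0}K$: (1) for all $g\in\Xi$, $g^{-1}\Gamma g\cap NZ(G')$ and $g^{-1}\Gamma g\cap N'Z(G')$ are lattices in $NZ(G')$ and $N'Z(G')$ respectively, and $NZ(G')=(g^{-1}\Gamma g\cap NZ(G'))\,\eta\,Z(G')$; (2) $G=\Gamma\Omega$; (3) $\{\gamma\in\Gamma:\gamma\Omega\cap\Omega\ne\emptyset\}$ is finite. **Super automorphic forms on the super ball.** $B=\{\mathbf z\in\mathbb C^n:\mathbf z^*\mathbf z<1\}$. $\wp(r)$ is the power set of $\{1,\dots,r\}$. $\mathcal O(\mathcal B)=\{f=\sum_{I\in\wp(r)}f_I\zeta^I: f_I\in\mathcal O(B)\}$, where $\mathcal O(\cdot)$ of an ordinary domain denotes holomorphic functions, $\zeta_1,\dots,\zeta_r$ are anticommuting variables, and $\zeta^I=\zeta_{i_1}\cdots\zeta_{i_p}$ for $I=\{i_1<\dots<i_p\}$. For $g=\begin{pmatrix}g'&0\\0&E\end{pmatrix}\in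 G$, $g'=\begin{pmatrix}A&\mathbf b\\ \mathbf c&d\end{pmatrix}$, put $g\mathbf z=(A\mathbf z+\mathbf b)(\mathbf c\mathbf z+d)^{-1}$, $j(g,\mathbf z)=(\mathbf c\mathbf z+d)^{-1}$ and $$f|_g=\sum_I f_I(g\mathbf z)\,j(g,\mathbf z)^{k+|I|}\,(E\zeta)^I .$$ $sM_k(\Gamma)=\{f\in\mathcal O(\mathcal B): f|_\gamma=f\ \text{for all }\gamma\in\Gamma\}$. **Unbounded realization.** $R$ maps $B$ by the corresponding fractional linear transformation biholomorphically onto $$H=\{\mathbf w=(w_1,\mathbf w_2)\in\mathbb C\times\mathbb C^{n-1}:\mathrm{Re}\,w_1>\tfrac12\mathbf w_2^*\mathbf w_2\}.$$ Put $j(R^{-1},\mathbf w)=\frac{\sqrt2}{1+w_1}$. For $f=\sum_If_I\zeta^I\in\mathcal O(\mathcal B)$ define $$f|_{R^{-1}}(\mathbf w,\vartheta)=\sum_I f_I(R^{-1}\mathbf w)\,j(R^{-1},\mathbf w)^{k+|I|}\,\vartheta^I,$$ where $\vartheta_1,\dots,\vartheta_r$ are anticommuting variables. Put $\Delta'(\mathbf w,\mathbf w)=w_1+\overline{w_1}-\mathbf w_2^*\mathbf w_2$ for $\mathbf w\in H$. The measure $\Delta'(\mathbf w,\mathbf w)^{-(n+1)}dV_{\mathrm{Leb}}$ on $H$ is invariant under $RGR^{-1}$. $R\,\eta A_{>t_0}\mathbf 0\subset H$ is the image under $R$ of $\{x\mathbf 0: x\in\eta A_{>t_0}\}\subset B$.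 *)

theory Defs
  imports
    "HOL-Analysis.Analysis"
    "HOL-Algebra.Coset"
    "Jordan_Normal_Form.Determinant"
    "Jordan_Normal_Form.Schur_Decomposition"
begin

text \<open>
  Conventions. The type \<open>'m\<close> indexes the middle block, of size \<open>n - 1 = CARD('m) \<ge> 1\<close>.
  Points of \<open>C^n\<close> are pairs \<open>(z1, z2)\<close> in \<open>complex \<times> complex^'m\<close>. The \<open>n\<close> coordinates are
  indexed by \<open>'m option\<close> (\<open>None\<close> is the first one) and the \<open>n + 1\<close> homogeneous coordinates by
  \<open>'m option option\<close> (\<open>None\<close> is the last one, \<open>Some None\<close> the first one). The size \<open>r\<close> of the
  odd part may be 0, so the \<open>r \<times> r\<close> matrices are of type \<open>complex mat\<close>, and the odd indices are
  \<open>0, \<dots>, r - 1\<close> instead of \<open>1, \<dots>, r\<close>.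
\<close>

type_synonym 'm pt = "complex \<times> (complex ^ 'm)"
type_synonym 'm mat1 = "complex ^ ('m option option) ^ ('m option option)"
type_synonym 'm gel = "'m mat1 \<times> complex mat"


section \<open>Topological groups, Haar measures and lattices\<close>

definition quotient_top :: "'a topology \<Rightarrow> ('a \<Rightarrow> 'b) \<Rightarrow> 'b topology" where
  "quotient_top T p =
     topology (\<lambda>U. U \<subseteq> p ` topspace T \<and> openin T {x \<in> topspace T. p x \<in> U})"

lemma openin_quotient_top:
  "openin (quotient_top T p) U \<longleftrightarrow>
     U \<subseteq> p ` topspace T \<and> openin T {x \<in> topspace T. p x \<in> U}"
proof -
  let ?L = "\<lambda>U. U \<subseteq> p ` topspace T \<and> openin T {x \<in> topspace T. p x \<in> U}"
  have "istopology ?L"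
    unfolding istopology_def
  proof (intro conjI allI impI)
    fix S V assume S: "?L S" and V: "?L V"
    show "S \<inter> V \<subseteq> p ` topspace T" using S by blast
    have "{x \<in> topspace T. p x \<in> S \<inter> V} =
        {x \<in> topspace T. p x \<in> S} \<inter> {x \<in> topspace T. p x \<in> V}" by blast
    then show "openin T {x \<in> topspace T. p x \<in> S \<inter> V}" using S V by (simp add: openin_Int)
  next
    fix \<K> assume K: "\<forall>S\<in>\<K>. ?L S"
    show "\<Union>\<K> \<subseteq> p ` topspace T" using K by blast
    have "{x \<in> topspace T. p x \<in> \<Union>\<K>} = (\<Union>S\<in>\<K>. {x \<in> topspace T. p x \<in> S})" by blast
    then show "openin T {x \<in> topspace T. p x \<in> \<Union>\<K>}" using K by (simp add: openin_clauses(3))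
  qed
  then show ?thesis unfolding quotient_top_def by (simp add: topology_inverse')
qed

text \<open>Left Haar measure of a second countable locally compact group, as a Borel measure; Radon
  regularity is then automatic from finiteness on compact sets.\<close>

definition haar_measure :: "('a, 'b) monoid_scheme \<Rightarrow> 'a topology \<Rightarrow> 'a measure \<Rightarrow> bool" where
  "haar_measure G T \<mu> \<longleftrightarrow>
     space \<mu> = topspace T \<and>
     sets \<mu> = sigma_sets (topspace T) {U. openin T U} \<and>
     (\<forall>x\<in>carrier G. \<forall>A\<in>sets \<mu>. emeasure \<mu> (x <#\<^bsub>G\<^esub> A) = emeasure \<mu> A) \<and>
     (\<forall>C. compactin T C \<longrightarrow> emeasure \<mu> C < \<infinity>) \<and>
     emeasure \<mu> (space \<mu>) \<noteq> 0"

definition lattice_in :: "('a, 'b) monoid_scheme \<Rightarrow> 'a topology \<Rightarrow> 'a set \<Rightarrow> bool" where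
  "lattice_in G T \<Gamma> \<longleftrightarrow>
     subgroup \<Gamma> G \<and>
     subtopology T \<Gamma> = discrete_topology \<Gamma> \<and>
     (\<exists>\<mu> F. haar_measure G T \<mu> \<and> F \<in> sets \<mu> \<and> \<Gamma> <#>\<^bsub>G\<^esub> F = carrier G \<and> emeasure \<mu> F < \<infinity>)"


section \<open>The groups\<close>

definition cadj :: "complex ^ 'a ^ 'b \<Rightarrow> complex ^ 'b ^ 'a" where
  "cadj A = (\<chi> i j. cnj (A $ j $ i))"

definition herm_form :: "'m::finite mat1" where
  "herm_form = (\<chi> i j. if i = j then (if i = None then -1 else 1) else 0)"

definition Un1 :: "('m::finite mat1) set" where
  "Un1 = {g. cadj g ** herm_form ** g = herm_form}"

definition Umat :: "nat \<Rightarrow> complex mat set" where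
  "Umat r = {E \<in> carrier_mat r r. mat_adjoint E * E = 1\<^sub>m r}"

definition sSU :: "nat \<Rightarrow> ('m::finite gel) monoid" where
  "sSU r = \<lparr> carrier = {(g, E). g \<in> Un1 \<and> E \<in> Umat r \<and> Determinants.det g = Determinant.det E},
             monoid.mult = (\<lambda>(g, E) (h, F). (g ** h, E * F)),
             one = (Finite_Cartesian_Product.mat 1, 1\<^sub>m r) \<rparr>"

text \<open>The type \<open>complex mat\<close> carries no topology; this is the topology of entrywise convergence
  on pairs of an \<open>(n + 1) \<times> (n + 1)\<close> and an \<open>r \<times> r\<close> matrix.\<close>

definition gel_top :: "nat \<Rightarrow> ('m::finite gel) topology" where
  "gel_top r = pullback_topology (UNIV \<times> carrier_mat r r)
     (\<lambda>(g, E). (g, \<lambda>i j. if i < r \<and> j < r then E $$ (i, j) else 0)) euclidean"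

definition lattice_sub :: "nat \<Rightarrow> ('m::finite gel) set \<Rightarrow> ('m gel) set \<Rightarrow> bool" where
  "lattice_sub r H \<Gamma> \<longleftrightarrow> lattice_in ((sSU r)\<lparr>carrier := H\<rparr>) (subtopology (gel_top r) H) \<Gamma>"

text \<open>The space \<open>\<Gamma> \ G\<close> of cosets \<open>\<Gamma> x\<close> with the quotient topology.\<close>

definition coset_space :: "nat \<Rightarrow> ('m::finite gel) set \<Rightarrow> (('m gel) set) topology" where
  "coset_space r \<Gamma> =
     quotient_top (subtopology (gel_top r) (carrier (sSU r))) (\<lambda>x. \<Gamma> #>\<^bsub>sSU r\<^esub> x)"

definition emb :: "nat \<Rightarrow> 'm::finite mat1 \<Rightarrow> 'm gel" where
  "emb r g = (g, 1\<^sub>m r)"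

definition Gprime :: "nat \<Rightarrow> ('m::finite gel) set" where
  "Gprime r = emb r ` {g \<in> Un1. Determinants.det g = 1}"

definition ZGprime :: "nat \<Rightarrow> ('m::finite gel) set" where
  "ZGprime r = {(Finite_Cartesian_Product.mat \<epsilon>, E) | \<epsilon> E.
     norm \<epsilon> = 1 \<and> E \<in> Umat r \<and> \<epsilon> ^ (CARD('m) + 2) = Determinant.det E}"

text \<open>Block matrices with block sizes \<open>n, 1\<close> and \<open>1, n - 1, 1\<close>.\<close>

definition blk2 :: "complex ^ ('m option) ^ ('m option) \<Rightarrow> complex ^ ('m option)
    \<Rightarrow> complex ^ ('m option) \<Rightarrow> complex \<Rightarrow> 'm::finite mat1" where
  "blk2 A b c d = (\<chi> i j. case i of
       Some i' \<Rightarrow> (case j of Some j' \<Rightarrow> A $ i' $ j' | None \<Rightarrow> b $ i')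
     | None \<Rightarrow> (case j of Some j' \<Rightarrow> c $ j' | None \<Rightarrow> d))"

definition blk3 :: "complex \<Rightarrow> complex ^ 'm \<Rightarrow> complex
    \<Rightarrow> complex ^ 'm \<Rightarrow> complex ^ 'm ^ 'm \<Rightarrow> complex ^ 'm
    \<Rightarrow> complex \<Rightarrow> complex ^ 'm \<Rightarrow> complex \<Rightarrow> 'm::finite mat1" where
  "blk3 a11 a12 a13 a21 a22 a23 a31 a32 a33 = (\<chi> i j. case i of
       Some None \<Rightarrow> (case j of Some None \<Rightarrow> a11 | Some (Some q) \<Rightarrow> a12 $ q | None \<Rightarrow> a13)
     | Some (Some p) \<Rightarrow>
         (case j of Some None \<Rightarrow> a21 $ p | Some (Some q) \<Rightarrow> a22 $ p $ q | None \<Rightarrow> a23 $ p)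
     | None \<Rightarrow> (case j of Some None \<Rightarrow> a31 | Some (Some q) \<Rightarrow> a32 $ q | None \<Rightarrow> a33))"

definition K_grp :: "nat \<Rightarrow> ('m::finite gel) set" where
  "K_grp r = {(blk2 A 0 0 d, E) | A d E.
     cadj A ** A = Finite_Cartesian_Product.mat 1 \<and> norm d = 1 \<and> E \<in> Umat r \<and>
     Determinants.det A * d = Determinant.det E}"

definition a_mat :: "real \<Rightarrow> 'm::finite mat1" where
  "a_mat t = blk3 (of_real (cosh t)) 0 (of_real (sinh t))
                  0 (Finite_Cartesian_Product.mat 1) 0
                  (of_real (sinh t)) 0 (of_real (cosh t))"

definition R_mat :: "'m::finite mat1" where
  "R_mat = blk3 (of_real (1 / sqrt 2)) 0 (of_real (1 / sqrt 2))
                0 (Finite_Cartesian_Product.mat 1) 0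
                (of_real (- 1 / sqrt 2)) 0 (of_real (1 / sqrt 2))"

text \<open>Here \<open>u\<^sup>* u\<close> is the square of the Euclidean norm of \<open>u\<close>.\<close>

definition n_mat :: "real \<Rightarrow> complex ^ 'm \<Rightarrow> 'm::finite mat1" where
  "n_mat lam u = blk3 1 (\<chi> j. cnj (u $ j)) (\<i> * of_real lam + of_real ((norm u)\<^sup>2) / 2)
                      0 (Finite_Cartesian_Product.mat 1) u
                      0 0 1"

definition A_gt :: "nat \<Rightarrow> real \<Rightarrow> ('m::finite gel) set" where
  "A_gt r t0 = {emb r (a_mat \<tau>) | \<tau>. \<tau> > t0}"

definition N_grp :: "nat \<Rightarrow> ('m::finite gel) set" where
  "N_grp r = {emb r (matrix_inv R_mat ** n_mat lam u ** R_mat) | lam u. True}"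

definition N'_grp :: "nat \<Rightarrow> ('m::finite gel) set" where
  "N'_grp r = {emb r (matrix_inv R_mat ** n_mat lam 0 ** R_mat) | lam. True}"

definition conj_grp :: "nat \<Rightarrow> 'm::finite gel \<Rightarrow> ('m gel) set \<Rightarrow> ('m gel) set" where
  "conj_grp r g \<Gamma> = {inv\<^bsub>sSU r\<^esub> g \<otimes>\<^bsub>sSU r\<^esub> \<gamma> \<otimes>\<^bsub>sSU r\<^esub> g | \<gamma>. \<gamma> \<in> \<Gamma>}"


section \<open>Fundamental domain data\<close>

definition Omega :: "nat \<Rightarrow> ('m::finite gel) set \<Rightarrow> real \<Rightarrow> ('m gel) set \<Rightarrow> ('m gel) set" where
  "Omega r \<eta> t0 \<Xi> =
     (\<Union>g\<in>\<Xi>. g <#\<^bsub>sSU r\<^esub> (\<eta> <#>\<^bsub>sSU r\<^esub> A_gt r t0 <#>\<^bsub>sSU r\<^esub> K_grp r))"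

definition fundamental_data ::
    "nat \<Rightarrow> ('m::finite gel) set \<Rightarrow> ('m gel) set \<Rightarrow> real \<Rightarrow> ('m gel) set \<Rightarrow> bool" where
  "fundamental_data r \<Gamma> \<eta> t0 \<Xi> \<longleftrightarrow>
     (let N = N_grp r; NT = subtopology (gel_top r) N;
          NZ = N <#>\<^bsub>sSU r\<^esub> ZGprime r; N'Z = N'_grp r <#>\<^bsub>sSU r\<^esub> ZGprime r;
          \<Omega> = Omega r \<eta> t0 \<Xi>
      in openin NT \<eta> \<and> compactin NT (NT closure_of \<eta>) \<and>
         finite \<Xi> \<and> \<Xi> \<subseteq> Gprime r \<and>
         (\<forall>g\<in>\<Xi>. lattice_sub r NZ (conj_grp r g \<Gamma> \<inter> NZ) \<and>
                 lattice_sub r N'Z (conj_grp r g \<Gamma> \<inter> N'Z) \<and>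
                 NZ = (conj_grp r g \<Gamma> \<inter> NZ) <#>\<^bsub>sSU r\<^esub> \<eta> <#>\<^bsub>sSU r\<^esub> ZGprime r) \<and>
         carrier (sSU r) = \<Gamma> <#>\<^bsub>sSU r\<^esub> \<Omega> \<and>
         finite {\<gamma> \<in> \<Gamma>. (\<gamma> <#\<^bsub>sSU r\<^esub> \<Omega>) \<inter> \<Omega> \<noteq> {}})"


section \<open>Holomorphic functions of several variables\<close>

text \<open>Frechet differentiable with complex linear derivative; \<open>smul\<close> is the complex scalar
  multiplication of the domain.\<close>

definition holo_on ::
    "(complex \<Rightarrow> 'a \<Rightarrow> 'a) \<Rightarrow> ('a::real_normed_vector \<Rightarrow> complex) \<Rightarrow> 'a set \<Rightarrow> bool" where
  "holo_on smul f S \<longleftrightarrow>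
     (\<forall>x\<in>S. \<exists>f'. (f has_derivative f') (at x) \<and> (\<forall>a v. f' (smul a v) = a * f' v))"

definition pt_smul :: "complex \<Rightarrow> 'm pt \<Rightarrow> 'm::finite pt" where
  "pt_smul a z = (a * fst z, a *s snd z)"


section \<open>Grassmann algebra\<close>

text \<open>A Grassmann element \<open>a = (\<Sum>I. a I \<zeta>^I)\<close> is the family of its coefficients. For disjoint
  \<open>I, J\<close> one has \<open>\<zeta>^I \<zeta>^J = (-1)^p \<zeta>^(I \<union> J)\<close>, where \<open>p\<close> is the number of pairs
  \<open>(i, j) \<in> I \<times> J\<close> with \<open>j < i\<close>.\<close>

type_synonym grassmann = "nat set \<Rightarrow> complex"

definition gr_mult :: "grassmann \<Rightarrow> grassmann \<Rightarrow> grassmann" where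
  "gr_mult a b = (\<lambda>K. \<Sum>I\<in>Pow K.
     (-1) ^ card {(i, j). i \<in> I \<and> j \<in> K - I \<and> j < i} * a I * b (K - I))"

definition gr_one :: grassmann where
  "gr_one = (\<lambda>I. if I = {} then 1 else 0)"

definition gr_gen :: "nat \<Rightarrow> grassmann" where
  "gr_gen j = (\<lambda>I. if I = {j} then 1 else 0)"

text \<open>The ordered product of the elements \<open>v i\<close>, \<open>i \<in> I\<close>.\<close>

definition gr_pow :: "(nat \<Rightarrow> grassmann) \<Rightarrow> nat set \<Rightarrow> grassmann" where
  "gr_pow v I = foldr gr_mult (map v (sorted_list_of_set I)) gr_one"

definition mat_gr :: "nat \<Rightarrow> complex mat \<Rightarrow> nat \<Rightarrow> grassmann" where
  "mat_gr r E i = (\<lambda>J. \<Sum>j<r. E $$ (i, j) * gr_gen j J)"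


section \<open>Super automorphic forms\<close>

definition ball_B :: "('m::finite pt) set" where
  "ball_B = {z. (norm (fst z))\<^sup>2 + (norm (snd z))\<^sup>2 < 1}"

definition H_dom :: "('m::finite pt) set" where
  "H_dom = {w. Re (fst w) > (norm (snd w))\<^sup>2 / 2}"

text \<open>With \<open>g = (A, b; c, d)\<close>, the homogeneous coordinates of \<open>g (z, 1)\<close> are
  \<open>(A z + b, c z + d)\<close>.\<close>

definition hcoord :: "'m::finite pt \<Rightarrow> complex ^ ('m option option)" where
  "hcoord z = (\<chi> i. case i of Some None \<Rightarrow> fst z | Some (Some p) \<Rightarrow> snd z $ p | None \<Rightarrow> 1)"

definition jfac :: "'m::finite mat1 \<Rightarrow> 'm pt \<Rightarrow> complex" where
  "jfac g z = inverse ((g *v hcoord z) $ None)"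

definition act :: "'m::finite mat1 \<Rightarrow> 'm pt \<Rightarrow> 'm pt" where
  "act g z = ((g *v hcoord z) $ Some None * jfac g z,
              \<chi> p. (g *v hcoord z) $ Some (Some p) * jfac g z)"

text \<open>A superfunction is a function with values in the Grassmann algebra on \<open>r\<close> generators.\<close>

type_synonym 'm sfun = "'m pt \<Rightarrow> grassmann"

definition sholo :: "nat \<Rightarrow> ('m::finite pt) set \<Rightarrow> ('m sfun) set" where
  "sholo r S = {f. (\<forall>I\<in>Pow {..<r}. holo_on pt_smul (\<lambda>z. f z I) S) \<and>
                   (\<forall>z\<in>S. \<forall>I. I \<notin> Pow {..<r} \<longrightarrow> f z I = 0)}"

definition slash :: "nat \<Rightarrow> int \<Rightarrow> 'm sfun \<Rightarrow> 'm::finite gel \<Rightarrow> 'm sfun" where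
  "slash r k f g z = (\<lambda>J. \<Sum>I\<in>Pow {..<r}.
     f (act (fst g) z) I * jfac (fst g) z powi (k + int (card I)) * gr_pow (mat_gr r (snd g)) I J)"

definition sM :: "nat \<Rightarrow> int \<Rightarrow> ('m::finite gel) set \<Rightarrow> ('m sfun) set" where
  "sM r k \<Gamma> = {f \<in> sholo r ball_B. \<forall>\<gamma>\<in>\<Gamma>. \<forall>z\<in>ball_B. slash r k f \<gamma> z = f z}"

definition slash_Rinv :: "nat \<Rightarrow> int \<Rightarrow> 'm sfun \<Rightarrow> 'm::finite sfun" where
  "slash_Rinv r k f w = (\<lambda>J. \<Sum>I\<in>Pow {..<r}.
     f (act (matrix_inv R_mat) w) I
       * (of_real (sqrt 2) / (1 + fst w)) powi (k + int (card I)) * gr_pow gr_gen I J)"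


section \<open>Fourier exponents and integrability\<close>

definition fourier_exps :: "real \<Rightarrow> real \<Rightarrow> real set" where
  "fourier_exps lam x = {(of_int l - x) / lam | l. True}"

text \<open>\<open>shift k chi d I\<close> is \<open>tr_I D + (k + |I|) \<chi>\<close> for the real diagonal matrix \<open>D\<close> with entries \<open>d j\<close>.\<close>

definition shift :: "int \<Rightarrow> real \<Rightarrow> (nat \<Rightarrow> real) \<Rightarrow> nat set \<Rightarrow> real" where
  "shift k chi d I = (\<Sum>j\<in>I. d j) + (of_int k + of_nat (card I)) * chi"

definition fourier_term :: "(real \<Rightarrow> complex ^ 'm \<Rightarrow> complex) \<Rightarrow> 'm::finite pt \<Rightarrow> real \<Rightarrow> complex" where
  "fourier_term c w m = c m (snd w) * exp (2 * of_real pi * of_real m * fst w)"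

definition fourier_expansion :: "nat \<Rightarrow> real \<Rightarrow> (nat set \<Rightarrow> real) \<Rightarrow>
    (nat set \<Rightarrow> 'm::finite pt \<Rightarrow> complex) \<Rightarrow>
    (nat set \<Rightarrow> real \<Rightarrow> complex ^ 'm \<Rightarrow> complex) \<Rightarrow> bool" where
  "fourier_expansion r lam x q c \<longleftrightarrow>
     (\<forall>I\<in>Pow {..<r}.
        (\<forall>m\<in>fourier_exps lam (x I). holo_on (*s) (c I m) UNIV) \<and>
        (\<forall>w\<in>H_dom. (fourier_term (c I) w has_sum q I w) (fourier_exps lam (x I))))"

definition Delta' :: "'m::finite pt \<Rightarrow> real" where
  "Delta' w = Re (fst w + cnj (fst w)) - (norm (snd w))\<^sup>2"

definition H_measure :: "('m::finite pt) measure" where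
  "H_measure = density lborel (\<lambda>w. ennreal (indicator H_dom w / Delta' w ^ (CARD('m) + 2)))"

definition in_Lp :: "ennreal \<Rightarrow> 'a measure \<Rightarrow> ('a \<Rightarrow> complex) \<Rightarrow> bool" where
  "in_Lp s M f \<longleftrightarrow> f \<in> borel_measurable M \<and>
     (if s = \<infinity> then \<exists>C::real. AE x in M. norm (f x) \<le> C
      else (\<integral>\<^sup>+ x. ennreal (norm (f x) powr enn2real s) \<partial>M) < \<infinity>)"

definition cusp_region :: "nat \<Rightarrow> ('m::finite gel) set \<Rightarrow> real \<Rightarrow> ('m pt) set" where
  "cusp_region r \<eta> t0 = act R_mat ` {act (fst x) (0, 0) | x. x \<in> \<eta> <#>\<^bsub>sSU r\<^esub> A_gt r t0}"

end

(*
  Conjugating the cusp to infinity by R, the components q_I of f|_g|_{R^-1} are holomorphic on H.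
  The element gamma_0 makes each q_I quasi-periodic under w_1 -> w_1 + i lambda_0, which gives the
  Fourier expansion in w_1. The cocompactness of g^-1 Gamma g in N Z(G') bounds q_I on every
  horosphere Delta' = t, because the mixing of the components by elements of Gamma is unitary and the
  factor of automorphy has modulus 1 there. Reading the coefficients off a horosphere gives
  |c_m(v)| <= C exp(-pi m (t + |v|^2)) with C independent of m and v. For m >= 0 Liouville's theorem
  applies (Koecher principle, n >= 2); for m <= 0 the same bound yields absolute and locally uniform
  convergence, and it shows that q_I - c_0 decays exponentially in Delta'. The cusp region is
  {(Im w_1, w_2) in V, Delta' > t_1} with V open and bounded; integrability over it is decided by
  covering it with, respectively packing it by, translates of one ball along the real w_1-axis, the
  measure of which is compared with sum 1/j^2, respectively sum 1/j.
*)
theory Submission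
  imports Defs "HOL-Complex_Analysis.Complex_Analysis" "HOL-Real_Asymp.Real_Asymp"
begin

section \<open>Fourier coefficients of quasi-periodic functions of one variable\<close>

text \<open>The horosphere bound comes without uniformity in the height t, and read off at the
  height of a point itself it gives no decay in m there. Every convergence argument therefore uses a
  lower horosphere and gains exp(pi m (Delta' - t)). So the formal series is known to be summable
  before its value is known. The value is found by contour integration: once the value at the point
  is subtracted, the terms with l >= 0 and those with l < 0 are geometric series on two vertical
  paths on either side of the point, and their sums cancel because the common integrand has a
  removable singularity there. Holomorphy in several variables means Frechet differentiability with
  complex linear derivative, without continuity of that derivative; Cauchy's estimate on complex
  lines supplies the uniform second-order bound for differentiating under the integral. The mixing
  by Gamma only has to be bounded, and a crude bound valid on all of U(r) suffices. The threshold k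
  + |I| >= 2n is where Delta'^n meets the density Delta'^-(n+1) and leaves the divergent
  1/Delta'.\<close>

lemma contour_integral_period_const:
  fixes S T :: "complex set" and \<tau> :: complex
  assumes S: "convex S" "open S" "F holomorphic_on S" and T: "convex T" "open T" "T \<subseteq> S"
    and shift: "\<And>z. z \<in> T \<Longrightarrow> z + \<tau> \<in> S" and per: "\<And>z. z \<in> T \<Longrightarrow> F (z + \<tau>) = F z"
    and zz: "z \<in> T" "z' \<in> T"
  shows "contour_integral (linepath z (z + \<tau>)) F = contour_integral (linepath z' (z' + \<tau>)) F"
proof -
  obtain P where P: "\<And>x. x \<in> S \<Longrightarrow> (P has_field_derivative F x) (at x within S)"
    using holomorphic_convex_primitive'[OF S] by blast
  have P': "(P has_field_derivative F x) (at x)" if "x \<in> S" for x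
    using P[OF that] at_within_open[OF that S(2)] by simp
  have eq: "contour_integral (linepath w (w + \<tau>)) F = P (w + \<tau>) - P w" if "w \<in> T" for w
  proof -
    have "closed_segment w (w + \<tau>) \<subseteq> S"
      using that T shift S(1) closed_segment_subset by blast
    then have "(F has_contour_integral (P (pathfinish (linepath w (w + \<tau>))) - P (pathstart (linepath w (w + \<tau>)))))
        (linepath w (w + \<tau>))"
      by (intro contour_integral_primitive[of S, OF P]) auto
    then show ?thesis by (simp add: contour_integral_unique)
  qed
  \<comment> \<open>A period integral is an increment of the primitive, and the derivative
    \<open>F (w + \<tau>) - F w\<close> of that increment vanishes on \<open>T\<close>. Keeping
    \<open>T\<close> smaller than \<open>S\<close> admits an integrand that is holomorphic only on a
    strip around one zero of a denominator.\<close>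
  have "((\<lambda>w. P (w + \<tau>) - P w) has_field_derivative 0) (at w within T)" if "w \<in> T" for w
  proof -
    have "((\<lambda>w. P (w + \<tau>)) has_field_derivative F (w + \<tau>)) (at w)"
      using P'[OF shift[OF that]] by (simp add: DERIV_shift)
    moreover have "(P has_field_derivative F w) (at w)" using P' that T by blast
    ultimately have "((\<lambda>w. P (w + \<tau>) - P w) has_field_derivative F (w + \<tau>) - F w) (at w)"
      by (rule DERIV_diff)
    then show ?thesis using per[OF that] by (simp add: has_field_derivative_at_within)
  qed
  from has_field_derivative_zero_constant[OF T(1) this]
  show ?thesis using zz eq by force
qed

text \<open>On a path where the ratio has constant modulus below 1 the geometric series converges
  uniformly, so it may be integrated term by term.\<close>

lemma contour_integral_geometric_sums:
  fixes \<phi> u :: "complex \<Rightarrow> complex"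
  assumes cont: "continuous_on (closed_segment a b) \<phi>" "continuous_on (closed_segment a b) u"
    and u: "\<And>s. s \<in> closed_segment a b \<Longrightarrow> norm (u s) = \<rho>" and \<rho>: "\<rho> < 1"
  shows "(\<lambda>l. contour_integral (linepath a b) (\<lambda>s. \<phi> s * u s ^ l)) sums
           contour_integral (linepath a b) (\<lambda>s. \<phi> s / (1 - u s))"
proof -
  let ?K = "closed_segment a b"
  have \<rho>0: "0 \<le> \<rho>" using u[of a] norm_ge_zero[of "u a"] by simp
  have "bounded (\<phi> ` ?K)"
    using cont(1) by (intro compact_imp_bounded compact_continuous_image) auto
  then obtain C where C: "\<And>s. s \<in> ?K \<Longrightarrow> norm (\<phi> s) \<le> C" unfolding bounded_iff by auto
  have ul: "uniform_limit ?K (\<lambda>n s. \<Sum>i<n. \<phi> s * u s ^ i) (\<lambda>s. \<Sum>i. \<phi> s * u s ^ i) sequentially"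
  proof (rule Weierstrass_m_test)
    show "norm (\<phi> s * u s ^ n) \<le> C * \<rho> ^ n" if "s \<in> ?K" for n s
      using C[OF that] u[OF that] \<rho>0 by (simp add: norm_mult norm_power mult_right_mono)
    show "summable (\<lambda>n. C * \<rho> ^ n)" using \<rho> \<rho>0 by (intro summable_mult summable_geometric) auto
  qed
  have eq: "(\<Sum>i. \<phi> s * u s ^ i) = \<phi> s / (1 - u s)" if "s \<in> ?K" for s
    using u[OF that] \<rho> by (simp add: suminf_mult summable_geometric suminf_geometric)
  have ul2: "uniform_limit ?K (\<lambda>n s. \<Sum>i<n. \<phi> s * u s ^ i) (\<lambda>s. \<phi> s / (1 - u s)) sequentially"
    using ul eq by (simp cong: uniform_limit_cong')
  have ci: "(\<lambda>s. \<phi> s * u s ^ i) contour_integrable_on linepath a b" for i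
    using cont by (intro contour_integrable_continuous_linepath continuous_intros) auto
  have "(\<lambda>n. contour_integral (linepath a b) (\<lambda>s. \<Sum>i<n. \<phi> s * u s ^ i)) \<longlonglongrightarrow>
      contour_integral (linepath a b) (\<lambda>s. \<phi> s / (1 - u s))"
  proof (rule contour_integral_uniform_limit(2))
    show "\<forall>\<^sub>F n in sequentially. (\<lambda>s. \<Sum>i<n. \<phi> s * u s ^ i) contour_integrable_on linepath a b"
      using ci by (intro always_eventually allI contour_integrable_sum) auto
    show "uniform_limit (path_image (linepath a b)) (\<lambda>n s. \<Sum>i<n. \<phi> s * u s ^ i) (\<lambda>s. \<phi> s / (1 - u s)) sequentially"
      using ul2 by simp
    show "norm (vector_derivative (linepath a b) (at t)) \<le> norm (b - a)" for t by simp
  qed auto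
  then show ?thesis
    unfolding sums_def using ci by (subst (asm) contour_integral_sum) auto
qed

text \<open>The mean over one vertical period. Dividing by the increment of the path makes the
  formula right for either sign of \<open>lam\<close>; independence of the base point holds for
  quasi-periodic functions and admissible \<open>m\<close>.\<close>

definition fourier_coeff :: "real \<Rightarrow> real \<Rightarrow> (complex \<Rightarrow> complex) \<Rightarrow> complex \<Rightarrow> complex" where
  "fourier_coeff lam m F z =
     contour_integral (linepath z (z + \<i> * of_real lam)) (\<lambda>s. F s * exp (- (2 * of_real pi * of_real m * s)))
       / (\<i> * of_real lam)"

lemma Re_closed_segment_vertical:
  assumes "s \<in> closed_segment z (z + \<i> * of_real lam)"
  shows "Re s = Re z"
  using assms by (auto simp: closed_segment_def algebra_simps)

lemma norm_fourier_coeff_le: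
  assumes cont: "continuous_on (closed_segment z (z + \<i> * of_real lam)) F" and lam: "lam \<noteq> 0"
    and C: "\<And>s. s \<in> closed_segment z (z + \<i> * of_real lam) \<Longrightarrow> norm (F s) \<le> C"
  shows "norm (fourier_coeff lam m F z) \<le> C * exp (- (2 * pi * m * Re z))"
proof -
  let ?f = "\<lambda>s. F s * exp (- (2 * of_real pi * of_real m * s))"
  let ?L = "linepath z (z + \<i> * of_real lam)"
  have C0: "0 \<le> C" using C[of z] by (simp add: order_trans[OF norm_ge_zero])
  have "(?f has_contour_integral contour_integral ?L ?f) ?L"
    using cont by (intro has_contour_integral_integral contour_integrable_continuous_linepath continuous_intros)
  then have "norm (contour_integral ?L ?f) \<le> (C * exp (- (2 * pi * m * Re z))) * norm (z + \<i> * of_real lam - z)"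
  proof (rule has_contour_integral_bound_linepath)
    show "0 \<le> C * exp (- (2 * pi * m * Re z))" using C0 by simp
    fix s assume s: "s \<in> closed_segment z (z + \<i> * of_real lam)"
    have "norm (exp (- (2 * of_real pi * of_real m * s))) = exp (- (2 * pi * m * Re z))"
      using Re_closed_segment_vertical[OF s] by simp
    then show "norm (?f s) \<le> C * exp (- (2 * pi * m * Re z))"
      using C[OF s] by (simp only: norm_mult mult_right_mono exp_ge_zero)
  qed
  then show ?thesis
    unfolding fourier_coeff_def using lam by (simp add: norm_divide norm_mult field_simps)
qed

lemma exp_int_period: "exp (2 * of_real pi * \<i> * of_int l) = (1::complex)"
  using exp_2pi_1_int[of l] by (simp add: mult_ac)

text \<open>Orthogonality of the exponentials: for l nonzero the primitive takes equal values at the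
  two ends of a period.\<close>

lemma contour_integral_exp_period:
  fixes l :: int
  assumes lam: "lam \<noteq> 0"
  shows "contour_integral (linepath z (z + \<i> * of_real lam)) (\<lambda>s. exp (2 * of_real pi * of_int l * s / of_real lam))
     = (if l = 0 then \<i> * of_real lam else 0)"
proof (cases "l = 0")
  case False
  let ?k = "2 * of_real pi * of_int l / of_real lam :: complex"
  have k: "?k \<noteq> 0" using False lam by simp
  have per: "exp (?k * (z + \<i> * of_real lam)) = exp (?k * z)"
  proof -
    have "?k * (z + \<i> * of_real lam) = ?k * z + 2 * of_real pi * \<i> * of_int l"
      using lam by (simp add: field_simps)
    then show ?thesis by (simp add: exp_add exp_int_period)
  qed
  have "((\<lambda>s. exp (?k * s)) has_contour_integral
     (exp (?k * pathfinish (linepath z (z + \<i> * of_real lam))) / ?k - exp (?k * pathstart (linepath z (z + \<i> * of_real lam))) / ?k))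
     (linepath z (z + \<i> * of_real lam))"
  proof (rule contour_integral_primitive[of UNIV "\<lambda>s. exp (?k * s) / ?k"])
    fix x :: complex
    show "((\<lambda>s. exp (?k * s) / ?k) has_field_derivative exp (?k * x)) (at x within UNIV)"
      using k by (auto intro!: derivative_eq_intros)
  qed auto
  then have "contour_integral (linepath z (z + \<i> * of_real lam)) (\<lambda>s. exp (?k * s)) = 0"
    using per by (simp add: contour_integral_unique)
  then show ?thesis using False by (simp add: field_simps)
qed simp

lemma bij_int_nonneg: "bij_betw int UNIV {0..}"
  by (rule bij_betwI[where g=nat]) auto

lemma bij_int_neg: "bij_betw (\<lambda>n. - int n - 1) UNIV {..<0}"
  by (rule bij_betwI[where g="\<lambda>l. nat (- l - 1)"]) auto

lemma fourier_exps_bij: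
  "lam \<noteq> 0 \<Longrightarrow> bij_betw (\<lambda>l::int. (of_int l - x) / lam) UNIV (fourier_exps lam x)"
  unfolding bij_betw_def fourier_exps_def by (auto simp: inj_on_def)

text \<open>Fourier inversion at a zero of a periodic function. Each term can be integrated over any
  vertical path. The terms with l >= 0 are summed on the side of \<open>z0\<close> where |u| < 1,
  those with l < 0 on the side where |1/u| < 1. They give the integral of \<phi>/(1 - u) with
  opposite signs, and since \<phi> vanishes at \<open>z0\<close> this quotient has no pole between
  the two paths.\<close>

lemma contour_integral_geometric_int_has_sum:
  fixes b lam :: real and \<phi> :: "complex \<Rightarrow> complex" and z0 :: complex
  defines "B \<equiv> \<lambda>z (l::int). contour_integral (linepath z (z + \<i> * of_real lam))
              (\<lambda>s. \<phi> s * exp (2 * of_real pi * of_int l * (z0 - s) / of_real lam))"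
  assumes lam: "lam \<noteq> 0"
    and holo: "\<phi> holomorphic_on {z. Re z > b}"
    and per: "\<And>z. Re z > b \<Longrightarrow> \<phi> (z + \<i> * of_real lam) = \<phi> z"
    and z0: "Re z0 > b" "\<phi> z0 = 0" and z1: "Re z1 > b"
    and summ: "B z1 summable_on UNIV"
  shows "(B z1 has_sum 0) UNIV"
proof -
  let ?H = "{z. Re z > b}" and ?il = "\<i> * of_real lam :: complex"
  have H: "open ?H" "convex ?H" by (auto simp: open_halfspace_Re_gt convex_halfspace_Re_gt)
  define u where "u = (\<lambda>s::complex. exp (2 * of_real pi * (z0 - s) / of_real lam))"
  have u_holo: "u holomorphic_on A" for A unfolding u_def by (intro holomorphic_intros) (use lam in auto)
  have u_per: "u (s + ?il) = u s" for s
  proof -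
    have "2 * of_real pi * (z0 - (s + ?il)) / of_real lam
       = 2 * of_real pi * (z0 - s) / of_real lam + 2 * of_real pi * \<i> * of_int (-1)"
      using lam by (simp add: field_simps)
    then show ?thesis unfolding u_def by (simp only: exp_add exp_int_period mult_1_right)
  qed
  have u_pow: "u s ^ n = exp (2 * of_real pi * of_int (int n) * (z0 - s) / of_real lam)" for s n
    unfolding u_def by (simp add: exp_of_nat_mult [symmetric] field_simps)
  have u_inv_pow: "inverse (u s) ^ n = exp (2 * of_real pi * of_int (- int n) * (z0 - s) / of_real lam)" for s n
    using u_pow[of s n] by (simp add: power_inverse exp_minus)
  have norm_u: "norm (u s) = exp (2 * pi * (Re z0 - Re s) / lam)" for s
    unfolding u_def by simp
  have u_z0: "u z0 = 1" by (simp add: u_def)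
  have u_nz: "u s \<noteq> 0" for s by (simp add: u_def)
  \<comment> \<open>The zeros of 1 - u are the translates of \<open>z0\<close> by integer multiples
    of i \<open>lam\<close>, so only \<open>z0\<close> itself has imaginary part this close to that
    of \<open>z0\<close>.\<close>
  have u_1: "s = z0" if us: "u s = 1" and "\<bar>Im s - Im z0\<bar> < \<bar>lam\<bar>" for s
  proof -
    let ?X = "2 * of_real pi * (z0 - s) / of_real lam :: complex"
    have X: "Re ?X = 2 * pi * (Re z0 - Re s) / lam" "Im ?X = 2 * pi * (Im z0 - Im s) / lam"
      by (simp_all add: Re_divide_of_real Im_divide_of_real)
    obtain n :: int where n: "Re ?X = 0" "Im ?X = of_int (2 * n) * pi"
      using us unfolding u_def exp_eq_1 by blast
    have "Re z0 - Re s = 0" using n(1) X(1) lam by simp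
    moreover have "Im z0 - Im s = of_int n * lam"
    proof -
      have "2 * pi * (Im z0 - Im s) = 2 * pi * (of_int n * lam)"
        using n(2) X(2) lam by (simp add: field_simps)
      then show ?thesis by (simp only: mult_cancel_left) simp
    qed
    moreover from this that(2) have "\<bar>of_int n\<bar> * \<bar>lam\<bar> < 1 * \<bar>lam\<bar>"
      by (simp add: abs_mult[symmetric] abs_minus_commute)
    then have "n = 0" using lam by (simp only: mult_less_cancel_right) linarith
    ultimately show ?thesis by (simp add: complex_eq_iff)
  qed
  have B_const: "B z l = B z' l" if "Re z > b" "Re z' > b" for z z' l
    unfolding B_def
  proof (rule contour_integral_period_const[OF H(2,1) _ H(2,1)])
    show "(\<lambda>s. \<phi> s * exp (2 * of_real pi * of_int l * (z0 - s) / of_real lam)) holomorphic_on ?H"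
      using lam by (intro holomorphic_intros holo) auto
    fix z assume "z \<in> ?H"
    then have "\<phi> (z + ?il) = \<phi> z" using per by auto
    moreover have "2 * of_real pi * of_int l * (z0 - (z + ?il)) / of_real lam
       = 2 * of_real pi * of_int l * (z0 - z) / of_real lam + 2 * of_real pi * \<i> * of_int (-l)"
      using lam by (simp add: field_simps)
    ultimately show "\<phi> (z + ?il) * exp (2 * of_real pi * of_int l * (z0 - (z + ?il)) / of_real lam)
       = \<phi> z * exp (2 * of_real pi * of_int l * (z0 - z) / of_real lam)"
      by (simp only: exp_add exp_int_period mult_1_right)
  qed (use that in auto)
  \<comment> \<open>In the strip \<open>S\<close> the point \<open>z0\<close> is the only zero of 1
    - u. The starting points in \<open>T\<close> lie about half a period away from \<open>z0\<close>
    vertically, so that \<open>T\<close> and its translate by one period both stay in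
    \<open>S\<close> and avoid \<open>z0\<close>.\<close>
  define S where "S = {z. Re z > b} \<inter> {z. Im z > Im z0 - \<bar>lam\<bar>} \<inter> {z. Im z < Im z0 + \<bar>lam\<bar>}"
  define T where "T = {z. Re z > b} \<inter> {z. Im z > Im z0 - lam / 2 - \<bar>lam\<bar> / 4} \<inter> {z. Im z < Im z0 - lam / 2 + \<bar>lam\<bar> / 4}"
  have S: "convex S" "open S" unfolding S_def
    by (intro convex_Int open_Int convex_halfspace_Re_gt convex_halfspace_Im_gt convex_halfspace_Im_lt open_halfspace_Re_gt open_halfspace_Im_gt open_halfspace_Im_lt)+
  have T: "convex T" "open T" unfolding T_def
    by (intro convex_Int open_Int convex_halfspace_Re_gt convex_halfspace_Im_gt convex_halfspace_Im_lt open_halfspace_Re_gt open_halfspace_Im_gt open_halfspace_Im_lt)+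
  have TS: "T \<subseteq> S" "\<And>z. z \<in> T \<Longrightarrow> z + ?il \<in> S" "z0 \<notin> T" "z0 - ?il \<notin> T"
    using lam unfolding S_def T_def by (auto simp: abs_if split: if_splits)
  \<comment> \<open>This is \<phi>/(1 - u) with the singularity removed: numerator and denominator
    are each divided by z - \<open>z0\<close> and completed by a derivative, and the completed
    denominator is nonzero at \<open>z0\<close> because its value there is 2 pi /
    \<open>lam\<close>.\<close>
  define G where "G = (\<lambda>z. (if z = z0 then deriv \<phi> z0 else (\<phi> z - \<phi> z0) / (z - z0))
       / (if z = z0 then deriv (\<lambda>z. 1 - u z) z0 else ((1 - u z) - (1 - u z0)) / (z - z0)))"
  have G_eq: "G z = \<phi> z / (1 - u z)" if "z \<noteq> z0" for z
    using that by (simp add: G_def z0 u_z0)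
  have \<phi>_S: "\<phi> holomorphic_on S" by (rule holomorphic_on_subset[OF holo]) (auto simp: S_def)
  have u_S: "(\<lambda>z. 1 - u z) holomorphic_on S" by (rule holomorphic_on_diff[OF holomorphic_on_const u_holo])
  have "((\<lambda>z. 1 - u z) has_field_derivative 2 * of_real pi / of_real lam) (at z0)"
    unfolding u_def using lam by (auto intro!: derivative_eq_intros)
  then have du: "deriv (\<lambda>z. 1 - u z) z0 = 2 * of_real pi / of_real lam" by (rule DERIV_imp_deriv)
  have nz: "(if z = z0 then deriv (\<lambda>z. 1 - u z) z0 else ((1 - u z) - (1 - u z0)) / (z - z0)) \<noteq> 0"
    if "z \<in> S" for z
  proof (cases "z = z0")
    case True
    then show ?thesis using du lam by simp
  next
    case False
    then have "u z \<noteq> 1" using u_1[of z] that unfolding S_def by (auto simp: abs_less_iff)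
    then show ?thesis using False u_z0 by simp
  qed
  have G_holo: "G holomorphic_on S"
    unfolding G_def
    by (rule holomorphic_on_divide[OF pole_lemma_open[OF \<phi>_S S(2)] pole_lemma_open[OF u_S S(2)] nz])
  have G_per: "G (z + ?il) = G z" if "z \<in> T" for z
  proof -
    have "z \<noteq> z0" "z + ?il \<noteq> z0" using that TS(3,4) by force+
    moreover have "Re z > b" using that by (simp add: T_def)
    ultimately show ?thesis using per u_per by (simp add: G_eq)
  qed
  have G_const: "contour_integral (linepath z (z + ?il)) G = contour_integral (linepath z' (z' + ?il)) G"
    if "z \<in> T" "z' \<in> T" for z z'
    by (rule contour_integral_period_const[OF S G_holo T TS(1,2) G_per that])
  \<comment> \<open>Half the distance from \<open>z0\<close> to the boundary of the half-plane, in
    units of |lam|, so both shifted paths stay inside. The shifts in \<open>za\<close> and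
    \<open>zb\<close> carry the sign of \<open>lam\<close>, which makes |u| = exp(-2 pi \<delta>) on
    the first path for either sign; subtracting half a period centres the paths at the height of
    \<open>z0\<close>.\<close>
  define \<delta> where "\<delta> = (Re z0 - b) / (2 * \<bar>lam\<bar>)"
  have \<delta>: "\<delta> > 0" "\<delta> * \<bar>lam\<bar> = (Re z0 - b) / 2" using z0 lam by (auto simp: \<delta>_def)
  define za where "za = z0 + of_real (\<delta> * lam) - ?il / 2"
  define zb where "zb = z0 - of_real (\<delta> * lam) - ?il / 2"
  have \<delta>lam: "\<bar>\<delta> * lam\<bar> < Re z0 - b" using \<delta> z0 by (simp add: abs_mult)
  have zaT: "za \<in> T" and zbT: "zb \<in> T" using \<delta>lam lam unfolding za_def zb_def T_def by (auto simp: abs_if split: if_splits)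
  have Re: "Re za = Re z0 + \<delta> * lam" "Re zb = Re z0 - \<delta> * lam" by (auto simp: za_def zb_def)
  have Reb: "Re za > b" "Re zb > b" using zaT zbT by (auto simp: T_def)
  have ne: "s \<noteq> z0" if "s \<in> closed_segment za (za + ?il) \<or> s \<in> closed_segment zb (zb + ?il)" for s
  proof -
    have "Re s = Re za \<or> Re s = Re zb" using that Re_closed_segment_vertical by blast
    then show ?thesis using Re \<delta> lam by auto
  qed
  define \<rho> where "\<rho> = exp (- (2 * pi * \<delta>))"
  have \<rho>: "\<rho> < 1" using \<delta> by (simp add: \<rho>_def)
  have segH: "closed_segment z (z + ?il) \<subseteq> ?H" if "Re z > b" for z
  proof
    fix s assume "s \<in> closed_segment z (z + ?il)"
    then have "Re s = Re z" by (rule Re_closed_segment_vertical)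
    then show "s \<in> ?H" using that by simp
  qed
  have cont_\<phi>: "continuous_on (closed_segment z (z + ?il)) \<phi>" if "Re z > b" for z
    by (rule holomorphic_on_imp_continuous_on[OF holomorphic_on_subset[OF holo segH[OF that]]])
  have cont_u: "continuous_on A u" for A by (rule holomorphic_on_imp_continuous_on[OF u_holo])
  have cont_inv: "continuous_on A (\<lambda>s. inverse (u s))" for A
    by (rule continuous_on_inverse[OF cont_u]) (simp add: u_nz)
  have "(\<lambda>n. contour_integral (linepath za (za + ?il)) (\<lambda>s. \<phi> s * u s ^ n)) sums
           contour_integral (linepath za (za + ?il)) (\<lambda>s. \<phi> s / (1 - u s))"
  proof (rule contour_integral_geometric_sums[OF _ _ _ \<rho>])
    fix s assume "s \<in> closed_segment za (za + ?il)"
    then have "Re s = Re za" by (rule Re_closed_segment_vertical)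
    then have "Re s = Re z0 + \<delta> * lam" using Re by simp
    then show "norm (u s) = \<rho>" using lam by (simp add: norm_u \<rho>_def)
  qed (simp_all add: cont_\<phi> cont_u Reb)
  moreover have "contour_integral (linepath za (za + ?il)) (\<lambda>s. \<phi> s / (1 - u s)) = contour_integral (linepath za (za + ?il)) G"
    by (rule contour_integral_cong) (simp_all add: G_eq ne)
  moreover have "contour_integral (linepath za (za + ?il)) (\<lambda>s. \<phi> s * u s ^ n) = B z1 (int n)" for n
    using B_const[OF Reb(1) z1, of "int n"] by (simp add: B_def u_pow)
  ultimately have s1: "(\<lambda>n. B z1 (int n)) sums contour_integral (linepath za (za + ?il)) G" by simp
  \<comment> \<open>The extra factor 1/u turns n >= 0 into the exponent -n - 1, so that l = 0 is
    counted only once; the geometric sum becomes (\<phi>/u)/(1 - 1/u) = -\<phi>/(1 - u).\<close>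
  have "(\<lambda>n. contour_integral (linepath zb (zb + ?il)) (\<lambda>s. (\<phi> s * inverse (u s)) * inverse (u s) ^ n)) sums
           contour_integral (linepath zb (zb + ?il)) (\<lambda>s. (\<phi> s * inverse (u s)) / (1 - inverse (u s)))"
  proof (rule contour_integral_geometric_sums[OF _ _ _ \<rho>])
    fix s assume "s \<in> closed_segment zb (zb + ?il)"
    then have "Re s = Re zb" by (rule Re_closed_segment_vertical)
    then have "Re s = Re z0 - \<delta> * lam" using Re by simp
    then show "norm (inverse (u s)) = \<rho>" using lam by (simp add: norm_inverse norm_u \<rho>_def exp_minus)
  qed (simp_all add: cont_\<phi> cont_inv Reb continuous_on_mult)
  moreover have "contour_integral (linepath zb (zb + ?il)) (\<lambda>s. (\<phi> s * inverse (u s)) / (1 - inverse (u s)))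
      = contour_integral (linepath zb (zb + ?il)) (\<lambda>s. - G s)"
  proof (rule contour_integral_cong)
    fix s assume "s \<in> path_image (linepath zb (zb + ?il))"
    then have "s \<noteq> z0" using ne by auto
    have "- (\<phi> s / (1 - u s)) = (\<phi> s * inverse (u s)) / (1 - inverse (u s))"
      using u_nz[of s] by (cases "u s = 1") (auto simp: field_simps)
    with G_eq[OF \<open>s \<noteq> z0\<close>] show "(\<phi> s * inverse (u s)) / (1 - inverse (u s)) = - G s" by simp
  qed simp
  moreover have "contour_integral (linepath zb (zb + ?il)) (\<lambda>s. (\<phi> s * inverse (u s)) * inverse (u s) ^ n)
      = B z1 (- int n - 1)" for n
  proof -
    have *: "- int (Suc n) = - int n - 1" by simp
    show ?thesis
      using B_const[OF Reb(2) z1, of "- int n - 1"] u_inv_pow[of _ "Suc n"]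
      unfolding * B_def by (simp only: mult.assoc power_Suc)
  qed
  ultimately have s2: "(\<lambda>n. B z1 (- int n - 1)) sums - contour_integral (linepath zb (zb + ?il)) G"
    by (simp only: contour_integral_neg)
  \<comment> \<open>Unconditional summability allows the sum over the integers to be cut into two
    halves, and each half must agree with its ordinary series.\<close>
  obtain c1 where c1: "(B z1 has_sum c1) {0..}"
    using summ summable_on_subset_banach[of "B z1" UNIV "{0..}"] by (auto simp: summable_on_def)
  obtain c2 where c2: "(B z1 has_sum c2) {..<0}"
    using summ summable_on_subset_banach[of "B z1" UNIV "{..<0}"] by (auto simp: summable_on_def)
  have "c1 = contour_integral (linepath za (za + ?il)) G"
    using has_sum_imp_sums[of "\<lambda>n. B z1 (int n)" c1] c1 s1
    by (simp add: has_sum_reindex_bij_betw[OF bij_int_nonneg, of "B z1" c1] sums_unique2)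
  moreover have "c2 = - contour_integral (linepath zb (zb + ?il)) G"
    using has_sum_imp_sums[of "\<lambda>n. B z1 (- int n - 1)" c2] c2 s2
    by (simp add: has_sum_reindex_bij_betw[OF bij_int_neg, of "B z1" c2] sums_unique2)
  moreover have "(B z1 has_sum (c1 + c2)) ({0..} \<union> {..<0})" using c1 c2 by (intro has_sum_Un_disjoint) auto
  moreover have "{0::int..} \<union> {..<0} = UNIV" by auto
  ultimately show ?thesis using G_const[OF zaT zbT] by simp
qed

section \<open>Fourier expansion of a quasi-periodic function on a half-plane\<close>

lemma Re_halfspace_vertical_subset:
  assumes "Re z > b"
  shows "closed_segment z (z + \<i> * of_real lam) \<subseteq> {z. Re z > b}"
proof
  fix s assume "s \<in> closed_segment z (z + \<i> * of_real lam)"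
  then have "Re s = Re z" by (rule Re_closed_segment_vertical)
  then show "s \<in> {z. Re z > b}" using assms by simp
qed

locale quasi_periodic =
  fixes b lam x :: real and F :: "complex \<Rightarrow> complex"
  assumes lam: "lam \<noteq> 0"
    and holo: "F holomorphic_on {z. Re z > b}"
    and quasi_per: "\<And>z. Re z > b \<Longrightarrow> F (z + \<i> * of_real lam) = exp (- (2 * of_real pi * \<i> * of_real x)) * F z"
begin

text \<open>For an admissible exponent the factor exp(-2 pi m s) picks up exactly the inverse of the
  phase of \<open>F\<close> over one period, so the integrand is periodic and the path can be
  moved.\<close>

lemma fourier_coeff_const:
  assumes "Re z > b" "Re z' > b" "m \<in> fourier_exps lam x"
  shows "fourier_coeff lam m F z = fourier_coeff lam m F z'"
proof -
  obtain l :: int where l: "m = (of_int l - x) / lam" using assms(3) by (auto simp: fourier_exps_def)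
  have "contour_integral (linepath z (z + \<i> * of_real lam)) (\<lambda>s. F s * exp (- (2 * of_real pi * of_real m * s)))
     = contour_integral (linepath z' (z' + \<i> * of_real lam)) (\<lambda>s. F s * exp (- (2 * of_real pi * of_real m * s)))"
  proof (rule contour_integral_period_const[OF convex_halfspace_Re_gt open_halfspace_Re_gt _ convex_halfspace_Re_gt open_halfspace_Re_gt])
    show "(\<lambda>s. F s * exp (- (2 * of_real pi * of_real m * s))) holomorphic_on {z. Re z > b}"
      by (intro holomorphic_on_mult holo holomorphic_intros)
    fix w assume w: "w \<in> {z. Re z > b}"
    have "- (2 * of_real pi * of_real m * (w + \<i> * of_real lam))
       = (- (2 * of_real pi * of_real m * w) + 2 * of_real pi * \<i> * of_real x) + 2 * of_real pi * \<i> * of_int (- l)"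
      using lam unfolding l by (simp add: field_simps)
    then have "exp (- (2 * of_real pi * of_real m * (w + \<i> * of_real lam)))
       = exp (- (2 * of_real pi * of_real m * w)) * exp (2 * of_real pi * \<i> * of_real x)"
      by (simp only: exp_add exp_int_period mult_1_right)
    then show "F (w + \<i> * of_real lam) * exp (- (2 * of_real pi * of_real m * (w + \<i> * of_real lam)))
      = F w * exp (- (2 * of_real pi * of_real m * w))"
      using quasi_per[of w] w by (simp add: exp_minus)
  qed (use assms in auto)
  then show ?thesis by (simp add: fourier_coeff_def)
qed

lemma norm_fourier_coeff_le':
  assumes z: "Re z > b" and C: "\<And>s. Re s = Re z \<Longrightarrow> norm (F s) \<le> C"
  shows "norm (fourier_coeff lam m F z) \<le> C * exp (- (2 * pi * m * Re z))"
proof (rule norm_fourier_coeff_le[OF _ lam])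
  show "continuous_on (closed_segment z (z + \<i> * of_real lam)) F"
    by (rule holomorphic_on_imp_continuous_on[OF holomorphic_on_subset[OF holo Re_halfspace_vertical_subset[OF z]]])
  show "norm (F s) \<le> C" if "s \<in> closed_segment z (z + \<i> * of_real lam)" for s
    by (rule C[OF Re_closed_segment_vertical[OF that]])
qed

text \<open>The moduli of the terms depend only on Re s, so summability at one point of a vertical
  line yields uniform convergence on a whole period, and integration term by term isolates one
  coefficient by orthogonality.\<close>

lemma fourier_coeff_unique:
  assumes z: "Re z > b" and m: "m \<in> fourier_exps lam x"
    and sum: "\<And>s. Re s = Re z \<Longrightarrow> ((\<lambda>m. c m * exp (2 * of_real pi * of_real m * s)) has_sum F s) (fourier_exps lam x)"
  shows "c m = fourier_coeff lam m F z"
proof -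
  let ?X = "fourier_exps lam x" and ?L = "linepath z (z + \<i> * of_real lam)"
  let ?K = "closed_segment z (z + \<i> * of_real lam)"
  let ?t = "\<lambda>m' s. c m' * exp (2 * of_real pi * of_real m' * s) * exp (- (2 * of_real pi * of_real m * s))"
  let ?f = "\<lambda>s. F s * exp (- (2 * of_real pi * of_real m * s))"
  have Re_K: "Re s = Re z" if "s \<in> ?K" for s by (rule Re_closed_segment_vertical[OF that])
  have ul: "uniform_limit ?K (\<lambda>A s. \<Sum>m'\<in>A. ?t m' s) ?f (finite_subsets_at_top ?X)"
  proof (rule Weierstrass_m_test_general')
    fix m' s assume "s \<in> ?K"
    then show "norm (?t m' s) \<le> norm (?t m' z)" using Re_K[of s] by (simp add: norm_mult)
  next
    fix s assume "s \<in> ?K"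
    then show "((\<lambda>m'. ?t m' s) has_sum ?f s) ?X" by (intro has_sum_cmult_left sum Re_K)
  next
    have "(\<lambda>m'. ?t m' z) summable_on ?X"
      using has_sum_imp_summable[OF sum[OF refl]] by (intro summable_on_cmult_left)
    then show "(\<lambda>m'. norm (?t m' z)) summable_on ?X" by (simp add: summable_on_iff_abs_summable_on_complex)
  qed
  have t_int: "?t m' contour_integrable_on ?L" for m'
    by (intro contour_integrable_continuous_linepath continuous_intros)
  have ct: "contour_integral ?L (?t m') = (if m' = m then c m * \<i> * of_real lam else 0)" if "m' \<in> ?X" for m'
  proof -
    obtain l :: int where l1: "m = (of_int l - x) / lam" using m by (auto simp: fourier_exps_def)
    obtain l' :: int where l2: "m' = (of_int l' - x) / lam" using \<open>m' \<in> ?X\<close> by (auto simp: fourier_exps_def)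
    note l = l1 l2
    have teq: "?t m' s = c m' * exp (2 * of_real pi * of_int (l' - l) * s / of_real lam)" for s
    proof -
      have "2 * of_real pi * of_real m' * s + - (2 * of_real pi * of_real m * s)
        = 2 * of_real pi * of_int (l' - l) * s / of_real lam"
        using lam unfolding l by (simp add: field_simps)
      then show ?thesis by (simp only: exp_add[symmetric] mult.assoc)
    qed
    have "contour_integral ?L (?t m') = contour_integral ?L (\<lambda>s. c m' * exp (2 * of_real pi * of_int (l' - l) * s / of_real lam))"
      by (simp only: teq)
    also have "\<dots> = c m' * contour_integral ?L (\<lambda>s. exp (2 * of_real pi * of_int (l' - l) * s / of_real lam))"
      by (intro contour_integral_lmul contour_integrable_continuous_linepath continuous_intros) (use lam in simp)
    also have "\<dots> = c m' * (if l' - l = 0 then \<i> * of_real lam else 0)"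
      by (simp only: contour_integral_exp_period[OF lam])
    finally have "contour_integral ?L (?t m') = c m' * (if l' - l = 0 then \<i> * of_real lam else 0)" .
    moreover have "l' - l = 0 \<longleftrightarrow> m' = m" using lam l by auto
    ultimately show ?thesis by simp
  qed
  have "((\<lambda>A. contour_integral ?L (\<lambda>s. \<Sum>m'\<in>A. ?t m' s)) \<longlongrightarrow> contour_integral ?L ?f) (finite_subsets_at_top ?X)"
  proof (rule contour_integral_uniform_limit(2))
    show "\<forall>\<^sub>F A in finite_subsets_at_top ?X. (\<lambda>s. \<Sum>m'\<in>A. ?t m' s) contour_integrable_on ?L"
      by (rule eventually_finite_subsets_at_top_weakI) (rule contour_integrable_sum[OF _ t_int])
    show "uniform_limit (path_image ?L) (\<lambda>A s. \<Sum>m'\<in>A. ?t m' s) ?f (finite_subsets_at_top ?X)" using ul by simp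
    show "norm (vector_derivative ?L (at t)) \<le> norm (z + \<i> * of_real lam - z)" for t by simp
  qed auto
  \<comment> \<open>The integrals of the partial sums are not merely convergent: they are constant
    as soon as the finite index set contains \<open>m\<close>.\<close>
  moreover have "\<forall>\<^sub>F A in finite_subsets_at_top ?X. contour_integral ?L (\<lambda>s. \<Sum>m'\<in>A. ?t m' s) = c m * \<i> * of_real lam"
    unfolding eventually_finite_subsets_at_top
  proof (intro exI conjI allI impI)
    show "finite {m}" "{m} \<subseteq> ?X" using m by auto
    fix A assume A: "finite A \<and> {m} \<subseteq> A \<and> A \<subseteq> ?X"
    then have "contour_integral ?L (\<lambda>s. \<Sum>m'\<in>A. ?t m' s) = (\<Sum>m'\<in>A. contour_integral ?L (?t m'))"
      by (intro contour_integral_sum t_int) auto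
    also have "\<dots> = (\<Sum>m'\<in>A. if m' = m then c m * \<i> * of_real lam else 0)"
      using A by (intro sum.cong refl ct) auto
    also have "\<dots> = c m * \<i> * of_real lam" using A by (simp add: sum.delta)
    finally show "contour_integral ?L (\<lambda>s. \<Sum>m'\<in>A. ?t m' s) = c m * \<i> * of_real lam" .
  qed
  ultimately have "((\<lambda>A. c m * \<i> * of_real lam) \<longlongrightarrow> contour_integral ?L ?f) (finite_subsets_at_top ?X)"
    by (rule Lim_transform_eventually)
  then have eq: "contour_integral ?L ?f = c m * \<i> * of_real lam"
    by (simp add: tendsto_const_iff)
  have "fourier_coeff lam m F z = c m * (\<i> * of_real lam) / (\<i> * of_real lam)"
    unfolding fourier_coeff_def eq by (simp only: mult.assoc)
  also have "\<dots> = c m" by (rule nonzero_mult_div_cancel_right) (use lam in simp)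
  finally show ?thesis by simp
qed

text \<open>Reduction to inversion at a zero. The factor \<open>e\<close> cancels the phase of
  \<open>F\<close> and equals 1 at \<open>z0\<close>; subtracting \<open>F z0\<close> then creates
  the zero and changes only the coefficient with l = 0. Thus the shifted series sums to 0, and the
  original one to \<open>F z0\<close>.\<close>

lemma fourier_has_sum:
  assumes z0: "Re z0 > b" and z1: "Re z1 > b"
    and summ: "(\<lambda>m. fourier_coeff lam m F z1 * exp (2 * of_real pi * of_real m * z0)) summable_on fourier_exps lam x"
  shows "((\<lambda>m. fourier_coeff lam m F z1 * exp (2 * of_real pi * of_real m * z0)) has_sum F z0) (fourier_exps lam x)"
proof -
  let ?il = "\<i> * of_real lam :: complex"
  define mm where "mm = (\<lambda>l::int. (of_int l - x) / lam)"
  let ?E = "\<lambda>l s. exp (- (2 * of_real pi * of_real (mm l) * s))" and ?Z = "\<lambda>l. exp (2 * of_real pi * of_real (mm l) * z0)"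
  let ?c = "\<lambda>l. fourier_coeff lam (mm l) F z1 * ?Z l"
  let ?L = "linepath z1 (z1 + ?il)"
  define e where "e = (\<lambda>s. exp (2 * of_real pi * of_real x * (s - z0) / of_real lam))"
  define \<phi> where "\<phi> = (\<lambda>s. F s * e s - F z0)"
  define B where "B = (\<lambda>l::int. contour_integral ?L (\<lambda>s. \<phi> s * exp (2 * of_real pi * of_int l * (z0 - s) / of_real lam)))"
  have e_holo: "e holomorphic_on A" for A unfolding e_def by (intro holomorphic_intros) (use lam in auto)
  have e_per: "e (s + ?il) = e s * exp (2 * of_real pi * \<i> * of_real x)" for s
  proof -
    have "2 * of_real pi * of_real x * (s + ?il - z0) / of_real lam
       = 2 * of_real pi * of_real x * (s - z0) / of_real lam + 2 * of_real pi * \<i> * of_real x"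
      using lam by (simp add: field_simps)
    then show ?thesis unfolding e_def by (simp only: exp_add)
  qed
  have \<phi>_holo: "\<phi> holomorphic_on {z. Re z > b}"
    unfolding \<phi>_def by (intro holomorphic_on_diff holomorphic_on_mult holo e_holo holomorphic_on_const)
  have \<phi>_per: "\<phi> (z + ?il) = \<phi> z" if "Re z > b" for z
    using quasi_per[OF that] by (simp add: \<phi>_def e_per exp_minus)
  have cont: "continuous_on (closed_segment z1 (z1 + ?il)) F"
    by (rule holomorphic_on_imp_continuous_on[OF holomorphic_on_subset[OF holo Re_halfspace_vertical_subset[OF z1]]])
  have B_eq: "B l = ?il * (?c l - (if l = 0 then F z0 else 0))" for l
  proof -
    have \<phi>_eq: "\<phi> s * exp (2 * of_real pi * of_int l * (z0 - s) / of_real lam)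
       = (F s * ?E l s) * ?Z l
         - F z0 * exp (2 * of_real pi * of_int l * z0 / of_real lam) * exp (2 * of_real pi * of_int (- l) * s / of_real lam)" for s
    proof -
      have "2 * of_real pi * of_real x * (s - z0) / of_real lam + 2 * of_real pi * of_int l * (z0 - s) / of_real lam
         = - (2 * of_real pi * of_real (mm l) * s) + 2 * of_real pi * of_real (mm l) * z0"
        using lam by (simp add: mm_def field_simps)
      then have "e s * exp (2 * of_real pi * of_int l * (z0 - s) / of_real lam)
         = ?E l s * ?Z l"
        unfolding e_def by (simp only: exp_add[symmetric])
      moreover have "2 * of_real pi * of_int l * (z0 - s) / of_real lam
         = 2 * of_real pi * of_int l * z0 / of_real lam + 2 * of_real pi * of_int (- l) * s / of_real lam"
        using lam by (simp add: field_simps)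
      then have "exp (2 * of_real pi * of_int l * (z0 - s) / of_real lam)
         = exp (2 * of_real pi * of_int l * z0 / of_real lam) * exp (2 * of_real pi * of_int (- l) * s / of_real lam)"
        by (simp only: exp_add)
      ultimately show ?thesis unfolding \<phi>_def
        by (simp only: left_diff_distrib mult.assoc)
    qed
    have i1: "(\<lambda>s. F s * ?E l s) contour_integrable_on ?L"
      by (intro contour_integrable_continuous_linepath continuous_intros cont)
    have i2: "(\<lambda>s. exp (2 * of_real pi * of_int (- l) * s / of_real lam)) contour_integrable_on ?L"
      using lam by (intro contour_integrable_continuous_linepath continuous_intros) simp
    have "B l = contour_integral ?L (\<lambda>s. (F s * ?E l s) * ?Z l
         - F z0 * exp (2 * of_real pi * of_int l * z0 / of_real lam) * exp (2 * of_real pi * of_int (- l) * s / of_real lam))"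
      unfolding B_def by (simp only: \<phi>_eq)
    also have "\<dots> = contour_integral ?L (\<lambda>s. (F s * ?E l s)) * ?Z l
      - F z0 * exp (2 * of_real pi * of_int l * z0 / of_real lam) * contour_integral ?L (\<lambda>s. exp (2 * of_real pi * of_int (- l) * s / of_real lam))"
      by (simp only: contour_integral_diff[OF contour_integrable_rmul[OF i1] contour_integrable_lmul[OF i2]]
          contour_integral_rmul[OF i1] contour_integral_lmul[OF i2])
    also have "contour_integral ?L (\<lambda>s. exp (2 * of_real pi * of_int (- l) * s / of_real lam)) = (if - l = 0 then ?il else 0)"
      by (rule contour_integral_exp_period[OF lam])
    also have "contour_integral ?L (\<lambda>s. F s * ?E l s) = ?il * fourier_coeff lam (mm l) F z1"
      using lam by (simp add: fourier_coeff_def)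
    finally show ?thesis by (cases "l = 0") (simp_all add: algebra_simps)
  qed
  have "bij_betw mm UNIV (fourier_exps lam x)" using fourier_exps_bij[OF lam] by (simp add: mm_def)
  note reindex = has_sum_reindex_bij_betw[OF this] summable_on_reindex_bij_betw[OF this]
  have "?c summable_on UNIV" using summ by (simp add: reindex(2)[symmetric])
  moreover have d: "((\<lambda>l::int. if l = 0 then F z0 else 0) has_sum F z0) UNIV"
    by (rule has_sum_finite_neutralI[of "{0}"]) auto
  ultimately have "(\<lambda>l. ?c l + - (if l = 0 then F z0 else 0)) summable_on UNIV"
    by (intro summable_on_add) (auto simp: summable_on_uminus dest: has_sum_imp_summable)
  then have "(\<lambda>l. ?il * (?c l - (if l = 0 then F z0 else 0))) summable_on UNIV"
    by (intro summable_on_cmult_right) simp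
  then have "B summable_on UNIV" by (simp only: B_eq[symmetric])
  then have "(B has_sum 0) UNIV"
    using contour_integral_geometric_int_has_sum[OF lam \<phi>_holo \<phi>_per z0 _ z1]
    unfolding B_def by (simp add: \<phi>_def e_def)
  from has_sum_cmult_right[OF this, of "inverse ?il"]
  have "((\<lambda>l. inverse ?il * B l) has_sum 0) UNIV" by simp
  moreover have "inverse ?il * B l = ?c l - (if l = 0 then F z0 else 0)" for l
  proof -
    have *: "inverse ?il * (?il * y) = y" for y
      using lam by (subst mult.assoc[symmetric], subst left_inverse) simp_all
    show ?thesis unfolding B_eq by (rule *)
  qed
  ultimately have "((\<lambda>l. ?c l - (if l = 0 then F z0 else 0)) has_sum 0) UNIV" by (simp only:)
  from has_sum_add[OF this d] have "(?c has_sum F z0) UNIV" by simp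
  then show ?thesis by (simp add: reindex(1)[symmetric])
qed

end

section \<open>Holomorphic functions of several variables\<close>

abbreviation (input) cmat where "cmat \<equiv> Finite_Cartesian_Product.mat"

lemmas cart_eq_iff = Finite_Cartesian_Product.vec_eq_iff

section \<open>Second-order estimates and holomorphic parameter integrals\<close>

lemma norm_smult_vec: "norm (a *s v) = norm a * norm (v :: complex ^ 'n::finite)"
  by (simp add: norm_vec_def L2_set_def norm_mult power_mult_distrib sum_distrib_left[symmetric] real_sqrt_mult)

text \<open>The constant is 2! / (1/2)^2: Cauchy's inequality for the second derivative on discs of
  radius \<rho>/2 around points of the half disc. The form of Taylor's remainder used here divides
  by 1!, not by 2!.\<close>

lemma taylor2_bound:
  assumes holo: "g holomorphic_on ball 0 \<rho>" and bound: "\<And>z. z \<in> ball 0 \<rho> \<Longrightarrow> norm (g z) \<le> M"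
    and t: "norm t < \<rho> / 2"
  shows "norm (g t - g 0 - deriv g 0 * t) \<le> 8 * M / \<rho>\<^sup>2 * (norm t)\<^sup>2"
proof -
  have \<rho>: "\<rho> > 0" using t norm_ge_zero[of t] by linarith
  let ?S = "ball (0::complex) (\<rho> / 2)"
  have sub: "z \<in> ball 0 \<rho>" if "z \<in> ?S" for z using that \<rho> by simp
  have d: "((deriv ^^ i) g has_field_derivative (deriv ^^ Suc i) g z) (at z within ?S)" if "z \<in> ?S" for i z
  proof -
    have "(deriv ^^ i) g holomorphic_on ball 0 \<rho>" by (rule holomorphic_higher_deriv[OF holo open_ball])
    then have "((deriv ^^ i) g has_field_derivative deriv ((deriv ^^ i) g) z) (at z)"
      by (rule holomorphic_derivI[OF _ open_ball sub[OF that]])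
    then show ?thesis by (simp add: has_field_derivative_at_within)
  qed
  have b2: "norm ((deriv ^^ Suc 1) g z) \<le> 8 * M / \<rho>\<^sup>2" if z: "z \<in> ?S" for z
  proof -
    have cb: "cball z (\<rho> / 2) \<subseteq> ball 0 \<rho>"
    proof
      fix y assume "y \<in> cball z (\<rho> / 2)"
      then have "norm (y - z) \<le> \<rho> / 2" by (simp add: dist_norm norm_minus_commute)
      moreover have "norm y \<le> norm (y - z) + norm z" using norm_triangle_ineq[of "y - z" z] by simp
      ultimately show "y \<in> ball 0 \<rho>" using z by simp
    qed
    have "norm ((deriv ^^ 2) g z) \<le> fact 2 * M / (\<rho> / 2) ^ 2"
    proof (rule Cauchy_inequality)
      show "g holomorphic_on ball z (\<rho> / 2)" by (rule holomorphic_on_subset[OF holo]) (use cb in auto)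
      show "continuous_on (cball z (\<rho> / 2)) g"
        by (rule holomorphic_on_imp_continuous_on[OF holomorphic_on_subset[OF holo cb]])
      show "norm (g y) \<le> M" if "norm (z - y) = \<rho> / 2" for y
        by (rule bound) (use cb that in \<open>auto simp: dist_norm\<close>)
    qed (use \<rho> in simp)
    moreover have "fact 2 * M / (\<rho> / 2) ^ 2 = 8 * M / \<rho>\<^sup>2" by (simp add: power2_eq_square)
    ultimately show ?thesis by (simp add: numeral_2_eq_2)
  qed
  have "norm ((deriv ^^ 0) g t - (\<Sum>i\<le>1. (deriv ^^ i) g 0 * (t - 0) ^ i / fact i))
      \<le> 8 * M / \<rho>\<^sup>2 * norm (t - 0) ^ Suc 1 / fact 1"
    by (rule complex_Taylor[where S="?S" and f="\<lambda>i. (deriv ^^ i) g", OF convex_ball d b2])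
      (use t \<rho> in \<open>auto simp: dist_norm\<close>)
  then show ?thesis by (simp add: algebra_simps power2_eq_square)
qed

lemma smult_vec_has_derivative:
  "((\<lambda>z. p + z *s v) has_derivative (\<lambda>h. h *s (v :: complex ^ 'n::finite))) (at z)"
proof -
  have "bounded_linear (\<lambda>h. h *s v)"
  proof (rule bounded_linear_intro)
    show "(x + y) *s v = x *s v + y *s v" for x y by (simp add: cart_eq_iff algebra_simps)
    show "(r *\<^sub>R x) *s v = r *\<^sub>R (x *s v)" for r x
      unfolding cart_eq_iff by simp
    show "norm (x *s v) \<le> norm x * norm v" for x by (simp add: norm_smult_vec)
  qed
  then have "((\<lambda>z. z *s v) has_derivative (\<lambda>h. h *s v)) (at z)" by (rule bounded_linear_imp_has_derivative)
  from has_derivative_add[OF has_derivative_const[of p] this] show ?thesis by simp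
qed

lemma holo_on_line_differentiable:
  assumes "holo_on (*s) f S" "p + z *s v \<in> S"
  shows "(\<lambda>z. f (p + z *s v)) field_differentiable (at z)"
proof -
  obtain f' where f': "(f has_derivative f') (at (p + z *s v))" "\<And>a v. f' (a *s v) = a * f' v"
    using assms unfolding holo_on_def by blast
  have "((\<lambda>z. f (p + z *s v)) has_derivative (\<lambda>h. f' (h *s v))) (at z)"
    by (rule has_derivative_compose[OF smult_vec_has_derivative f'(1)])
  then have "((\<lambda>z. f (p + z *s v)) has_field_derivative f' v) (at z)"
    unfolding has_field_derivative_def f'(2) by (simp only: mult_commute_abs)
  then show ?thesis unfolding field_differentiable_def ..
qed

text \<open>Restriction to the complex line through \<open>h\<close> leaves a function of one
  variable. The constant depends only on the bound and the radius, hence is the same for every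
  member of a uniformly bounded family; this uniformity takes the place of continuity of the
  derivative.\<close>

lemma holo_on_second_order:
  fixes f :: "complex ^ 'n::finite \<Rightarrow> complex"
  assumes holo: "holo_on (*s) f (ball p \<rho>)" and bound: "\<And>v. v \<in> ball p \<rho> \<Longrightarrow> norm (f v) \<le> M"
    and f': "(f has_derivative f') (at p)" and lin: "\<And>a v. f' (a *s v) = a * f' v"
    and h: "norm h < \<rho> / 2"
  shows "norm (f (p + h) - f p - f' h) \<le> 8 * M / \<rho>\<^sup>2 * (norm h)\<^sup>2"
proof (cases "h = 0")
  case True
  have "f' 0 = 0" using lin[of 0 0] by simp
  then show ?thesis using True by simp
next
  case False
  define e where "e = inverse (of_real (norm h)) *s h"
  have e: "norm e = 1" "of_real (norm h) *s e = h"
    using False by (auto simp: e_def norm_smult_vec norm_inverse cart_eq_iff)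
  define g where "g = (\<lambda>z. f (p + z *s e))"
  have mem: "p + z *s e \<in> ball p \<rho>" if "z \<in> ball 0 \<rho>" for z
    using that e(1) by (simp add: dist_norm norm_smult_vec)
  have \<rho>: "\<rho> > 0" using h norm_ge_zero[of h] by linarith
  have "g field_differentiable (at z)" if "z \<in> ball 0 \<rho>" for z
    unfolding g_def by (rule holo_on_line_differentiable[OF holo mem[OF that]])
  then have holo_g: "g holomorphic_on ball 0 \<rho>"
    by (simp add: holomorphic_on_open field_differentiable_def)
  have "((\<lambda>z. f (p + z *s e)) has_derivative (\<lambda>h. f' (h *s e))) (at 0)"
    by (rule has_derivative_compose[OF smult_vec_has_derivative]) (use f' in simp)
  then have "(g has_field_derivative f' e) (at 0)"
    unfolding has_field_derivative_def lin g_def by (simp only: mult_commute_abs)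
  then have dg: "deriv g 0 = f' e" by (rule DERIV_imp_deriv)
  have "norm (g (of_real (norm h)) - g 0 - deriv g 0 * of_real (norm h)) \<le> 8 * M / \<rho>\<^sup>2 * (norm (of_real (norm h) :: complex))\<^sup>2"
    by (rule taylor2_bound[OF holo_g]) (use bound mem h in \<open>auto simp: g_def\<close>)
  moreover have "deriv g 0 * of_real (norm h) = f' h" using lin[of "of_real (norm h)" e] e dg by (simp add: mult.commute)
  ultimately show ?thesis by (simp add: g_def e)
qed

text \<open>The quadratic remainder is uniform in t and can be integrated, so the integral of the
  derivatives is the derivative of the integral. What has to be checked first is that the
  derivatives are integrable in t.\<close>

lemma holo_on_integral:
  fixes \<Phi> :: "real \<Rightarrow> complex ^ 'n::finite \<Rightarrow> complex"
  assumes \<rho>: "\<rho> > 0"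
    and holo: "\<And>t. t \<in> {0..1} \<Longrightarrow> holo_on (*s) (\<Phi> t) (ball p \<rho>)"
    and bound: "\<And>t v. t \<in> {0..1} \<Longrightarrow> v \<in> ball p \<rho> \<Longrightarrow> norm (\<Phi> t v) \<le> M"
    and cont: "\<And>v. v \<in> ball p \<rho> \<Longrightarrow> continuous_on {0..1} (\<lambda>t. \<Phi> t v)"
  shows "\<exists>D. ((\<lambda>v. integral {0..1} (\<lambda>t. \<Phi> t v)) has_derivative D) (at p) \<and> (\<forall>a v. D (a *s v) = a * D v)"
proof -
  let ?F = "\<lambda>v. integral {0..1} (\<lambda>t. \<Phi> t v)"
  have "\<forall>t\<in>{0..1}. \<exists>D. (\<Phi> t has_derivative D) (at p) \<and> (\<forall>a v. D (a *s v) = a * D v)"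
    using holo \<rho> unfolding holo_on_def by auto
  then obtain D where D: "\<And>t. t \<in> {0..1} \<Longrightarrow> (\<Phi> t has_derivative D t) (at p)"
    and lin: "\<And>t a v. t \<in> {0..1} \<Longrightarrow> D t (a *s v) = a * D t v" by metis
  define K where "K = 8 * M / \<rho>\<^sup>2"
  have est: "norm (\<Phi> t (p + h) - \<Phi> t p - D t h) \<le> K * (norm h)\<^sup>2" if "t \<in> {0..1}" "norm h < \<rho> / 2" for t h
    unfolding K_def by (rule holo_on_second_order[OF holo bound D lin]) (use that in auto)
  have "norm (\<Phi> 0 p) \<le> M" using bound[of 0 p] \<rho> by simp
  then have "M \<ge> 0" using norm_ge_zero order_trans by blast
  then have K: "K \<ge> 0" by (simp add: K_def)
  \<comment> \<open>Difference quotients are continuous in t and converge to the derivative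
    uniformly in t, by the quadratic remainder. The step sizes \<open>\<tau> n\<close> keep the
    increment shorter than \<rho>/2; the 1 added to the norm of \<open>h\<close> covers
    \<open>h = 0\<close>.\<close>
  have contD: "continuous_on {0..1} (\<lambda>t. D t h)" for h
  proof -
    define \<tau> :: "nat \<Rightarrow> real" where "\<tau> = (\<lambda>n. \<rho> / (2 * (norm h + 1) * (real n + 1)))"
    have \<tau>: "\<tau> n > 0" "\<tau> n * norm h < \<rho> / 2" for n
    proof -
      show "\<tau> n > 0" using \<rho> by (simp add: \<tau>_def add_nonneg_pos)
      have "norm h < (norm h + 1) * (real n + 1)"
        using mult_left_mono[of 1 "real n + 1" "norm h + 1"] by simp
      then have "\<rho> * norm h < \<rho> * ((norm h + 1) * (real n + 1))" using \<rho> by simp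
      moreover have "(norm h + 1) * (real n + 1) > 0" by (simp add: add_nonneg_pos)
      ultimately show "\<tau> n * norm h < \<rho> / 2" by (simp add: \<tau>_def field_simps)
    qed
    have \<tau>0: "\<tau> \<longlonglongrightarrow> 0"
    proof -
      have "(\<lambda>n. (\<rho> / (2 * (norm h + 1))) * (1 / (real n + 1))) \<longlonglongrightarrow> (\<rho> / (2 * (norm h + 1))) * 0"
        by (intro tendsto_mult_left) (use LIMSEQ_inverse_real_of_nat in \<open>simp add: inverse_eq_divide add.commute\<close>)
      then show ?thesis by (simp add: \<tau>_def)
    qed
    let ?g = "\<lambda>n t. (\<Phi> t (p + of_real (\<tau> n) *s h) - \<Phi> t p) / of_real (\<tau> n)"
    have mem: "p + of_real (\<tau> n) *s h \<in> ball p \<rho>" for n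
      using \<tau>[of n] \<rho> by (simp add: dist_norm norm_smult_vec)
    have "uniform_limit {0..1} ?g (\<lambda>t. D t h) sequentially"
    proof (rule uniform_limitI)
      fix e :: real assume e: "e > 0"
      have "(\<lambda>n. K * \<tau> n * (norm h)\<^sup>2) \<longlonglongrightarrow> K * 0 * (norm h)\<^sup>2" by (intro tendsto_intros \<tau>0)
      then have "\<forall>\<^sub>F n in sequentially. K * \<tau> n * (norm h)\<^sup>2 < e" using e by (auto intro: order_tendstoD)
      then show "\<forall>\<^sub>F n in sequentially. \<forall>t\<in>{0..1}. dist (?g n t) (D t h) < e"
      proof (rule eventually_mono, intro ballI)
        fix n t assume n: "K * \<tau> n * (norm h)\<^sup>2 < e" and t: "t \<in> {0..1::real}"
        have nz: "of_real (\<tau> n) \<noteq> (0::complex)" using \<tau>(1)[of n] by simp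
        have "norm (\<Phi> t (p + of_real (\<tau> n) *s h) - \<Phi> t p - D t (of_real (\<tau> n) *s h)) \<le> K * (norm (of_real (\<tau> n) *s h))\<^sup>2"
          by (rule est[OF t]) (use \<tau>[of n] in \<open>simp add: norm_smult_vec\<close>)
        also have "\<Phi> t (p + of_real (\<tau> n) *s h) - \<Phi> t p - D t (of_real (\<tau> n) *s h) = of_real (\<tau> n) * (?g n t - D t h)"
          using nz by (simp add: lin[OF t] field_simps)
        finally have "\<tau> n * norm (?g n t - D t h) \<le> \<tau> n * (K * \<tau> n * (norm h)\<^sup>2)"
          using \<tau>(1)[of n] by (simp add: norm_mult norm_smult_vec power2_eq_square mult_ac)
        then have "norm (?g n t - D t h) \<le> K * \<tau> n * (norm h)\<^sup>2" using \<tau>(1)[of n] by simp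
        then show "dist (?g n t) (D t h) < e" using n by (simp add: dist_norm)
      qed
    qed
    moreover have "continuous_on {0..1} (?g n)" for n
      by (intro continuous_on_divide continuous_on_diff cont mem continuous_on_const) (use \<rho> \<tau>(1)[of n] in auto)
    ultimately show ?thesis by (intro uniform_limit_theorem[where f="?g" and F=sequentially]) auto
  qed
  have intD: "(\<lambda>t. D t h) integrable_on {0..1}" for h
    by (rule integrable_continuous_real[OF contD])
  have int\<Phi>: "(\<lambda>t. \<Phi> t v) integrable_on {0..1}" if "v \<in> ball p \<rho>" for v
    by (rule integrable_continuous_real[OF cont[OF that]])
  define D0 where "D0 = (\<lambda>h. integral {0..1} (\<lambda>t. D t h))"
  have D0_lin: "D0 (a *s v) = a * D0 v" for a v
  proof -
    have "D0 (a *s v) = integral {0..1} (\<lambda>t. a * D t v)"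
      unfolding D0_def by (rule integral_cong) (simp add: lin)
    then show ?thesis by (simp add: D0_def)
  qed
  have "linear D0"
  proof (rule linearI)
    show "D0 (u + v) = D0 u + D0 v" for u v
    proof -
      have "D0 (u + v) = integral {0..1} (\<lambda>t. D t u + D t v)"
        unfolding D0_def
        by (rule integral_cong) (rule linear_add[OF bounded_linear.linear[OF has_derivative_bounded_linear[OF D]]])
      then show ?thesis using integral_add[OF intD intD] by (simp add: D0_def)
    qed
    show "D0 (c *\<^sub>R v) = c *\<^sub>R D0 v" for c v
    proof -
      have "c *\<^sub>R v = of_real c *s v" unfolding cart_eq_iff
        by (simp only: vector_scaleR_component vector_smult_component scaleR_conv_of_real[of c "v $ _"] simp_thms)
      then show ?thesis using D0_lin[of "of_real c" v] by (simp add: scaleR_conv_of_real)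
    qed
  qed
  then have bl: "bounded_linear D0" by (simp add: linear_conv_bounded_linear)
  have "(?F has_derivative D0) (at p)"
  proof (rule has_derivativeI_sandwich[where e="\<rho> / 2" and H="\<lambda>y. K * norm (y - p)"])
    show "\<rho> / 2 > 0" using \<rho> by simp
    show "bounded_linear D0" by (rule bl)
    show "((\<lambda>y. K * norm (y - p)) \<longlongrightarrow> 0) (at p)"
    proof -
      have "((\<lambda>y. K * norm (y - p)) \<longlongrightarrow> K * norm (p - p)) (at p)" by (intro tendsto_intros)
      then show ?thesis by simp
    qed
    fix y assume y: "y \<noteq> p" "dist y p < \<rho> / 2"
    define h where "h = y - p"
    have h: "norm h < \<rho> / 2" "h \<noteq> 0" "y = p + h" using y by (auto simp: h_def dist_norm)
    have mem: "y \<in> ball p \<rho>" "p \<in> ball p \<rho>" using y(2) \<rho> by (auto simp: dist_commute)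
    note i1 = integrable_diff[OF int\<Phi>[OF mem(1)] int\<Phi>[OF mem(2)]]
    note i2 = intD[of h]
    have eq: "?F y - ?F p - D0 h
      = integral {0..1} (\<lambda>t. \<Phi> t y - \<Phi> t p - D t h)"
      unfolding D0_def
      by (simp only: integral_diff[OF i1 i2] integral_diff[OF int\<Phi>[OF mem(1)] int\<Phi>[OF mem(2)]])
    have "norm (integral {0..1} (\<lambda>t. \<Phi> t y - \<Phi> t p - D t h)) \<le> integral {0..1::real} (\<lambda>t. K * (norm h)\<^sup>2)"
    proof (rule Henstock_Kurzweil_Integration.integral_norm_bound_integral)
      show "(\<lambda>t. \<Phi> t y - \<Phi> t p - D t h) integrable_on {0..1}"
        by (rule integrable_diff[OF i1 i2])
      show "norm (\<Phi> t y - \<Phi> t p - D t h) \<le> K * (norm h)\<^sup>2" if "t \<in> {0..1}" for t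
        using est[OF that h(1)] h(3) by simp
    qed (rule integrable_const_ivl)
    then have "norm (?F y - ?F p - D0 h) \<le> K * (norm h)\<^sup>2"
      unfolding eq by simp
    then have fin: "norm (?F y - ?F p - D0 h) \<le> K * norm h * norm h"
      by (simp only: power2_eq_square mult.assoc)
    show "norm (?F y - ?F p - D0 (y - p)) / norm (y - p) \<le> K * norm (y - p)"
      using fin h(2) unfolding h_def by (subst pos_divide_le_eq) simp_all
  qed
  with D0_lin show ?thesis by (intro exI[of _ D0]) simp
qed

section \<open>Fourier expansion and Koecher principle on the Siegel domain\<close>

lemma Delta'_eq: "Delta' w = 2 * Re (fst w) - (norm (snd w))\<^sup>2"
  by (simp add: Delta'_def)

lemma H_dom_iff: "w \<in> H_dom \<longleftrightarrow> Delta' w > 0"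
  by (auto simp: H_dom_def Delta'_eq)

lemma continuous_on_Delta': "continuous_on A Delta'"
  unfolding Delta'_def by (intro continuous_intros)

lemma open_Delta'_gt: "open {w :: 'm::finite pt. Delta' w > t}"
  by (rule open_Collect_less[OF continuous_on_const continuous_on_Delta'])

lemma open_H_dom: "open (H_dom :: 'm::finite pt set)"
  using open_Delta'_gt[of 0] by (simp add: H_dom_iff[symmetric])

lemma holo_on_imp_continuous_on: "holo_on smul f S \<Longrightarrow> continuous_on S f"
  unfolding holo_on_def
  by (intro continuous_at_imp_continuous_on ballI) (auto intro: has_derivative_continuous)

section \<open>Summability over the Fourier exponents and the gap below zero\<close>

lemma summable_on_power_abs_int:
  assumes "0 \<le> \<rho>" "\<rho> < (1::real)"
  shows "(\<lambda>l::int. \<rho> ^ nat \<bar>l\<bar>) summable_on UNIV"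
proof -
  have s: "summable (\<lambda>n. norm (\<rho> ^ n))" using assms by (simp add: summable_geometric)
  have 1: "(\<lambda>l::int. \<rho> ^ nat \<bar>l\<bar>) summable_on {0..}"
    using summable_on_reindex_bij_betw[OF bij_int_nonneg, of "\<lambda>l. \<rho> ^ nat \<bar>l\<bar>"] norm_summable_imp_summable_on[OF s] by simp
  have s2: "summable (\<lambda>n. norm (\<rho> ^ nat \<bar>- int n - 1\<bar>))"
  proof -
    have "nat \<bar>- int n - 1\<bar> = Suc n" for n by simp
    then show ?thesis using assms by (simp only: ) (simp add: summable_geometric summable_mult)
  qed
  have 2: "(\<lambda>l::int. \<rho> ^ nat \<bar>l\<bar>) summable_on {..<0}"
    using summable_on_reindex_bij_betw[OF bij_int_neg, of "\<lambda>l. \<rho> ^ nat \<bar>l\<bar>"] norm_summable_imp_summable_on[OF s2] by simp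
  have "{0::int..} \<union> {..<0} = UNIV" by auto
  moreover have "{0::int..} \<inter> {..<0} = {}" by auto
  ultimately show ?thesis using summable_on_Un_disjoint[OF 1 2] by simp
qed

text \<open>A non-positive exponent satisfies m <= -(|l| - |x|)/|lam|, which compares the sum with a
  two-sided geometric series. Positive exponents are cut off because their coefficients will turn
  out to vanish.\<close>

lemma summable_on_fourier_exps:
  assumes lam: "lam \<noteq> 0" and \<delta>: "\<delta> > 0"
  shows "(\<lambda>m. if m \<le> 0 then exp (\<delta> * m) else 0) summable_on fourier_exps lam x"
proof -
  define \<rho> where "\<rho> = exp (- (\<delta> / \<bar>lam\<bar>))"
  have \<rho>: "0 \<le> \<rho>" "\<rho> < 1" using lam \<delta> by (auto simp: \<rho>_def)
  have le: "(if (of_int l - x) / lam \<le> 0 then exp (\<delta> * ((of_int l - x) / lam)) else 0)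
      \<le> exp (\<delta> * \<bar>x\<bar> / \<bar>lam\<bar>) * \<rho> ^ nat \<bar>l\<bar>" for l :: int
  proof (cases "(of_int l - x) / lam \<le> 0")
    case True
    have "(of_int l - x) / lam = - (\<bar>of_int l - x\<bar> / \<bar>lam\<bar>)"
      using abs_of_nonpos[OF True] by (simp only: abs_divide minus_minus)
    also have "\<dots> \<le> - ((\<bar>of_int l\<bar> - \<bar>x\<bar>) / \<bar>lam\<bar>)"
      using lam by (simp add: divide_right_mono abs_triangle_ineq2)
    finally have "\<delta> * ((of_int l - x) / lam) \<le> \<delta> * (- ((\<bar>of_int l\<bar> - \<bar>x\<bar>) / \<bar>lam\<bar>))"
      using \<delta> by (intro mult_left_mono) auto
    also have "\<dots> = \<delta> * \<bar>x\<bar> / \<bar>lam\<bar> + of_nat (nat \<bar>l\<bar>) * (- (\<delta> / \<bar>lam\<bar>))"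
      using lam by (simp add: field_simps)
    finally have "exp (\<delta> * ((of_int l - x) / lam)) \<le> exp (\<delta> * \<bar>x\<bar> / \<bar>lam\<bar> + of_nat (nat \<bar>l\<bar>) * (- (\<delta> / \<bar>lam\<bar>)))"
      by simp
    also have "\<dots> = exp (\<delta> * \<bar>x\<bar> / \<bar>lam\<bar>) * \<rho> ^ nat \<bar>l\<bar>"
      by (simp only: exp_add exp_of_nat_mult \<rho>_def)
    finally show ?thesis using True by simp
  qed (use \<rho> in simp)
  have "(\<lambda>l::int. if (of_int l - x) / lam \<le> 0 then exp (\<delta> * ((of_int l - x) / lam)) else 0) summable_on UNIV"
    by (rule summable_on_comparison_test[OF summable_on_cmult_right[OF summable_on_power_abs_int[OF \<rho>]] le]) simp
  then show ?thesis using summable_on_reindex_bij_betw[OF fourier_exps_bij[OF lam], of "\<lambda>m. if m \<le> 0 then exp (\<delta> * m) else 0"] by simp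
qed

text \<open>Once the sign of \<open>lam\<close> is absorbed into l and x, the negative exponents are
  (l' - y)/|lam| with an integer l' < y, and the largest such l' is the ceiling of y minus 1, also
  when y is an integer.\<close>

lemma fourier_exps_neg_gap:
  assumes lam: "lam \<noteq> 0"
  shows "\<exists>\<mu>>0. \<forall>m\<in>fourier_exps lam x. m < 0 \<longrightarrow> m \<le> - \<mu>"
proof -
  define y where "y = sgn lam * x"
  have y: "of_int \<lceil>y\<rceil> - 1 < y" by linarith
  show ?thesis
  proof (intro exI[of _ "(y - (of_int \<lceil>y\<rceil> - 1)) / \<bar>lam\<bar>"] conjI ballI impI)
    show "(y - (of_int \<lceil>y\<rceil> - 1)) / \<bar>lam\<bar> > 0" using lam y by simp
    fix m assume m: "m \<in> fourier_exps lam x" "m < 0"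
    then obtain l :: int where l: "m = (of_int l - x) / lam" by (auto simp: fourier_exps_def)
    define l' where "l' = (if lam > 0 then l else - l)"
    have m_eq: "m = (of_int l' - y) / \<bar>lam\<bar>"
      using lam unfolding l l'_def y_def by (cases "lam > 0") (auto simp: field_simps)
    have "of_int l' < y" using m(2) lam unfolding m_eq by (simp add: divide_less_0_iff)
    then have "l' \<le> \<lceil>y\<rceil> - 1" by linarith
    then have "of_int l' \<le> (of_int \<lceil>y\<rceil> - 1 :: real)" by linarith
    then show "m \<le> - ((y - (of_int \<lceil>y\<rceil> - 1)) / \<bar>lam\<bar>)"
      using lam unfolding m_eq by (simp add: field_simps)
  qed
qed

lemma zero_in_fourier_exps:
  assumes "lam \<noteq> 0"
  shows "0 \<in> fourier_exps lam x \<longleftrightarrow> x \<in> \<int>"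
  using assms unfolding fourier_exps_def by (auto simp: Ints_def)

text \<open>What survives of the group at a cusp: the quasi-periodicity comes from gamma_0, the
  bound from cocompactness on horospheres. The bound is asked on each horosphere separately, with a
  constant that may depend on its height.\<close>

locale koecher =
  fixes q :: "'m::finite pt \<Rightarrow> complex" and lam x :: real
  assumes lam: "lam \<noteq> 0"
    and holo: "holo_on pt_smul q H_dom"
    and quasi_per: "\<And>w. w \<in> H_dom \<Longrightarrow>
      q (fst w + \<i> * of_real lam, snd w) = exp (- (2 * of_real pi * \<i> * of_real x)) * q w"
    and horo_bound: "\<And>t. t > 0 \<Longrightarrow> \<exists>C. \<forall>w. Delta' w = t \<longrightarrow> norm (q w) \<le> C"
begin

lemma holomorphic_fst_slice: "(\<lambda>s. q (s, v)) holomorphic_on {z. Re z > (norm v)\<^sup>2 / 2}"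
  unfolding holomorphic_on_open[OF open_halfspace_Re_gt]
proof
  fix s assume "s \<in> {z. Re z > (norm v)\<^sup>2 / 2}"
  then have "(s, v) \<in> H_dom" by (simp add: H_dom_def)
  then obtain f' where f': "(q has_derivative f') (at (s, v))" "\<And>a v. f' (pt_smul a v) = a * f' v"
    using holo unfolding holo_on_def by blast
  have "((\<lambda>s. (s, v)) has_derivative (\<lambda>h. (h, 0))) (at s)"
    by (rule has_derivative_Pair[OF has_derivative_ident has_derivative_const])
  from has_derivative_compose[OF this f'(1)]
  have "((\<lambda>s. q (s, v)) has_derivative (\<lambda>h. f' (h, 0))) (at s)" .
  moreover have "(\<lambda>h. f' (h, 0)) = (*) (f' (1, 0))"
  proof
    fix h
    have "pt_smul h (1, 0) = (h, 0 :: complex ^ 'm)" by (simp add: pt_smul_def)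
    then have "f' (h, 0) = h * f' (1, 0)" using f'(2) by metis
    then show "f' (h, 0) = f' (1, 0) * h" by (simp only: mult.commute)
  qed
  ultimately have "((\<lambda>s. q (s, v)) has_field_derivative f' (1, 0)) (at s)"
    unfolding has_field_derivative_def by (simp only:)
  then show "\<exists>f'. ((\<lambda>s. q (s, v)) has_field_derivative f') (at s)" ..
qed

sublocale slice: quasi_periodic "(norm v)\<^sup>2 / 2" lam x "\<lambda>s. q (s, v)" for v
proof
  show "lam \<noteq> 0" by (rule lam)
  show "(\<lambda>s. q (s, v)) holomorphic_on {z. Re z > (norm v)\<^sup>2 / 2}" by (rule holomorphic_fst_slice)
  fix z assume "Re z > (norm v)\<^sup>2 / 2"
  then have "(z, v) \<in> H_dom" by (simp add: H_dom_def)
  from quasi_per[OF this]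
  show "q (z + \<i> * of_real lam, v) = exp (- (2 * of_real pi * \<i> * of_real x)) * q (z, v)"
    by (simp only: fst_conv snd_conv)
qed

text \<open>The base point lies over \<open>v\<close> on the horosphere Delta' = 1. It has to move
  with \<open>v\<close>, because the slice of H over \<open>v\<close> begins only at |v|^2 /
  2.\<close>

definition coef :: "real \<Rightarrow> complex ^ 'm \<Rightarrow> complex" where
  "coef m v = fourier_coeff lam m (\<lambda>s. q (s, v)) (of_real ((1 + (norm v)\<^sup>2) / 2))"

lemma coef_eq:
  assumes "m \<in> fourier_exps lam x" "Re z > (norm v)\<^sup>2 / 2"
  shows "coef m v = fourier_coeff lam m (\<lambda>s. q (s, v)) z"
  unfolding coef_def by (rule slice.fourier_coeff_const[OF _ assms(2,1)]) simp

lemma coef_bound: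
  assumes t: "t > 0"
  obtains C where "C \<ge> 0"
    "\<And>m v. m \<in> fourier_exps lam x \<Longrightarrow> norm (coef m v) \<le> C * exp (- (pi * m * (t + (norm v)\<^sup>2)))"
proof -
  obtain C where "\<forall>w. Delta' w = t \<longrightarrow> norm (q w) \<le> C" using horo_bound[OF t] ..
  then have C: "norm (q w) \<le> C" if "Delta' w = t" for w using that by blast
  have "Delta' (of_real (t / 2), 0 :: complex ^ 'm) = t" by (simp add: Delta'_eq)
  from C[OF this] have C0: "C \<ge> 0" using norm_ge_zero order_trans by blast
  show ?thesis
  proof (rule that[OF C0])
    fix m :: real and v :: "complex ^ 'm" assume m: "m \<in> fourier_exps lam x"
    \<comment> \<open>The vertical line through this point lies entirely on the horosphere of height
      t, so one constant serves all \<open>m\<close> and \<open>v\<close>; twice its real part is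
      the t + |v|^2 of the exponent.\<close>
    let ?z = "of_real ((t + (norm v)\<^sup>2) / 2) :: complex"
    have z: "Re ?z > (norm v)\<^sup>2 / 2" using t by simp
    have "norm (fourier_coeff lam m (\<lambda>s. q (s, v)) ?z) \<le> C * exp (- (2 * pi * m * Re ?z))"
      by (rule slice.norm_fourier_coeff_le'[OF z], rule C) (simp add: Delta'_eq)
    then show "norm (coef m v) \<le> C * exp (- (pi * m * (t + (norm v)\<^sup>2)))"
      unfolding coef_eq[OF m z] by (simp add: mult.assoc)
  qed
qed

lemma holo_on_snd_slice: "holo_on (*s) (\<lambda>v. q (s, v) * k) {v. (s, v) \<in> H_dom}"
  unfolding holo_on_def
proof
  fix v :: "complex ^ 'm" assume "v \<in> {v. (s, v) \<in> H_dom}"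
  then obtain f' where f': "(q has_derivative f') (at (s, v))" "\<And>a v. f' (pt_smul a v) = a * f' v"
    using holo unfolding holo_on_def by blast
  have "((\<lambda>v. (s, v)) has_derivative (\<lambda>h. (0, h))) (at v)"
    by (rule has_derivative_Pair[OF has_derivative_const has_derivative_ident])
  from has_derivative_mult_left[OF has_derivative_compose[OF this f'(1)]]
  have "((\<lambda>v. q (s, v) * k) has_derivative (\<lambda>h. f' (0, h) * k)) (at v)" .
  moreover have "f' (0, a *s h) * k = a * (f' (0, h) * k)" for a h
  proof -
    have "pt_smul a (0, h) = (0, a *s h)" by (simp add: pt_smul_def)
    then have "f' (0, a *s h) = a * f' (0, h)" using f'(2) by metis
    then show ?thesis by (simp only: mult.assoc)
  qed
  ultimately show "\<exists>f'. ((\<lambda>v. q (s, v) * k) has_derivative f') (at v) \<and> (\<forall>a h. f' (a *s h) = a * f' h)"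
    by (intro exI[of _ "\<lambda>h. f' (0, h) * k"] conjI allI)
qed

text \<open>Near a given \<open>v0\<close> one path serves all \<open>v\<close>, by independence of
  the base point; the coefficient becomes an integral over a fixed compact path with a holomorphic
  parameter.\<close>

lemma coef_holo:
  assumes m: "m \<in> fourier_exps lam x"
  shows "holo_on (*s) (coef m) UNIV"
  unfolding holo_on_def
proof
  fix v0 :: "complex ^ 'm"
  define a where "a = (norm v0)\<^sup>2 / 2 + 1"
  define U where "U = {v :: complex ^ 'm. (norm v)\<^sup>2 / 2 < a}"
  have "open U" unfolding U_def by (intro open_Collect_less continuous_intros) auto
  moreover have "v0 \<in> U" by (simp add: U_def a_def)
  ultimately obtain \<rho> where \<rho>: "\<rho> > 0" "cball v0 \<rho> \<subseteq> U" by (meson open_contains_cball)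
  define z where "z = (of_real a :: complex)"
  define l where "l = (\<lambda>t::real. linepath z (z + \<i> * of_real lam) t)"
  have Re_l: "Re (l t) = a" for t by (simp add: l_def linepath_def z_def algebra_simps)
  have H: "(l t, v) \<in> H_dom" if "v \<in> U" for t v using that by (simp add: H_dom_def Re_l U_def)
  have cont_l: "continuous_on A l" for A unfolding l_def linepath_def by (intro continuous_intros)
  define k where "k = (\<lambda>t. exp (- (2 * of_real pi * of_real m * l t)))"
  have cont_k: "continuous_on A k" for A unfolding k_def by (intro continuous_intros cont_l)
  define \<Phi> where "\<Phi> = (\<lambda>t v. q (l t, v) * k t)"
  have cont_q: "continuous_on H_dom q" by (rule holo_on_imp_continuous_on[OF holo])
  have coef: "coef m v = integral {0..1} (\<lambda>t. \<Phi> t v)" if "v \<in> U" for v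
  proof -
    have "coef m v = fourier_coeff lam m (\<lambda>s. q (s, v)) z"
      by (rule coef_eq[OF m]) (use that in \<open>simp add: U_def z_def\<close>)
    also have "\<dots> = integral {0..1} (\<lambda>t. \<Phi> t v * (\<i> * of_real lam)) / (\<i> * of_real lam)"
      unfolding fourier_coeff_def contour_integral_integral vector_derivative_linepath_at
      by (simp add: \<Phi>_def k_def l_def)
    also have "\<dots> = integral {0..1} (\<lambda>t. \<Phi> t v)" using lam by simp
    finally show ?thesis .
  qed
  have "compact (l ` {0..1} \<times> cball v0 \<rho>)"
    by (intro compact_Times compact_continuous_image cont_l) auto
  moreover have "l ` {0..1} \<times> cball v0 \<rho> \<subseteq> H_dom" using H \<rho>(2) by auto
  ultimately have "bounded (q ` (l ` {0..1} \<times> cball v0 \<rho>))"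
    by (intro compact_imp_bounded compact_continuous_image continuous_on_subset[OF cont_q])
  then obtain M1 where M1: "\<And>t v. t \<in> {0..1} \<Longrightarrow> v \<in> cball v0 \<rho> \<Longrightarrow> norm (q (l t, v)) \<le> M1"
    unfolding bounded_iff by fastforce
  have norm_k: "norm (k t) = exp (- (2 * pi * m * a))" for t
    by (simp add: k_def Re_l)
  have "\<exists>D. ((\<lambda>v. integral {0..1} (\<lambda>t. \<Phi> t v)) has_derivative D) (at v0) \<and> (\<forall>a v. D (a *s v) = a * D v)"
  proof (rule holo_on_integral[OF \<rho>(1)])
    fix t :: real assume t: "t \<in> {0..1}"
    have "holo_on (*s) (\<Phi> t) {v. (l t, v) \<in> H_dom}" unfolding \<Phi>_def by (rule holo_on_snd_slice)
    then show "holo_on (*s) (\<Phi> t) (ball v0 \<rho>)"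
      unfolding holo_on_def using H \<rho>(2) ball_subset_cball by blast
    show "norm (\<Phi> t v) \<le> M1 * exp (- (2 * pi * m * a))" if "v \<in> ball v0 \<rho>" for v
      using M1[OF t, of v] that by (simp only: \<Phi>_def norm_mult norm_k) (simp add: mult_right_mono)
  next
    fix v assume "v \<in> ball v0 \<rho>"
    then have "v \<in> U" using \<rho>(2) by auto
    then have "(\<lambda>t. (l t, v)) ` {0..1} \<subseteq> H_dom" using H by auto
    then show "continuous_on {0..1} (\<lambda>t. \<Phi> t v)"
      unfolding \<Phi>_def
      by (intro continuous_on_mult cont_k continuous_on_compose2[OF cont_q] continuous_on_Pair cont_l continuous_on_const)
  qed
  then obtain D where D: "((\<lambda>v. integral {0..1} (\<lambda>t. \<Phi> t v)) has_derivative D) (at v0)"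
    "\<forall>a v. D (a *s v) = a * D v" by auto
  have "(coef m has_derivative D) (at v0)"
    by (rule has_derivative_transform_within_open[OF D(1) \<open>open U\<close> \<open>v0 \<in> U\<close>]) (simp add: coef)
  with D(2) show "\<exists>f'. (coef m has_derivative f') (at v0) \<and> (\<forall>a v. f' (a *s v) = a * f' v)"
    by (intro exI[of _ D]) simp
qed

text \<open>Koecher principle: a coefficient with \<open>m \<ge> 0\<close> is bounded because every horosphere is
  cocompact, so Liouville's theorem applies on complex lines.\<close>

lemma coef_const:
  assumes m: "m \<in> fourier_exps lam x" "m \<ge> 0"
  shows "coef m v = coef m 0"
proof -
  obtain C where C': "C \<ge> 0" "\<And>m v. m \<in> fourier_exps lam x \<Longrightarrow>
      norm (coef m v) \<le> C * exp (- (pi * m * (1 + (norm v)\<^sup>2)))"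
    by (fact coef_bound[of 1, simplified])
  note C = C'(1) C'(2)[OF m(1)]
  have b: "norm (coef m u) \<le> C" for u
  proof -
    have "C * exp (- (pi * m * (1 + (norm u)\<^sup>2))) \<le> C * 1"
      using m(2) C(1) by (intro mult_left_mono) auto
    then show ?thesis using C(2)[of u] by simp
  qed
  have "(\<lambda>z. coef m (0 + z *s v)) field_differentiable (at z)" for z
    by (rule holo_on_line_differentiable[OF coef_holo[OF m(1)]]) simp
  then have "(\<lambda>z. coef m (0 + z *s v)) holomorphic_on UNIV"
    by (simp add: holomorphic_on_def field_differentiable_at_within)
  moreover have "bounded (range (\<lambda>z. coef m (0 + z *s v)))"
    using b by (auto simp: bounded_iff)
  ultimately have "(\<lambda>z. coef m (0 + z *s v)) constant_on UNIV" by (rule Liouville_theorem)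
  then obtain c where c: "\<And>z. coef m (0 + z *s v) = c" by (auto simp: constant_on_def)
  show ?thesis using c[of 1] c[of 0] by simp
qed

text \<open>The coefficient is constant, yet the horosphere bound at \<open>v\<close> decays like
  exp(-pi m |v|^2). A direction in which |v| can grow exists because n >= 2.\<close>

lemma coef_pos_zero:
  assumes m: "m \<in> fourier_exps lam x" "m > 0"
  shows "coef m v = 0"
proof (rule ccontr)
  assume "coef m v \<noteq> 0"
  then have nz: "norm (coef m 0) > 0" using coef_const[of m v] m by simp
  obtain C where C': "C \<ge> 0" "\<And>m v. m \<in> fourier_exps lam x \<Longrightarrow>
      norm (coef m v) \<le> C * exp (- (pi * m * (1 + (norm v)\<^sup>2)))"
    by (fact coef_bound[of 1, simplified])
  note C = C'(1) C'(2)[OF m(1)]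
  \<comment> \<open>Chosen so that \<open>norm (coef m 0) * (pi * m * R) = C\<close>. Since exp y >
    y, a vector with squared norm \<open>R\<close> already contradicts the bound.\<close>
  define R where "R = C / (norm (coef m 0) * (pi * m))"
  have R: "R \<ge> 0" using C(1) m(2) by (simp add: R_def)
  define u where "u = (of_real (sqrt R) *s axis undefined 1 :: complex ^ 'm)"
  have "norm (axis i (1::complex) :: complex ^ 'm) = 1" for i
  proof -
    have "(norm (axis i (1::complex) $ j))\<^sup>2 = (if j = i then 1 else 0)" for j :: 'm
      by (simp add: axis_def)
    then show ?thesis by (simp add: norm_vec_def L2_set_def)
  qed
  then have u: "(norm u)\<^sup>2 = R" using R by (simp add: u_def norm_smult_vec)
  have "norm (coef m 0) \<le> C * exp (- (pi * m * (1 + R)))"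
    using C(2)[of u] coef_const[of m u] m u by simp
  then have "norm (coef m 0) * exp (pi * m * (1 + R)) \<le> C * exp (- (pi * m * (1 + R))) * exp (pi * m * (1 + R))"
    by (rule mult_right_mono) simp
  also have "\<dots> = C" by (simp only: mult.assoc exp_add[symmetric]) simp
  finally have le: "norm (coef m 0) * exp (pi * m * (1 + R)) \<le> C" .
  have pm: "pi * m > 0" using m(2) by simp
  have "pi * m * R < pi * m * (1 + R)" using pm by (simp only: distrib_left)
  also have "\<dots> < exp (pi * m * (1 + R))"
    using exp_ge_add_one_self[of "pi * m * (1 + R)"] by linarith
  finally have "norm (coef m 0) * (pi * m * R) < norm (coef m 0) * exp (pi * m * (1 + R))"
    using nz by (rule mult_strict_left_mono)
  moreover have "norm (coef m 0) * (pi * m * R) = C" using nz m(2) by (simp add: R_def)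
  ultimately show False using le by linarith
qed

text \<open>The Gaussian factor of the coefficient bound combines with exp(2 pi m Re w_1) so that
  only Delta' remains. For m < 0 the result decays in |m| at all points above the horosphere of
  height t.\<close>

lemma term_bound:
  assumes t: "t > 0"
  obtains C where "C \<ge> 0"
    "\<And>m w. m \<in> fourier_exps lam x \<Longrightarrow>
       norm (fourier_term coef w m) \<le> (if m \<le> 0 then C * exp (pi * m * (Delta' w - t)) else 0)"
proof -
  obtain C where C: "C \<ge> 0"
    "\<And>m v. m \<in> fourier_exps lam x \<Longrightarrow> norm (coef m v) \<le> C * exp (- (pi * m * (t + (norm v)\<^sup>2)))"
    by (fact coef_bound[OF t])
  show ?thesis
  proof (rule that[OF C(1)])
    fix m :: real and w :: "'m pt" assume m: "m \<in> fourier_exps lam x"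
    show "norm (fourier_term coef w m) \<le> (if m \<le> 0 then C * exp (pi * m * (Delta' w - t)) else 0)"
    proof (cases "m \<le> 0")
      case True
      have "norm (fourier_term coef w m) = norm (coef m (snd w)) * exp (2 * pi * m * Re (fst w))"
        by (simp add: fourier_term_def norm_mult)
      also have "\<dots> \<le> C * exp (- (pi * m * (t + (norm (snd w))\<^sup>2))) * exp (2 * pi * m * Re (fst w))"
        by (intro mult_right_mono C m) simp
      also have "\<dots> = C * exp (pi * m * (Delta' w - t))"
        by (simp add: exp_add[symmetric] Delta'_eq algebra_simps)
      finally show ?thesis using True by simp
    next
      case False
      then show ?thesis using coef_pos_zero[OF m] by (simp add: fourier_term_def)
    qed
  qed
qed

lemma term_summable:
  assumes w: "w \<in> H_dom"
  shows "(\<lambda>m. norm (fourier_term coef w m)) summable_on fourier_exps lam x"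
proof -
  \<comment> \<open>The coefficients are estimated on the horosphere at half the height of
    \<open>w\<close>, which leaves the factor exp(pi m Delta'/2) for the summation.\<close>
  have t: "Delta' w / 2 > 0" using w by (simp add: H_dom_iff)
  obtain C where C: "C \<ge> 0" "\<And>m w'. m \<in> fourier_exps lam x \<Longrightarrow>
       norm (fourier_term coef w' m) \<le> (if m \<le> 0 then C * exp (pi * m * (Delta' w' - Delta' w / 2)) else 0)"
    by (fact term_bound[OF t])
  show ?thesis
  proof (rule summable_on_comparison_test)
    show "(\<lambda>m. C * (if m \<le> 0 then exp ((pi * (Delta' w / 2)) * m) else 0)) summable_on fourier_exps lam x"
      using t by (intro summable_on_cmult_right summable_on_fourier_exps lam) simp
    show "norm (fourier_term coef w m) \<le> C * (if m \<le> 0 then exp ((pi * (Delta' w / 2)) * m) else 0)"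
      if "m \<in> fourier_exps lam x" for m
      using C(2)[OF that, of w] by (simp add: algebra_simps split: if_splits)
  qed simp
qed

lemma term_has_sum:
  assumes w: "w \<in> H_dom"
  shows "(fourier_term coef w has_sum q w) (fourier_exps lam x)"
proof -
  let ?v = "snd w"
  let ?z = "of_real ((1 + (norm ?v)\<^sup>2) / 2) :: complex"
  have eq: "fourier_term coef w = (\<lambda>m. fourier_coeff lam m (\<lambda>s. q (s, ?v)) ?z * exp (2 * of_real pi * of_real m * fst w))"
    by (rule ext) (simp add: fourier_term_def coef_def)
  have "fourier_term coef w summable_on fourier_exps lam x"
    using term_summable[OF w] by (simp only: summable_on_iff_abs_summable_on_complex)
  then have "(fourier_term coef w has_sum q (fst w, ?v)) (fourier_exps lam x)"
    unfolding eq by (intro slice.fourier_has_sum) (use w in \<open>simp_all add: H_dom_def\<close>)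
  then show ?thesis by simp
qed

lemma coef_unique:
  assumes c: "\<And>w. w \<in> H_dom \<Longrightarrow> (fourier_term c w has_sum q w) (fourier_exps lam x)"
    and m: "m \<in> fourier_exps lam x"
  shows "c m v = coef m v"
proof -
  let ?z = "of_real ((1 + (norm v)\<^sup>2) / 2) :: complex"
  have z: "Re ?z > (norm v)\<^sup>2 / 2" by simp
  show ?thesis unfolding coef_def
  proof (rule slice.fourier_coeff_unique[where c="\<lambda>m. c m v", OF z m])
    fix s assume "Re s = Re ?z"
    then have "(s, v) \<in> H_dom" using z by (simp add: H_dom_def)
    from c[OF this] show "((\<lambda>m. c m v * exp (2 * of_real pi * of_real m * s)) has_sum q (s, v)) (fourier_exps lam x)"
      unfolding fourier_term_def[abs_def] by simp
  qed
qed

lemma term_uniform_limit: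
  assumes K: "compact K" "K \<subseteq> H_dom"
  shows "uniform_limit K (\<lambda>F w. \<Sum>m\<in>F. fourier_term coef w m) q (finite_subsets_at_top (fourier_exps lam x))"
proof (cases "K = {}")
  case False
  \<comment> \<open>Half of the lowest height occurring in \<open>K\<close> yields a single majorant
    for all points of \<open>K\<close>.\<close>
  have "\<exists>w0\<in>K. \<forall>w\<in>K. Delta' w0 \<le> Delta' w"
    by (rule continuous_attains_inf[OF K(1) False continuous_on_Delta'])
  then obtain w0 where w0: "w0 \<in> K" "\<And>w. w \<in> K \<Longrightarrow> Delta' w0 \<le> Delta' w" by (elim bexE) simp
  have t: "Delta' w0 / 2 > 0" using w0 K by (auto simp: H_dom_iff)
  obtain C where C: "C \<ge> 0" "\<And>m w. m \<in> fourier_exps lam x \<Longrightarrow>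
       norm (fourier_term coef w m) \<le> (if m \<le> 0 then C * exp (pi * m * (Delta' w - Delta' w0 / 2)) else 0)"
    by (fact term_bound[OF t])
  show ?thesis
  proof (rule Weierstrass_m_test_general')
    show "(\<lambda>m. C * (if m \<le> 0 then exp ((pi * (Delta' w0 / 2)) * m) else 0)) summable_on fourier_exps lam x"
      using t by (intro summable_on_cmult_right summable_on_fourier_exps lam) simp
    show "(fourier_term coef w has_sum q w) (fourier_exps lam x)" if "w \<in> K" for w
      by (rule term_has_sum) (use that K in auto)
    fix m w assume m: "m \<in> fourier_exps lam x" and w: "w \<in> K"
    show "norm (fourier_term coef w m) \<le> C * (if m \<le> 0 then exp ((pi * (Delta' w0 / 2)) * m) else 0)"
    proof (cases "m \<le> 0")
      case True
      have "pi * m * (Delta' w - Delta' w0 / 2) \<le> (pi * m) * (Delta' w0 / 2)"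
        using True w0(2)[OF w] by (intro mult_left_mono_neg) (auto simp: mult_nonneg_nonpos)
      then have "C * exp (pi * m * (Delta' w - Delta' w0 / 2)) \<le> C * exp ((pi * (Delta' w0 / 2)) * m)"
        using C(1) by (intro mult_left_mono) (auto simp: mult_ac)
      then show ?thesis using C(2)[OF m, of w] True by simp
    qed (use C(2)[OF m, of w] in simp)
  qed
qed simp

text \<open>The exponent is split: the height above \<open>y\<close> is charged with the gap below
  zero and produces the decay, while the remaining y/2 is kept for the summation over m. The
  subtracted value is the constant term m = 0, which occurs exactly when x is an integer.\<close>

lemma exponential_decay:
  assumes y: "y > 0"
  shows "\<exists>\<kappa> C. \<kappa> > 0 \<and> (\<forall>w. Delta' w \<ge> y \<longrightarrow>
    norm (q w - (if x \<in> \<int> then coef 0 0 else 0)) \<le> C * exp (- (\<kappa> * Delta' w)))"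
proof -
  let ?X = "fourier_exps lam x"
  let ?a = "if x \<in> \<int> then coef 0 0 else 0"
  have "\<exists>\<mu>>0. \<forall>m\<in>?X. m < 0 \<longrightarrow> m \<le> - \<mu>" by (rule fourier_exps_neg_gap[OF lam])
  then obtain \<mu> where \<mu>: "\<mu> > 0" "\<And>m. m \<in> ?X \<Longrightarrow> m < 0 \<Longrightarrow> m \<le> - \<mu>" by (elim exE conjE) simp
  have t: "y / 2 > 0" using y by simp
  obtain C where C: "C \<ge> 0" "\<And>m w. m \<in> ?X \<Longrightarrow>
       norm (fourier_term coef w m) \<le> (if m \<le> 0 then C * exp (pi * m * (Delta' w - y / 2)) else 0)"
    by (fact term_bound[OF t])
  let ?b = "\<lambda>m. if m \<le> 0 then exp ((pi * (y / 2)) * m) else 0"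
  have bs: "?b summable_on ?X" using t by (intro summable_on_fourier_exps lam) simp
  show ?thesis
  proof (rule exI[of _ "pi * \<mu>"], rule exI[of _ "C * exp (pi * \<mu> * y) * infsum ?b ?X"], intro conjI allI impI)
    show "pi * \<mu> > 0" using \<mu>(1) by simp
    fix w :: "'m pt" assume w: "Delta' w \<ge> y"
    then have wH: "w \<in> H_dom" using y by (simp add: H_dom_iff)
    have a: "((\<lambda>m. if m = 0 then ?a else 0) has_sum ?a) ?X"
    proof (cases "x \<in> \<int>")
      case True
      then have "0 \<in> ?X" using zero_in_fourier_exps[OF lam] by simp
      then show ?thesis by (intro has_sum_finite_neutralI[of "{0}"]) auto
    next
      case False
      then show ?thesis by simp
    qed
    have "((\<lambda>m. fourier_term coef w m + - (if m = 0 then ?a else 0)) has_sum q w + - ?a) ?X"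
      by (intro has_sum_add term_has_sum[OF wH] has_sum_uminusI a)
    then have hs: "((\<lambda>m. fourier_term coef w m - (if m = 0 then ?a else 0)) has_sum q w - ?a) ?X" by simp
    have le: "norm (fourier_term coef w m - (if m = 0 then ?a else 0)) \<le> C * exp (- (pi * \<mu> * (Delta' w - y))) * ?b m"
      if m: "m \<in> ?X" for m
    proof (cases "m < 0")
      case True
      have "(Delta' w - y) * m \<le> (Delta' w - y) * (- \<mu>)"
        using \<mu>(2)[OF m True] w by (intro mult_left_mono) auto
      then have "pi * ((Delta' w - y) * m) \<le> pi * ((Delta' w - y) * (- \<mu>))"
        by (rule mult_left_mono) simp
      then have "pi * m * (Delta' w - y / 2) \<le> - (pi * \<mu> * (Delta' w - y)) + (pi * (y / 2)) * m"
        by (simp add: algebra_simps)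
      then have "C * exp (pi * m * (Delta' w - y / 2)) \<le> C * (exp (- (pi * \<mu> * (Delta' w - y))) * exp ((pi * (y / 2)) * m))"
        unfolding exp_add[symmetric] using C(1) by (intro mult_left_mono) auto
      then show ?thesis using C(2)[OF m, of w] True by (simp add: mult.assoc)
    next
      case False
      show ?thesis
      proof (cases "m = 0")
        case True
        then have "x \<in> \<int>" using m zero_in_fourier_exps[OF lam] by simp
        moreover have "fourier_term coef w m = coef 0 0"
          using True m coef_const[of 0 "snd w"] by (simp add: fourier_term_def)
        ultimately show ?thesis using True C(1) by simp
      next
        case False
        with \<open>\<not> m < 0\<close> show ?thesis using C(2)[OF m, of w] by simp
      qed
    qed
    have "norm (q w - ?a) \<le> infsum (\<lambda>m. C * exp (- (pi * \<mu> * (Delta' w - y))) * ?b m) ?X"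
      using norm_infsum_le[OF hs has_sum_infsum[OF summable_on_cmult_right[OF bs]] le] by simp
    also have "\<dots> = C * exp (- (pi * \<mu> * (Delta' w - y))) * infsum ?b ?X"
      by (rule infsum_cmult_right) (rule bs)
    also have "\<dots> = C * exp (pi * \<mu> * y) * infsum ?b ?X * exp (- (pi * \<mu> * Delta' w))"
      by (simp add: algebra_simps exp_diff exp_minus divide_inverse)
    finally show "norm (q w - ?a) \<le> C * exp (pi * \<mu> * y) * infsum ?b ?X * exp (- (pi * \<mu> * Delta' w))" .
  qed
qed

end

section \<open>Integrability at the cusp\<close>

lemma ennreal_le_suminf: "f j \<le> (\<Sum>i. f i :: ennreal)"
  using sum_le_suminf[of f "{j}"] by (simp add: summableI)

lemma powr_exp_bounded:
  fixes \<kappa> t p :: real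
  assumes "\<kappa> > 0" "t > 0"
  shows "\<exists>B. \<forall>y\<ge>t. y powr p * exp (- (\<kappa> * y)) \<le> B"
proof -
  have "((\<lambda>y. y powr p * exp (- (\<kappa> * y))) \<longlongrightarrow> 0) at_top" using assms(1) by real_asymp
  then have "\<forall>\<^sub>F y in at_top. y powr p * exp (- (\<kappa> * y)) < 1" by (rule order_tendstoD) simp
  then obtain T where T: "\<And>y. y \<ge> T \<Longrightarrow> y powr p * exp (- (\<kappa> * y)) < 1"
    by (auto simp: eventually_at_top_linorder)
  have "continuous_on {t..T} (\<lambda>y. y powr p * exp (- (\<kappa> * y)))"
    using assms(2) by (intro continuous_intros) auto
  then have "bounded ((\<lambda>y. y powr p * exp (- (\<kappa> * y))) ` {t..T})"
    by (intro compact_imp_bounded compact_continuous_image) auto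
  then obtain B where B: "\<And>y. y \<in> {t..T} \<Longrightarrow> \<bar>y powr p * exp (- (\<kappa> * y))\<bar> \<le> B"
    unfolding bounded_iff by fastforce
  have "y powr p * exp (- (\<kappa> * y)) \<le> max B 1" if "y \<ge> t" for y
    using B[of y] T[of y] that by (cases "y \<ge> T") auto
  then show ?thesis by blast
qed

lemma sets_H_measure [simp, measurable_cong]: "sets H_measure = sets borel"
  by (simp add: H_measure_def)

lemma space_H_measure [simp]: "space H_measure = UNIV"
  by (simp add: H_measure_def)

lemma borel_measurable_Delta' [measurable]: "Delta' \<in> borel_measurable borel"
  by (rule borel_measurable_continuous_onI[OF continuous_on_Delta'])

lemma sets_H_dom [measurable]: "H_dom \<in> sets borel"
  by (rule borel_open[OF open_H_dom])

locale cusp_neighbourhood =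
  fixes V :: "(real \<times> (complex ^ 'm::finite)) set" and t1 :: real
  assumes V: "open V" "bounded V" "V \<noteq> {}" and t1: "t1 > 0"
begin

definition P :: "'m pt set" where
  "P = {w. (Im (fst w), snd w) \<in> V \<and> Delta' w > t1}"

lemma P_subset: "P \<subseteq> H_dom"
  using t1 by (auto simp: P_def H_dom_iff)

lemma open_P: "open P"
proof -
  have "open ((\<lambda>w :: 'm pt. (Im (fst w), snd w)) -` V)"
    by (intro open_vimage V continuous_intros)
  then have "open ((\<lambda>w :: 'm pt. (Im (fst w), snd w)) -` V \<inter> {w. Delta' w > t1})"
    by (rule open_Int[OF _ open_Delta'_gt])
  moreover have "P = (\<lambda>w. (Im (fst w), snd w)) -` V \<inter> {w. Delta' w > t1}" by (auto simp: P_def)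
  ultimately show ?thesis by simp
qed

lemma sets_P [measurable]: "P \<in> sets borel"
  by (rule borel_open[OF open_P])

lemma emeasure_P_finite: "emeasure H_measure P < \<infinity>"
proof -
  let ?N = "CARD('m) + 2"
  obtain \<beta> where \<beta>: "\<And>p. p \<in> V \<Longrightarrow> norm p \<le> \<beta>" using V(2) unfolding bounded_iff by blast
  \<comment> \<open>From 2 Re w_1 = Delta' + |w_2|^2 and Delta' > t1 one gets j + 1 <= L Delta'. Two
    of the n + 1 factors of the density are spent on this inequality; the other
    \<open>CARD('m)\<close> are bounded by 1/t1 each, which gives \<open>K\<close>.\<close>
  define L where "L = (1 + (\<beta>\<^sup>2 + 2) / t1) / 2"
  have L: "L > 0" using t1 by (simp add: L_def add_pos_nonneg)
  define K where "K = L\<^sup>2 / t1 ^ CARD('m)"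
  have K: "K \<ge> 0" using t1 by (simp add: K_def)
  \<comment> \<open>In the radius, 1 accounts for the fractional part of Re w_1, and each \<beta>
    for one of Im w_1 and w_2.\<close>
  define Bx where "Bx = (\<lambda>j::nat. cball (of_nat j, 0) (1 + 2 * \<beta>) :: 'm pt set)"
  let ?k = "\<lambda>j. ennreal (K * inverse (real (Suc j) ^ 2))" and ?D = "\<lambda>w. ennreal (indicator H_dom w / Delta' w ^ ?N)"
  have Bx [measurable]: "Bx j \<in> sets borel" for j by (simp add: Bx_def)
  have pw: "?D w * indicator P w
      \<le> (\<Sum>j. ?k j * indicator (Bx j) w)" for w
  proof (cases "w \<in> P")
    case True
    then have w: "norm (Im (fst w), snd w) \<le> \<beta>" "Delta' w > t1" using \<beta> by (auto simp: P_def)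
    have n1: "\<bar>Im (fst w)\<bar> \<le> \<beta>" "norm (snd w) \<le> \<beta>"
      using w(1) norm_fst_le[of "Im (fst w)" "snd w"] norm_snd_le[of "snd w" "Im (fst w)"] by auto
    have Re: "Re (fst w) > 0"
      using w(2) t1 zero_le_power2[of "norm (snd w)"] unfolding Delta'_eq by linarith
    define j where "j = nat \<lfloor>Re (fst w)\<rfloor>"
    have j: "real j \<le> Re (fst w)" "Re (fst w) < real j + 1" using Re unfolding j_def by linarith+
    have "norm (w - (of_nat j, 0)) \<le> norm (fst w - of_nat j) + norm (snd w)"
      using norm_Pair_le[of "fst w - of_nat j" "snd w"] by (cases w) simp
    also have "norm (fst w - of_nat j) \<le> \<bar>Re (fst w - of_nat j)\<bar> + \<bar>Im (fst w - of_nat j)\<bar>"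
      by (rule cmod_le)
    also have "\<dots> + norm (snd w) \<le> 1 + 2 * \<beta>" using j n1 by simp
    finally have mem: "w \<in> Bx j" by (simp add: Bx_def dist_norm norm_minus_commute)
    have "(norm (snd w))\<^sup>2 \<le> \<beta>\<^sup>2" using n1(2) by (intro power_mono) auto
    then have "2 * (real j + 1) \<le> Delta' w + (\<beta>\<^sup>2 + 2)" using j by (simp add: Delta'_eq)
    also have "\<beta>\<^sup>2 + 2 \<le> (\<beta>\<^sup>2 + 2) / t1 * Delta' w"
      using w(2) t1 by (simp add: pos_le_divide_eq mult_left_mono add_nonneg_nonneg)
    finally have jL: "real (Suc j) \<le> L * Delta' w" by (simp add: L_def algebra_simps)
    have D0: "Delta' w > 0" using w(2) t1 by simp
    have "real (Suc j) ^ 2 * t1 ^ CARD('m) \<le> (L * Delta' w) ^ 2 * Delta' w ^ CARD('m)"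
      using jL w(2) t1 D0 L by (intro mult_mono power_mono) auto
    also have "\<dots> = L\<^sup>2 * Delta' w ^ ?N" by (simp add: power_mult_distrib power_add power2_eq_square mult_ac)
    finally have "1 / Delta' w ^ ?N \<le> K * inverse (real (Suc j) ^ 2)"
      using D0 t1 by (simp add: K_def field_simps)
    then have "?D w * indicator P w
       \<le> ?k j * indicator (Bx j) w"
      using True P_subset mem by (simp add: ennreal_leI indicator_def subsetD)
    also have "\<dots> \<le> (\<Sum>j. ?k j * indicator (Bx j) w)"
      by (rule ennreal_le_suminf)
    finally show ?thesis .
  qed simp
  have "emeasure H_measure P = (\<integral>\<^sup>+w. ?D w * indicator P w \<partial>lborel)"
    unfolding H_measure_def by (rule emeasure_density) measurable
  also have "\<dots> \<le> (\<integral>\<^sup>+w. (\<Sum>j. ?k j * indicator (Bx j) w) \<partial>lborel)"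
    by (rule nn_integral_mono) (rule pw)
  also have "\<dots> = (\<Sum>j. \<integral>\<^sup>+w. ?k j * indicator (Bx j) w \<partial>lborel)"
    by (rule nn_integral_suminf) measurable
  also have "\<dots> = (\<Sum>j. ?k j * emeasure lborel (Bx j))"
    by (simp add: nn_integral_cmult_indicator)
  also have "\<dots> = (\<Sum>j. ?k j * emeasure lborel (Bx 0))"
  proof -
    have "norm p \<ge> 0 \<and> norm p \<le> \<beta>" if "p \<in> V" for p using \<beta>[OF that] by simp
    then have "\<beta> \<ge> 0" using V(3) by fastforce
    then have eq: "emeasure lborel (Bx j) = emeasure lborel (Bx 0)" for j
      unfolding Bx_def by (subst (1 2) emeasure_cball) auto
    show ?thesis by (intro suminf_cong arg_cong2[where f="(*)"] refl eq)
  qed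
  also have "\<dots> = (\<Sum>j. ?k j) * emeasure lborel (Bx 0)"
    by (rule ennreal_suminf_multc)
  also have "(\<Sum>j. ?k j) = ennreal (\<Sum>j. K * inverse (real (Suc j) ^ 2))"
  proof (rule suminf_ennreal2)
    have "summable (\<lambda>j. inverse (real j ^ 2))" by (rule inverse_power_summable) simp
    then have "summable (\<lambda>j. inverse (real (Suc j) ^ 2))" by (subst summable_Suc_iff)
    then show "summable (\<lambda>j. K * inverse (real (Suc j) ^ 2))" by (rule summable_mult)
  qed (use K in simp)
  also have "\<dots> * emeasure lborel (Bx 0) < \<infinity>"
    using emeasure_bounded_finite[of "Bx 0"] by (simp add: ennreal_mult_less_top Bx_def)
  finally show ?thesis .
qed

section \<open>Integrability of a function that is exponentially close to a constant\<close>

context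
  fixes q :: "'m pt \<Rightarrow> complex" and a :: complex and C \<kappa> p :: real
  assumes cont: "continuous_on H_dom q" and \<kappa>: "\<kappa> > 0"
    and decay: "\<And>w. Delta' w \<ge> t1 \<Longrightarrow> norm (q w - a) \<le> C * exp (- (\<kappa> * Delta' w))"
begin

abbreviation (input) h :: "'m pt \<Rightarrow> complex" where
  "h \<equiv> \<lambda>w. q w * of_real (Delta' w powr p)"

lemma h_measurable: "h \<in> borel_measurable (restrict_space H_measure P)"
proof -
  have "continuous_on P h"
  proof (intro continuous_on_mult continuous_on_of_real continuous_on_powr)
    show "continuous_on P q" by (rule continuous_on_subset[OF cont P_subset])
    show "\<forall>w\<in>P. Delta' w \<noteq> 0" using t1 by (auto simp: P_def)
  qed (rule continuous_on_Delta' continuous_on_const)+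
  then have "h \<in> borel_measurable (restrict_space borel P)"
    by (rule borel_measurable_continuous_on_restrict)
  moreover have "sets (restrict_space H_measure P) = sets (restrict_space borel P)"
    by (rule sets_restrict_space_cong) simp
  ultimately show ?thesis by (simp cong: measurable_cong_sets)
qed

text \<open>Exponential decay beats every power of Delta', so the function is bounded, and a bounded
  function on a set of finite measure lies in every L^s.\<close>

lemma in_Lp_cusp:
  assumes a: "a = 0" and s: "1 \<le> s"
  shows "in_Lp s (restrict_space H_measure P) h"
proof -
  obtain B where B: "\<And>y. y \<ge> t1 \<Longrightarrow> y powr p * exp (- (\<kappa> * y)) \<le> B"
    using powr_exp_bounded[OF \<kappa> t1] by blast
  \<comment> \<open>The sign of \<open>C\<close> is not part of the assumptions; it follows from the
    decay estimate at one point of height \<open>t1\<close>.\<close>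
  have "norm (q w - a) \<le> C * exp (- (\<kappa> * Delta' w))" if "Delta' w = t1" for w using decay[of w] that by simp
  from this[of "(of_real (t1 / 2), 0)"]
  have "norm (q (of_real (t1 / 2), 0) - a) \<le> C * exp (- (\<kappa> * t1))" by (simp add: Delta'_eq)
  from order_trans[OF norm_ge_zero this] have C: "C \<ge> 0" by (simp add: zero_le_mult_iff)
  have hB: "norm (h w) \<le> C * B" if "w \<in> P" for w
  proof -
    have D: "Delta' w \<ge> t1" using that by (simp add: P_def)
    have "norm (h w) = norm (q w) * Delta' w powr p" by (simp add: norm_mult)
    also have "\<dots> \<le> C * exp (- (\<kappa> * Delta' w)) * Delta' w powr p"
      using decay[OF D] a by (intro mult_right_mono) auto
    also have "\<dots> = C * (Delta' w powr p * exp (- (\<kappa> * Delta' w)))" by simp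
    also have "\<dots> \<le> C * B" using B[OF D] C by (intro mult_left_mono)
    finally show ?thesis .
  qed
  have space: "space (restrict_space H_measure P) = P" by (simp add: space_restrict_space)
  show ?thesis
  proof (cases "s = \<infinity>")
    case True
    have "AE w in restrict_space H_measure P. norm (h w) \<le> C * B"
      by (rule AE_I2) (use hB space in auto)
    then show ?thesis using True h_measurable by (auto simp: in_Lp_def)
  next
    case False
    have "(\<integral>\<^sup>+w. ennreal (norm (h w) powr enn2real s) \<partial>restrict_space H_measure P)
        \<le> (\<integral>\<^sup>+w. ennreal ((C * B) powr enn2real s) \<partial>restrict_space H_measure P)"
    proof (rule nn_integral_mono)
      fix w assume "w \<in> space (restrict_space H_measure P)"
      then have "norm (h w) \<le> C * B" using hB space by simp
      then show "ennreal (norm (h w) powr enn2real s) \<le> ennreal ((C * B) powr enn2real s)"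
        by (intro ennreal_leI powr_mono2) auto
    qed
    also have "\<dots> = ennreal ((C * B) powr enn2real s) * emeasure H_measure P"
      by (simp add: emeasure_restrict_space space_restrict_space)
    also have "\<dots> < \<infinity>" using emeasure_P_finite by (simp add: ennreal_mult_less_top)
    finally show ?thesis using False h_measurable by (simp add: in_Lp_def)
  qed
qed

text \<open>High in the cusp |q| stays above |a|/2. As Delta' >= 1 there, the smallest integrand
  belongs to p = n and s = 1: Delta'^n against the density leaves 1/Delta', which is at least a
  multiple of 1/(j + 1) on the j-th ball. For s infinite, some ball lies so high that a proposed
  bound fails on it.\<close>

lemma not_in_Lp_cusp:
  assumes a: "a \<noteq> 0" and s: "1 \<le> s" and p: "p \<ge> real CARD('m) + 1"
  shows "\<not> in_Lp s (restrict_space H_measure P) h"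
proof
  assume Lp: "in_Lp s (restrict_space H_measure P) h"
  let ?N = "CARD('m) + 2"
  let ?D = "\<lambda>w. ennreal (indicator H_dom w / Delta' w ^ ?N)"
  define \<alpha> where "\<alpha> = norm a / 2"
  have \<alpha>: "\<alpha> > 0" using a by (simp add: \<alpha>_def)
  have "((\<lambda>y. C * exp (- (\<kappa> * y))) \<longlongrightarrow> 0) at_top" using \<kappa> by real_asymp
  then have "\<forall>\<^sub>F y in at_top. C * exp (- (\<kappa> * y)) < \<alpha>" using \<alpha> by (rule order_tendstoD)
  then obtain T0 where T0: "\<And>y. y \<ge> T0 \<Longrightarrow> C * exp (- (\<kappa> * y)) < \<alpha>"
    by (auto simp: eventually_at_top_linorder)
  \<comment> \<open>Above this height the deviation from \<open>a\<close> is below |a|/2, powers of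
    Delta' grow with the exponent, and the condition Delta' > t1 holds.\<close>
  define T where "T = max (max T0 1) t1 + 1"
  have T: "T > T0" "T > 1" "T > t1" by (auto simp: T_def)
  have h_low: "norm (h w) \<ge> \<alpha> * Delta' w powr p" if "Delta' w \<ge> T" for w
  proof -
    have "norm (q w - a) \<le> C * exp (- (\<kappa> * Delta' w))" using that T by (intro decay) simp
    also have "\<dots> < \<alpha>" using that T by (intro T0) simp
    finally have "norm (q w - a) < \<alpha>" .
    moreover have "norm a \<le> norm (q w) + norm (q w - a)"
      using norm_triangle_ineq4[of "q w" "q w - a"] by simp
    ultimately have "\<alpha> \<le> norm (q w)" by (simp add: \<alpha>_def)
    then show ?thesis by (simp add: norm_mult mult_right_mono)
  qed
  obtain l1 u1 where lu: "(l1, u1) \<in> V" using V(3) by auto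
  obtain \<rho>0 where \<rho>0: "\<rho>0 > 0" "ball (l1, u1) \<rho>0 \<subseteq> V" using V(1) lu by (meson openE)
  \<comment> \<open>Radius at most 1/2 makes balls with centres one apart disjoint; radius at most
    \<open>\<rho>0\<close> keeps the horospherical coordinates inside \<open>V\<close>.\<close>
  define \<rho> where "\<rho> = min \<rho>0 (1 / 2)"
  have \<rho>: "\<rho> > 0" "\<rho> \<le> \<rho>0" "\<rho> \<le> 1 / 2" using \<rho>0 by (auto simp: \<rho>_def)
  \<comment> \<open>On every ball 2 Re w_1 > 2 s0 - 1 and |w_2| <= |u1| + 1, and this
    \<open>s0\<close> makes 2 s0 - 1 - (|u1| + 1)^2 equal to \<open>T\<close>.\<close>
  define s0 where "s0 = (T + (norm u1 + 1)\<^sup>2) / 2 + 1 / 2"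
  have s0: "s0 > 0" using T by (simp add: s0_def add_pos_nonneg)
  define W where "W = (\<lambda>j::nat. (Complex (s0 + real j) l1, u1) :: 'm pt)"
  define B where "B = (\<lambda>j. ball (W j) \<rho>)"
  define M where "M = 2 * s0 + 3"
  have M: "M > 0" using s0 by (simp add: M_def)
  have B_D: "\<bar>Re (fst w) - (s0 + real j)\<bar> < 1 / 2" "Delta' w \<ge> T" "Delta' w \<ge> 2 * real j"
    "Delta' w \<le> M * (real j + 1)" "w \<in> P" if "w \<in> B j" for w j
  proof -
    have d: "norm (w - W j) < \<rho>" using that by (simp add: B_def dist_norm norm_minus_commute)
    obtain w1 w2 where w: "w = (w1, w2)" by (cases w)
    have d1: "norm (w1 - Complex (s0 + real j) l1) < \<rho>" "norm (w2 - u1) < \<rho>"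
      using d norm_fst_le[of "w1 - Complex (s0 + real j) l1" "w2 - u1"] norm_snd_le[of "w2 - u1" "w1 - Complex (s0 + real j) l1"]
      by (auto simp: w W_def)
    show R: "\<bar>Re (fst w) - (s0 + real j)\<bar> < 1 / 2"
      using d1(1) abs_Re_le_cmod[of "w1 - Complex (s0 + real j) l1"] \<rho> by (simp add: w)
    have "norm w2 \<le> norm u1 + 1"
      using d1(2) \<rho> norm_triangle_ineq[of u1 "w2 - u1"] by simp
    then have sq: "(norm w2)\<^sup>2 \<le> (norm u1 + 1)\<^sup>2" by (intro power_mono) auto
    have s0': "2 * s0 = T + (norm u1 + 1)\<^sup>2 + 1" by (simp add: s0_def)
    have Dw: "Delta' w = 2 * Re w1 - (norm w2)\<^sup>2" by (simp add: Delta'_eq w)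
    have R': "Re w1 < s0 + real j + 1 / 2" "Re w1 > s0 + real j - 1 / 2"
      using R by (simp_all only: w fst_conv abs_less_iff) linarith+
    show DT: "Delta' w \<ge> T" using R' sq s0' unfolding Dw by linarith
    show "Delta' w \<ge> 2 * real j" using R' sq s0' T unfolding Dw by linarith
    have "Delta' w \<le> 2 * s0 + 1 + 2 * real j"
      using R' zero_le_power2[of "norm w2"] unfolding Dw by linarith
    also have "\<dots> \<le> M * (real j + 1)" using s0 by (simp add: M_def algebra_simps)
    finally show "Delta' w \<le> M * (real j + 1)" .
    have "(Im w1 - l1)\<^sup>2 \<le> (norm (w1 - Complex (s0 + real j) l1))\<^sup>2"
      using power_mono[OF abs_Im_le_cmod[of "w1 - Complex (s0 + real j) l1"], of 2] by simp
    then have "norm ((Im w1, w2) - (l1, u1)) \<le> norm (w - W j)"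
      by (simp add: w W_def norm_Pair)
    then have "(Im w1, w2) \<in> ball (l1, u1) \<rho>0"
      using d \<rho>(2) unfolding mem_ball dist_commute[of "(l1, u1)"] unfolding dist_norm by linarith
    then show "w \<in> P" using \<rho>0 DT T by (auto simp: P_def w)
  qed
  have B_open [measurable]: "B j \<in> sets borel" for j by (simp add: B_def)
  define vol where "vol = emeasure lborel (B 0)"
  have vol: "emeasure lborel (B j) = vol" for j
    unfolding vol_def B_def using \<rho>(1) by (subst (1 2) emeasure_ball) auto
  have vol0: "vol > 0" using \<rho>(1) unfolding vol_def B_def
    by (simp add: emeasure_ball ennreal_zero_less_mult_iff)
  have ge1: "x powr p \<ge> x ^ (CARD('m) + 1)" if "x \<ge> 1" for x
  proof -
    have "x ^ (CARD('m) + 1) = x powr real (CARD('m) + 1)" using that by (subst powr_realpow) auto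
    also have "\<dots> \<le> x powr p" using that p by (intro powr_mono) auto
    finally show ?thesis .
  qed
  show False
  proof (cases "s = \<infinity>")
    case True
    then obtain c where "AE w in restrict_space H_measure P. norm (h w) \<le> c" using Lp by (auto simp: in_Lp_def)
    then have "AE w in H_measure. w \<in> P \<longrightarrow> norm (h w) \<le> c"
      by (subst (asm) AE_restrict_space_iff) auto
    then have ae: "AE w in lborel. 0 < ?D w \<longrightarrow> w \<in> P \<longrightarrow> norm (h w) \<le> c"
      unfolding H_measure_def by (subst (asm) AE_density) auto
    \<comment> \<open>On \<open>B j\<close> the values of |h| are at least \<alpha> Delta' >=
      \<alpha> j > c, so the almost everywhere bound would force a ball of positive volume to be a
      null set.\<close>
    obtain j where j: "real j > c / \<alpha>" using reals_Archimedean2 by blast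
    have "w \<notin> B j" if "0 < ?D w \<longrightarrow> w \<in> P \<longrightarrow> norm (h w) \<le> c" for w
    proof
      assume w: "w \<in> B j"
      note D = B_D[OF w]
      have "w \<in> H_dom" using D(5) P_subset by auto
      moreover have "Delta' w > 0" using D(2) T by simp
      ultimately have "norm (h w) \<le> c" using that D(5) by simp
      then have "\<alpha> * Delta' w powr p \<le> c" using h_low[OF D(2)] by simp
      moreover have "Delta' w powr p \<ge> Delta' w ^ (CARD('m) + 1)" using D(2) T by (intro ge1) simp
      moreover have "Delta' w ^ (CARD('m) + 1) \<ge> Delta' w ^ 1" using D(2) T by (intro power_increasing) auto
      ultimately have c: "\<alpha> * Delta' w powr p \<le> c" and "Delta' w \<le> Delta' w powr p" by simp_all
      then have "\<alpha> * real j \<le> \<alpha> * Delta' w powr p" using D(3) \<alpha> by (intro mult_left_mono) auto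
      moreover have "c < \<alpha> * real j" using j \<alpha> by (simp add: pos_divide_less_eq mult.commute)
      ultimately show False using c by linarith
    qed
    with ae have "AE w in lborel. w \<notin> B j" by (auto elim: eventually_mono)
    then have "emeasure lborel {w \<in> space lborel. \<not> w \<notin> B j} = 0"
      by (subst (asm) AE_iff_measurable[OF _ refl]) (use B_open in auto)
    then show False using vol[of j] vol0 by simp
  next
    case False
    let ?r = "enn2real s"
    let ?G = "\<lambda>w. \<alpha> powr ?r * (Delta' w ^ (CARD('m) + 1))"
    have "s < top_class.top" using False by (simp add: less_top)
    then have "enn2real 1 \<le> ?r" by (rule enn2real_mono[OF s])
    then have r: "?r \<ge> 1" by simp
    \<comment> \<open>The minorant is cut off to the union of the balls, which makes it Borel on the
      whole space, whereas \<open>h\<close> is known to be measurable only on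
      \<open>P\<close>.\<close>
    define g where "g = (\<lambda>w. ennreal (?G w) * indicator (\<Union>j. B j) w)"
    have g_eq: "g w = ennreal (?G w)" if w: "w \<in> B j" for w j
    proof -
      have U: "w \<in> (\<Union>j. B j)" using w by (rule UN_I[OF UNIV_I])
      show ?thesis unfolding g_def indicator_simps(1)[OF U] by (rule mult_1_right)
    qed
    have g_0: "g w = 0" if "\<nexists>j. w \<in> B j" for w
    proof -
      have U: "w \<notin> (\<Union>j. B j)" using that by blast
      show ?thesis unfolding g_def indicator_simps(2)[OF U] by (rule mult_zero_right)
    qed
    have g_meas [measurable]: "g \<in> borel_measurable borel"
      unfolding g_def by measurable
    have g_le: "g w \<le> ennreal (norm (h w) powr ?r)" for w
    proof (cases "\<exists>j. w \<in> B j")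
      case True
      then obtain j where w: "w \<in> B j" ..
      note D = B_D[OF w]
      have D1: "Delta' w \<ge> 1" using D(2) T by simp
      have "?G w \<le> \<alpha> powr ?r * (Delta' w powr p) powr ?r"
      proof (rule mult_left_mono)
        have "Delta' w ^ (CARD('m) + 1) \<le> Delta' w powr p" by (rule ge1[OF D1])
        also have "\<dots> = (Delta' w powr p) powr 1" by simp
        also have "\<dots> \<le> (Delta' w powr p) powr ?r"
        proof (rule powr_mono[OF r])
          have "p \<ge> 0" using p by linarith
          then show "1 \<le> Delta' w powr p" by (rule ge_one_powr_ge_zero[OF D1])
        qed
        finally show "Delta' w ^ (CARD('m) + 1) \<le> (Delta' w powr p) powr ?r" .
      qed simp
      also have "\<dots> = (\<alpha> * Delta' w powr p) powr ?r" using \<alpha> by (simp add: powr_mult)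
      also have "\<dots> \<le> norm (h w) powr ?r" 
        by (rule powr_mono2[OF _ _ h_low[OF D(2)]]) (use \<alpha> r in simp_all)
      finally show ?thesis unfolding g_eq[OF w] by (rule ennreal_leI)
    next
      case False
      show ?thesis unfolding g_0[OF False] by (rule zero_le)
    qed
    \<comment> \<open>Density times minorant is \<open>\<alpha> powr ?r\<close> / Delta', and Delta'
      <= M (j + 1) on the j-th ball.\<close>
    let ?c = "\<lambda>j::nat. (\<alpha> powr ?r / M) * inverse (real (Suc j))"
    have "(\<Sum>j. ennreal (?c j)) * vol = (\<Sum>j. ennreal (?c j) * emeasure lborel (B j))"
      by (simp add: vol ennreal_suminf_multc)
    also have "\<dots> = (\<Sum>j. \<integral>\<^sup>+w. ennreal (?c j) * indicator (B j) w \<partial>lborel)"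
      by (rule suminf_cong, rule nn_integral_cmult_indicator[symmetric]) (simp add: B_open)
    also have "\<dots> = (\<integral>\<^sup>+w. (\<Sum>j. ennreal (?c j) * indicator (B j) w) \<partial>lborel)"
      by (rule nn_integral_suminf[symmetric]) measurable
    also have "\<dots> \<le> (\<integral>\<^sup>+w. ?D w * (g w * indicator P w) \<partial>lborel)"
    proof (rule nn_integral_mono)
      fix w
      show "(\<Sum>j. ennreal (?c j) * indicator (B j) w) \<le> ?D w * (g w * indicator P w)"
      proof (cases "\<exists>j. w \<in> B j")
        case True
        then obtain j where w: "w \<in> B j" ..
        note D = B_D[OF w]
        have D1: "Delta' w > 0" using D(2) T by simp
        have zero: "ennreal (?c i) * indicator (B i) w = 0" if "i \<notin> {j}" for i
        proof -
          have "i = j" if wi: "w \<in> B i" using B_D(1)[OF w] B_D(1)[OF wi] by linarith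
          then have wi: "w \<notin> B i" using that by blast
          show ?thesis unfolding indicator_simps(2)[OF wi] by (rule mult_zero_right)
        qed
        have "(\<Sum>j. ennreal (?c j) * indicator (B j) w) = (\<Sum>i\<in>{j}. ennreal (?c i) * indicator (B i) w)"
          by (rule suminf_finite[OF _ zero]) simp
        also have "\<dots> = ennreal (?c j)" using w by simp
        also have "\<dots> \<le> ennreal (1 / Delta' w ^ ?N * (?G w))"
        proof (rule ennreal_leI)
          have "\<alpha> powr ?r * inverse (M * real (Suc j)) \<le> \<alpha> powr ?r * inverse (Delta' w)"
          proof (intro mult_left_mono le_imp_inverse_le)
            show "Delta' w \<le> M * real (Suc j)" using D(4) by (simp only: of_nat_Suc add.commute)
          qed (use D1 in auto)
          also have "\<dots> = 1 / Delta' w ^ ?N * (?G w)"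
            using D1 by (simp add: field_simps)
          finally show "?c j \<le> 1 / Delta' w ^ ?N * (?G w)"
            by (simp add: divide_inverse mult_ac)
        qed
        also have "\<dots> = ?D w * (g w * indicator P w)"
          using D(5) P_subset D1 unfolding g_eq[OF w] by (subst ennreal_mult) (auto simp: indicator_def)
        finally show ?thesis .
      next
        case False
        then have "indicator (B j) w = (0 :: ennreal)" for j by (simp add: indicator_def)
        then show ?thesis by (simp only: mult_zero_right suminf_zero zero_le)
      qed
    qed
    also have "\<dots> = (\<integral>\<^sup>+w. g w * indicator P w \<partial>H_measure)"
      unfolding H_measure_def by (rule nn_integral_density[symmetric]) measurable
    also have "\<dots> = (\<integral>\<^sup>+w. g w \<partial>restrict_space H_measure P)"
      by (rule nn_integral_restrict_space[symmetric]) simp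
    also have "\<dots> \<le> (\<integral>\<^sup>+w. ennreal (norm (h w) powr ?r) \<partial>restrict_space H_measure P)"
      by (rule nn_integral_mono) (rule g_le)
    also have "\<dots> < \<infinity>" using Lp False by (simp add: in_Lp_def)
    finally have "(\<Sum>j. ennreal (?c j)) * vol < \<infinity>" .
    then have "(\<Sum>j. ennreal (?c j)) \<noteq> top_class.top" using vol0 by (auto simp: ennreal_mult_less_top)
    then have "summable ?c" using M by (intro summable_suminf_not_top) auto
    moreover have "\<alpha> powr ?r / M \<noteq> 0" using \<alpha> M by simp
    ultimately have "summable (\<lambda>j. inverse (real (Suc j)))" by (simp only: summable_cmult_iff simp_thms)
    then have "summable (\<lambda>j. inverse (real j))" by (subst (asm) summable_Suc_iff)
    then show False using not_summable_harmonic by blast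
  qed
qed

end

end

section \<open>Unitary matrices and Grassmann products\<close>

lemma mat_adjoint_carrier: "E \<in> carrier_mat r r \<Longrightarrow> mat_adjoint E \<in> carrier_mat r r"
  by (auto simp: mat_adjoint_def mat_of_rows_def)

lemma mat_adjoint_index:
  assumes "(E :: complex mat) \<in> carrier_mat r r" "i < r" "j < r"
  shows "mat_adjoint E $$ (i, j) = cnj (E $$ (j, i))"
  using assms by (simp add: mat_adjoint_def mat_of_rows_def)

lemma mat_adjoint_mult:
  assumes E: "(E :: complex mat) \<in> carrier_mat r r" and F: "F \<in> carrier_mat r r"
  shows "mat_adjoint (E * F) = mat_adjoint F * mat_adjoint E"
proof (rule eq_matI)
  note EF = mult_carrier_mat[OF E F]
  note a = mat_adjoint_carrier[OF E] mat_adjoint_carrier[OF F] mat_adjoint_carrier[OF EF]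
  show "dim_row (mat_adjoint (E * F)) = dim_row (mat_adjoint F * mat_adjoint E)"
    "dim_col (mat_adjoint (E * F)) = dim_col (mat_adjoint F * mat_adjoint E)" using a by auto
  fix i j assume "i < dim_row (mat_adjoint F * mat_adjoint E)" "j < dim_col (mat_adjoint F * mat_adjoint E)"
  then have ij: "i < r" "j < r" using a by auto
  have "mat_adjoint (E * F) $$ (i, j) = cnj (\<Sum>k = 0..<r. E $$ (j, k) * F $$ (k, i))"
    using ij E F by (simp add: mat_adjoint_index[OF EF ij] scalar_prod_def)
  also have "\<dots> = (\<Sum>k = 0..<r. mat_adjoint F $$ (i, k) * mat_adjoint E $$ (k, j))"
    using ij by (simp add: cnj_sum mat_adjoint_index[OF E] mat_adjoint_index[OF F] mult.commute)
  also have "\<dots> = (mat_adjoint F * mat_adjoint E) $$ (i, j)"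
    using ij a by (simp add: scalar_prod_def)
  finally show "mat_adjoint (E * F) $$ (i, j) = (mat_adjoint F * mat_adjoint E) $$ (i, j)" .
qed

lemma mat_adjoint_one: "mat_adjoint (1\<^sub>m r :: complex mat) = 1\<^sub>m r"
  by (rule eq_matI) (auto simp: mat_adjoint_index[OF one_carrier_mat] mat_adjoint_def mat_of_rows_def)

lemma mat_adjoint_adjoint:
  assumes "(E :: complex mat) \<in> carrier_mat r r"
  shows "mat_adjoint (mat_adjoint E) = E"
  using assms mat_adjoint_carrier[OF assms] mat_adjoint_carrier[OF mat_adjoint_carrier[OF assms]]
  by (intro eq_matI) (auto simp: mat_adjoint_index[OF mat_adjoint_carrier[OF assms]] mat_adjoint_index[OF assms])

lemma Umat_carrier: "E \<in> Umat r \<Longrightarrow> E \<in> carrier_mat r r"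
  by (simp add: Umat_def)

lemma Umat_one: "1\<^sub>m r \<in> Umat r"
  by (simp add: Umat_def mat_adjoint_one)

lemma Umat_mult:
  assumes "E \<in> Umat r" "F \<in> Umat r"
  shows "E * F \<in> Umat r"
proof -
  have c: "E \<in> carrier_mat r r" "F \<in> carrier_mat r r" using assms by (auto simp: Umat_def)
  note a = mat_adjoint_carrier[OF c(1)] mat_adjoint_carrier[OF c(2)]
  have "mat_adjoint (E * F) * (E * F) = mat_adjoint F * (mat_adjoint E * (E * F))"
    unfolding mat_adjoint_mult[OF c] using c a by (intro assoc_mult_mat) auto
  also have "mat_adjoint E * (E * F) = (mat_adjoint E * E) * F"
    using c a by (intro assoc_mult_mat[symmetric]) auto
  also have "mat_adjoint F * \<dots> = 1\<^sub>m r" using assms c by (simp add: Umat_def)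
  finally show ?thesis using c by (auto simp: Umat_def)
qed

lemma Umat_adjoint:
  assumes "E \<in> Umat r"
  shows "mat_adjoint E \<in> Umat r" "mat_adjoint E * E = 1\<^sub>m r" "E * mat_adjoint E = 1\<^sub>m r"
proof -
  have c: "E \<in> carrier_mat r r" using assms by (simp add: Umat_def)
  show 1: "mat_adjoint E * E = 1\<^sub>m r" using assms by (simp add: Umat_def)
  show 2: "E * mat_adjoint E = 1\<^sub>m r"
    by (rule mat_mult_left_right_inverse[OF mat_adjoint_carrier[OF c] c 1])
  then show "mat_adjoint E \<in> Umat r"
    using mat_adjoint_carrier[OF c] by (simp add: Umat_def mat_adjoint_adjoint[OF c])
qed

lemma Umat_norm_le:
  assumes E: "E \<in> Umat r" and ij: "i < r" "j < r"
  shows "norm (E $$ (i, j)) \<le> 1"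
proof -
  have c: "E \<in> carrier_mat r r" using E by (simp add: Umat_def)
  have "(mat_adjoint E * E) $$ (j, j) = 1" using E ij by (simp add: Umat_def)
  moreover have "(mat_adjoint E * E) $$ (j, j) = (\<Sum>k = 0..<r. cnj (E $$ (k, j)) * E $$ (k, j))"
    using c mat_adjoint_carrier[OF c] ij by (simp add: scalar_prod_def mat_adjoint_index[OF c])
  also have "\<dots> = of_real (\<Sum>k = 0..<r. (norm (E $$ (k, j)))\<^sup>2)"
    by (simp add: complex_norm_square mult.commute del: of_real_power)
  ultimately have "(\<Sum>k = 0..<r. (norm (E $$ (k, j)))\<^sup>2) = 1"
    by (metis of_real_eq_1_iff)
  moreover have "(norm (E $$ (i, j)))\<^sup>2 \<le> (\<Sum>k = 0..<r. (norm (E $$ (k, j)))\<^sup>2)"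
    using ij by (intro member_le_sum) auto
  ultimately show ?thesis using power2_le_imp_le[of "norm (E $$ (i, j))" 1] by simp
qed

section \<open>Products in the Grassmann algebra\<close>

lemma gr_mult_gen:
  assumes "finite S" "\<And>s. s \<in> S \<Longrightarrow> x < s"
  shows "gr_mult (gr_gen x) (\<lambda>J. if J = S then 1 else 0) = (\<lambda>K. if K = insert x S then 1 else 0)"
proof
  fix K
  let ?t = "\<lambda>I. (-1) ^ card {(i, j). i \<in> I \<and> j \<in> K - I \<and> j < i} * gr_gen x I * (if K - I = S then 1 else 0 :: complex)"
  have xS: "x \<notin> S" using assms(2) by blast
  show "gr_mult (gr_gen x) (\<lambda>J. if J = S then 1 else 0) K = (if K = insert x S then 1 else 0)"
  proof (cases "K = insert x S")
    case True
    have "?t I = (if I = {x} then 1 else 0)" if "I \<in> Pow K" for I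
    proof (cases "I = {x}")
      case True2: True
      \<comment> \<open>Since x precedes every element of S there is no inversion to count, so the
        sign is +1.\<close>
      have empty: "{(i, j). i \<in> I \<and> j \<in> S \<and> j < i} = {}" using assms(2) True2 by fastforce
      have KI: "K - I = S" using True True2 xS by auto
      show ?thesis unfolding KI empty using True2 by (simp add: gr_gen_def)
    qed (simp add: gr_gen_def)
    then have "(\<Sum>I\<in>Pow K. ?t I) = (\<Sum>I\<in>Pow K. if I = {x} then 1 else 0)" by (rule sum.cong[OF refl])
    also have "\<dots> = 1" using True assms(1) by (subst sum.delta) auto
    finally show ?thesis using True by (simp add: gr_mult_def)
  next
    case False
    have "?t I = 0" if "I \<in> Pow K" for I
      using False that by (auto simp: gr_gen_def)
    then have "(\<Sum>I\<in>Pow K. ?t I) = 0" by (intro sum.neutral ballI)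
    then show ?thesis using False by (simp only: gr_mult_def if_False)
  qed
qed

lemma foldr_gr_gen:
  "sorted_wrt (<) xs \<Longrightarrow> foldr gr_mult (map gr_gen xs) gr_one = (\<lambda>J. if J = set xs then 1 else 0)"
proof (induction xs)
  case Nil
  show ?case by (simp add: gr_one_def)
next
  case (Cons x xs)
  then show ?case by (simp add: gr_mult_gen)
qed

text \<open>This identifies the ordered monomial of index I with a basis vector, so a sum against
  \<open>gr_pow gr_gen I J\<close> merely reads off the component J.\<close>

lemma gr_pow_gen: "finite I \<Longrightarrow> gr_pow gr_gen I J = (if J = I then 1 else 0)"
  unfolding gr_pow_def by (subst foldr_gr_gen) auto

lemma gr_pow_cong: "finite I \<Longrightarrow> (\<And>i. i \<in> I \<Longrightarrow> v i = v' i) \<Longrightarrow> gr_pow v I = gr_pow v' I"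
  unfolding gr_pow_def by (subst map_cong[of _ "sorted_list_of_set I" v v']) auto

lemma mat_gr_one: "i < r \<Longrightarrow> mat_gr r (1\<^sub>m r) i = gr_gen i"
proof
  fix J assume "i < r"
  have "mat_gr r (1\<^sub>m r) i J = (\<Sum>j<r. if j = i then gr_gen j J else 0)"
    unfolding mat_gr_def using \<open>i < r\<close> by (intro sum.cong) auto
  also have "\<dots> = gr_gen i J" using \<open>i < r\<close> by (subst sum.delta) auto
  finally show "mat_gr r (1\<^sub>m r) i J = gr_gen i J" .
qed

lemma mat_gr_diag: "i < r \<Longrightarrow> mat_gr r (mat_diag r e) i = (\<lambda>J. e i * gr_gen i J)"
proof
  fix J assume "i < r"
  have "mat_gr r (mat_diag r e) i J = (\<Sum>j<r. if j = i then e j * gr_gen j J else 0)"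
    unfolding mat_gr_def using \<open>i < r\<close> by (intro sum.cong) (auto simp: mat_diag_def)
  also have "\<dots> = e i * gr_gen i J" using \<open>i < r\<close> by (subst sum.delta) auto
  finally show "mat_gr r (mat_diag r e) i J = e i * gr_gen i J" .
qed

lemma gr_mult_scale: "gr_mult (\<lambda>J. a * F J) (\<lambda>J. b * G J) = (\<lambda>J. a * b * gr_mult F G J)"
  unfolding gr_mult_def by (auto simp: sum_distrib_left mult_ac intro!: sum.cong)

lemma gr_pow_diag:
  assumes "I \<subseteq> {..<r}"
  shows "gr_pow (mat_gr r (mat_diag r e)) I J = (\<Prod>i\<in>I. e i) * gr_pow gr_gen I J"
proof -
  have fin: "finite I" using assms finite_subset by blast
  have "set xs \<subseteq> {..<r} \<Longrightarrow> foldr gr_mult (map (mat_gr r (mat_diag r e)) xs) gr_one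
     = (\<lambda>J. prod_list (map e xs) * foldr gr_mult (map gr_gen xs) gr_one J)" for xs
    by (induction xs) (auto simp: mat_gr_diag gr_mult_scale)
  from fun_cong[OF this[of "sorted_list_of_set I"]] show ?thesis
    unfolding gr_pow_def
    using assms fin prod.distinct_set_conv_list[of "sorted_list_of_set I" e] by simp
qed

lemma mat_gr_support:
  assumes "mat_gr r E i J \<noteq> 0"
  shows "\<exists>j<r. J = {j}"
proof -
  obtain j where "j \<in> {..<r}" "E $$ (i, j) * gr_gen j J \<noteq> 0"
    using assms unfolding mat_gr_def by (rule sum.not_neutral_contains_not_neutral)
  then show ?thesis by (auto simp: gr_gen_def split: if_splits)
qed

lemma norm_mat_gr_le:
  assumes "E \<in> Umat r" "i < r"
  shows "norm (mat_gr r E i J) \<le> 1"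
proof (cases "mat_gr r E i J = 0")
  case False
  then obtain j where j: "j < r" "J = {j}" using mat_gr_support by blast
  have "mat_gr r E i J = (\<Sum>j'<r. if j' = j then E $$ (i, j') else 0)"
    unfolding mat_gr_def j by (intro sum.cong) (auto simp: gr_gen_def)
  also have "\<dots> = E $$ (i, j)" using j by (subst sum.delta) auto
  finally show ?thesis using Umat_norm_le[OF assms j(1)] by simp
qed simp

text \<open>For increasing \<open>xs\<close> the coefficients are minors of E. Support and size
  share one induction, as the size bound uses the support: a nonzero coefficient has J inside {0,
  ..., r - 1}, so each product has at most 2^r summands. The bound is the same for all of U(r), and
  equality of degrees will later match the weights k + |I| and k + |J|.\<close>

lemma foldr_mat_gr:
  fixes r :: nat
  shows "(foldr gr_mult (map (mat_gr r E) xs) gr_one J \<noteq> 0 \<longrightarrow> J \<subseteq> {..<r} \<and> card J = length xs)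
     \<and> (E \<in> Umat r \<and> set xs \<subseteq> {..<r} \<longrightarrow> norm (foldr gr_mult (map (mat_gr r E) xs) gr_one J) \<le> (2 ^ r) ^ length xs)"
proof (induction xs arbitrary: J)
  case Nil
  show ?case by (simp add: gr_one_def)
next
  case (Cons x xs)
  let ?F = "foldr gr_mult (map (mat_gr r E) xs) gr_one"
  let ?t = "\<lambda>I. (-1) ^ card {(i, j). i \<in> I \<and> j \<in> J - I \<and> j < i} * mat_gr r E x I * ?F (J - I)"
  have F: "foldr gr_mult (map (mat_gr r E) (x # xs)) gr_one J = (\<Sum>I\<in>Pow J. ?t I)"
    by (simp add: gr_mult_def)
  have supp: "J \<subseteq> {..<r} \<and> card J = length (x # xs)" if nz: "(\<Sum>I\<in>Pow J. ?t I) \<noteq> 0"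
  proof -
    obtain I where I: "I \<in> Pow J" "?t I \<noteq> 0" using nz by (rule sum.not_neutral_contains_not_neutral)
    then have "mat_gr r E x I \<noteq> 0" "?F (J - I) \<noteq> 0" by auto
    then obtain j where j: "j < r" "I = {j}" "J - I \<subseteq> {..<r}" "card (J - I) = length xs"
      using mat_gr_support Cons.IH by blast
    have "J = insert j (J - {j})" using I(1) j by auto
    moreover have "finite (J - {j})" using j finite_subset by blast
    ultimately have "card J = Suc (card (J - {j}))" by (metis card_insert_disjoint Diff_iff singletonI)
    moreover have "J \<subseteq> {..<r}" using j I(1) by auto
    ultimately show ?thesis using j by simp
  qed
  moreover have "norm (\<Sum>I\<in>Pow J. ?t I) \<le> (2 ^ r) ^ length (x # xs)" if E: "E \<in> Umat r" "set (x # xs) \<subseteq> {..<r}"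
  proof (cases "(\<Sum>I\<in>Pow J. ?t I) = 0")
    case False
    then have J: "J \<subseteq> {..<r}" using supp by blast
    have fin: "finite J" using J finite_subset by blast
    have "norm (\<Sum>I\<in>Pow J. ?t I) \<le> (\<Sum>I\<in>Pow J. (2 ^ r) ^ length xs)"
    proof (rule sum_norm_le)
      fix I
      have "norm (?t I) = norm (mat_gr r E x I) * norm (?F (J - I))" by (simp add: norm_mult norm_power)
      also have "\<dots> \<le> 1 * (2 ^ r) ^ length xs"
        by (intro mult_mono norm_mat_gr_le) (use E Cons.IH[of "J - I"] in auto)
      finally show "norm (?t I) \<le> (2 ^ r) ^ length xs" by simp
    qed
    also have "\<dots> = 2 ^ card J * (2 ^ r) ^ length xs" using fin by (simp add: card_Pow)
    also have "\<dots> \<le> 2 ^ r * (2 ^ r) ^ length xs"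
      using card_mono[OF _ J] by (intro mult_right_mono power_increasing) auto
    finally show ?thesis by simp
  qed simp
  ultimately show ?case unfolding F by blast
qed

lemma gr_pow_mat_gr_nonzero:
  assumes "gr_pow (mat_gr r E) I J \<noteq> 0" "finite I"
  shows "card J = card I"
  using assms foldr_mat_gr[of r E "sorted_list_of_set I" J] unfolding gr_pow_def by simp

lemma norm_gr_pow_le:
  assumes "E \<in> Umat r" "I \<subseteq> {..<r}"
  shows "norm (gr_pow (mat_gr r E) I J) \<le> (2 ^ r) ^ r"
proof -
  have fin: "finite I" and card: "card I \<le> r" using assms(2) finite_subset card_mono[of "{..<r}" I] by auto
  have "norm (gr_pow (mat_gr r E) I J) \<le> (2 ^ r) ^ card I"
    using foldr_mat_gr[of r E "sorted_list_of_set I" J] assms fin unfolding gr_pow_def by simp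
  also have "\<dots> \<le> (2 ^ r) ^ r" using card by (intro power_increasing) auto
  finally show ?thesis .
qed

section \<open>The group and its action\<close>

lemma matrix_mul_rid': "(A :: complex ^ 'n ^ 'm) ** cmat 1 = A"
  by (simp add: matrix_matrix_mult_def Finite_Cartesian_Product.mat_def cart_eq_iff if_distrib sum.delta cong: if_cong)

lemma cadj_mult: "cadj (A ** B) = cadj B ** cadj (A :: complex ^ 'n ^ 'm)"
  by (simp add: cadj_def matrix_matrix_mult_def cart_eq_iff cnj_sum mult.commute)

lemma cadj_one: "cadj (cmat 1) = cmat 1"
  by (simp add: cadj_def Finite_Cartesian_Product.mat_def cart_eq_iff)

lemma herm_form_sq: "herm_form ** herm_form = (cmat 1 :: 'm::finite mat1)"
proof -
  have "(\<Sum>k\<in>UNIV. (herm_form :: 'm mat1) $ i $ k * herm_form $ k $ j) = (if i = j then 1 else 0)" for i j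
  proof -
    have "(\<Sum>k\<in>UNIV. (herm_form :: 'm mat1) $ i $ k * herm_form $ k $ j)
      = (\<Sum>k\<in>UNIV. if k = i then (if i = j then 1 else 0) else 0)"
      by (intro sum.cong) (auto simp: herm_form_def)
    then show ?thesis by simp
  qed
  then show ?thesis
    by (simp add: matrix_matrix_mult_def Finite_Cartesian_Product.mat_def cart_eq_iff)
qed

lemma Un1_one: "cmat 1 \<in> Un1"
  by (simp add: Un1_def cadj_one matrix_mul_rid')

lemma Un1_mult:
  assumes "g \<in> Un1" "h \<in> Un1"
  shows "g ** h \<in> Un1"
proof -
  have "cadj (g ** h) ** herm_form ** (g ** h) = cadj h ** (cadj g ** herm_form ** g) ** h"
    by (simp only: cadj_mult matrix_mul_assoc)
  then show ?thesis using assms by (simp add: Un1_def)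
qed

lemma Un1_inverse:
  assumes "g \<in> Un1"
  shows "\<exists>h\<in>Un1. h ** g = cmat 1 \<and> g ** h = cmat 1"
proof -
  have g: "cadj g ** herm_form ** g = herm_form" using assms by (simp add: Un1_def)
  \<comment> \<open>The adjoint with respect to the Hermitian form, which is the inverse because the
    form matrix squares to 1.\<close>
  define h where "h = herm_form ** cadj g ** herm_form"
  have "h ** g = herm_form ** (cadj g ** herm_form ** g)" unfolding h_def by (simp only: matrix_mul_assoc)
  then have hg: "h ** g = cmat 1" by (simp only: g herm_form_sq)
  then have gh: "g ** h = cmat 1" using matrix_left_right_inverse by blast
  have "cadj h ** herm_form ** h = cadj h ** (cadj g ** herm_form ** g) ** h" by (simp only: g)
  also have "\<dots> = cadj (g ** h) ** herm_form ** (g ** h)" by (simp only: cadj_mult matrix_mul_assoc)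
  also have "\<dots> = herm_form" by (simp only: gh cadj_one matrix_mul_lid matrix_mul_rid')
  finally have "h \<in> Un1" by (simp add: Un1_def)
  with hg gh show ?thesis by blast
qed

lemma sSU_simps:
  "carrier (sSU r) = {(g, E). g \<in> Un1 \<and> E \<in> Umat r \<and> Determinants.det g = Determinant.det E}"
  "x \<otimes>\<^bsub>sSU r\<^esub> y = (fst x ** fst y, snd x * snd y)"
  "\<one>\<^bsub>sSU r\<^esub> = (cmat 1, 1\<^sub>m r)"
  by (simp_all add: sSU_def case_prod_unfold)

lemma group_sSU: "group (sSU r :: ('m::finite gel) monoid)"
proof (rule groupI)
  fix x y z :: "'m gel"
  assume x: "x \<in> carrier (sSU r)" and y: "y \<in> carrier (sSU r)"
  have c: "snd x \<in> carrier_mat r r" "snd y \<in> carrier_mat r r" using x y by (auto simp: sSU_simps Umat_carrier)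
  show "x \<otimes>\<^bsub>sSU r\<^esub> y \<in> carrier (sSU r)"
    using x y by (auto simp: sSU_simps Un1_mult Umat_mult Determinants.det_mul det_mult[OF Umat_carrier Umat_carrier])
  show "x \<otimes>\<^bsub>sSU r\<^esub> y \<otimes>\<^bsub>sSU r\<^esub> z = x \<otimes>\<^bsub>sSU r\<^esub> (y \<otimes>\<^bsub>sSU r\<^esub> z)" if "z \<in> carrier (sSU r)"
  proof -
    have "snd z \<in> carrier_mat r r" using that by (auto simp: sSU_simps Umat_carrier)
    then show ?thesis using assoc_mult_mat[OF c] by (simp add: sSU_simps matrix_mul_assoc)
  qed
next
  show "\<one>\<^bsub>sSU r\<^esub> \<in> carrier (sSU r :: ('m gel) monoid)" by (simp add: sSU_simps Un1_one Umat_one)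
next
  fix x :: "'m gel" assume x: "x \<in> carrier (sSU r)"
  then have c: "snd x \<in> carrier_mat r r" by (auto simp: sSU_simps Umat_carrier)
  show "\<one>\<^bsub>sSU r\<^esub> \<otimes>\<^bsub>sSU r\<^esub> x = x" using c by (simp add: sSU_simps)
  obtain h where h: "h \<in> Un1" "h ** fst x = cmat 1"
    using Un1_inverse[of "fst x"] x by (auto simp: sSU_simps)
  have E: "snd x \<in> Umat r" using x by (auto simp: sSU_simps)
  have "Determinants.det h * Determinants.det (fst x) = 1"
    using arg_cong[OF h(2), of Determinants.det] by (simp add: Determinants.det_mul Determinants.det_I)
  moreover have "Determinant.det (mat_adjoint (snd x)) * Determinant.det (snd x) = 1"
    using arg_cong[OF Umat_adjoint(2)[OF E], of Determinant.det]
    by (simp add: det_mult[OF mat_adjoint_carrier[OF c] c])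
  moreover have "Determinants.det (fst x) = Determinant.det (snd x)" using x by (auto simp: sSU_simps)
  ultimately have "Determinants.det h = Determinant.det (mat_adjoint (snd x))"
    by (metis mult_cancel_right mult_zero_right zero_neq_one)
  then have "(h, mat_adjoint (snd x)) \<in> carrier (sSU r)" using h Umat_adjoint[OF E] by (simp add: sSU_simps)
  moreover have "(h, mat_adjoint (snd x)) \<otimes>\<^bsub>sSU r\<^esub> x = \<one>\<^bsub>sSU r\<^esub>"
    using h Umat_adjoint[OF E] by (simp add: sSU_simps)
  ultimately show "\<exists>y\<in>carrier (sSU r). y \<otimes>\<^bsub>sSU r\<^esub> x = \<one>\<^bsub>sSU r\<^esub>" by blast
qed

lemma Gprime_subset: "Gprime r \<subseteq> carrier (sSU r)"
  by (auto simp: Gprime_def emb_def sSU_simps Umat_one)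

section \<open>Homogeneous coordinates and the matrices R, a_t, n\<close>

lemma sum_UNIV_option: "(\<Sum>i\<in>UNIV. f i) = f None + (\<Sum>i\<in>UNIV. f (Some i))" for f :: "'a::finite option \<Rightarrow> 'b::comm_monoid_add"
  by (simp add: UNIV_option_conv sum.reindex)

lemma blk3_mult_vec:
  fixes v :: "complex ^ ('m::finite option option)"
  shows "(blk3 a11 a12 a13 a21 a22 a23 a31 a32 a33 *v v) $ Some None
      = a11 * v $ Some None + (\<Sum>q\<in>UNIV. a12 $ q * v $ Some (Some q)) + a13 * v $ None" (is ?A)
    and "(blk3 a11 a12 a13 a21 a22 a23 a31 a32 a33 *v v) $ Some (Some p)
      = a21 $ p * v $ Some None + (\<Sum>q\<in>UNIV. a22 $ p $ q * v $ Some (Some q)) + a23 $ p * v $ None" (is ?B)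
    and "(blk3 a11 a12 a13 a21 a22 a23 a31 a32 a33 *v v) $ None
      = a31 * v $ Some None + (\<Sum>q\<in>UNIV. a32 $ q * v $ Some (Some q)) + a33 * v $ None" (is ?C)
  by (simp_all add: matrix_vector_mult_def blk3_def sum_UNIV_option)

text \<open>A homogeneous vector with arbitrary last entry. Keeping the scale postpones all
  divisions until a point of the domain has to be read off.\<close>

definition hpt :: "complex \<Rightarrow> complex ^ 'm \<Rightarrow> complex \<Rightarrow> complex ^ ('m::finite option option)" where
  "hpt a b c = (\<chi> i. case i of Some None \<Rightarrow> a | Some (Some p) \<Rightarrow> b $ p | None \<Rightarrow> c)"

lemma hpt_simps [simp]: "hpt a b c $ Some None = a" "hpt a b c $ Some (Some p) = b $ p" "hpt a b c $ None = c"
  by (simp_all add: hpt_def)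

lemma hcoord_hpt: "hcoord z = hpt (fst z) (snd z) 1"
  by (simp add: hcoord_def hpt_def)

lemma vec_option_eqI:
  fixes u v :: "complex ^ ('m::finite option option)"
  assumes "u $ Some None = v $ Some None" "\<And>p. u $ Some (Some p) = v $ Some (Some p)" "u $ None = v $ None"
  shows "u = v"
  unfolding cart_eq_iff
proof
  fix i show "u $ i = v $ i" using assms by (cases i) (auto split: option.splits, metis option.exhaust)
qed

lemma sum_mat_one_mult: "(\<Sum>q\<in>UNIV. (cmat 1 :: complex ^ 'm::finite ^ 'm) $ p $ q * w q) = w p"
  by (simp add: Finite_Cartesian_Product.mat_def if_distrib[of "\<lambda>x. x * _"] sum.delta cong: if_cong)

text \<open>An explicit matrix to compute with; \<open>matrix_inv R_mat\<close> is defined by choice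
  and is identified with it in \<open>matrix_inv_R\<close>.\<close>

definition R_inv :: "'m::finite mat1" where
  "R_inv = blk3 (of_real (1 / sqrt 2)) 0 (of_real (- 1 / sqrt 2))
                0 (cmat 1) 0
                (of_real (1 / sqrt 2)) 0 (of_real (1 / sqrt 2))"

lemma R_mat_hpt: "R_mat *v hpt a b c = hpt ((a + c) / of_real (sqrt 2)) b ((c - a) / of_real (sqrt 2))"
  unfolding R_mat_def by (rule vec_option_eqI) (simp_all add: blk3_mult_vec sum_mat_one_mult add_divide_distrib diff_divide_distrib)

lemma R_inv_hpt: "R_inv *v hpt a b c = hpt ((a - c) / of_real (sqrt 2)) b ((a + c) / of_real (sqrt 2))"
  unfolding R_inv_def by (rule vec_option_eqI) (simp_all add: blk3_mult_vec sum_mat_one_mult add_divide_distrib diff_divide_distrib)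

lemma a_mat_hpt: "a_mat t *v hpt a b c
    = hpt (of_real (cosh t) * a + of_real (sinh t) * c) b (of_real (sinh t) * a + of_real (cosh t) * c)"
  unfolding a_mat_def by (rule vec_option_eqI) (simp_all add: blk3_mult_vec sum_mat_one_mult)

text \<open>The Heisenberg group acting on H by affine maps. The last homogeneous coordinate stays
  1, so the factor of automorphy of \<open>n_mat\<close> is 1.\<close>

definition nact :: "real \<Rightarrow> complex ^ 'm \<Rightarrow> 'm pt \<Rightarrow> 'm::finite pt" where
  "nact l u w = (fst w + (\<Sum>q\<in>UNIV. cnj (u $ q) * snd w $ q) + (\<i> * of_real l + of_real ((norm u)\<^sup>2) / 2), snd w + u)"

lemma n_mat_hcoord: "n_mat l u *v hcoord w = hcoord (nact l u w)"
  unfolding n_mat_def hcoord_hpt nact_def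
  by (rule vec_option_eqI) (simp_all add: blk3_mult_vec sum_mat_one_mult)

lemma hpt_cases: obtains a b c where "v = hpt a b c"
proof
  show "v = hpt (v $ Some None) (\<chi> p. v $ Some (Some p)) (v $ None)" by (rule vec_option_eqI) simp_all
qed

lemma matrix_eq_vec: "(\<And>v. A *v v = B *v v) \<Longrightarrow> A = (B :: complex ^ 'n::finite ^ 'm::finite)"
  using matrix_eq by blast

lemma csqrt2: "complex_of_real (sqrt 2) * complex_of_real (sqrt 2) = 2"
  by (simp flip: of_real_mult)

lemma R_inv_R: "R_inv ** R_mat = (cmat 1 :: 'm::finite mat1)"
proof (rule matrix_eq_vec)
  fix v :: "complex ^ ('m option option)"
  obtain a b c where v: "v = hpt a b c" by (rule hpt_cases)
  have "((a + c) / of_real (sqrt 2) - (c - a) / of_real (sqrt 2)) / of_real (sqrt 2) = a"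
    "((a + c) / of_real (sqrt 2) + (c - a) / of_real (sqrt 2)) / of_real (sqrt 2) = c"
    by (simp_all add: diff_divide_distrib[symmetric] add_divide_distrib[symmetric] csqrt2)
  then show "(R_inv ** R_mat) *v v = cmat 1 *v v"
    unfolding v by (simp only: matrix_vector_mul_assoc[symmetric] R_mat_hpt R_inv_hpt matrix_vector_mul_lid)
qed

lemma R_R_inv: "R_mat ** R_inv = (cmat 1 :: 'm::finite mat1)"
  using R_inv_R matrix_left_right_inverse by blast

lemma matrix_inv_R: "matrix_inv R_mat = (R_inv :: 'm::finite mat1)"
proof -
  have "R_mat ** matrix_inv R_mat = (cmat 1 :: 'm mat1)"
    unfolding matrix_inv_def by (rule someI2[of _ R_inv]) (use R_R_inv R_inv_R in auto)
  then have "R_inv ** (R_mat ** matrix_inv R_mat) = (R_inv :: 'm mat1)" by (simp only: matrix_mul_rid')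
  then show ?thesis by (simp only: matrix_mul_assoc R_inv_R matrix_mul_lid)
qed

section \<open>The Hermitian form, the action and its cocycle\<close>

definition hq :: "complex ^ ('m::finite option option) \<Rightarrow> real" where
  "hq v = (norm (v $ Some None))\<^sup>2 + (\<Sum>p\<in>UNIV. (norm (v $ Some (Some p)))\<^sup>2) - (norm (v $ None))\<^sup>2"

lemma norm_vec_sq: "(norm (b :: complex ^ 'm::finite))\<^sup>2 = (\<Sum>p\<in>UNIV. (norm (b $ p))\<^sup>2)"
  by (simp add: norm_vec_def L2_set_def sum_nonneg)

lemma hq_hpt: "hq (hpt a b c) = (norm a)\<^sup>2 + (norm b)\<^sup>2 - (norm c)\<^sup>2"
  by (simp add: hq_def norm_vec_sq)

lemma hq_scale: "hq (c *s v) = (norm c)\<^sup>2 * hq v"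
  by (simp add: hq_def norm_mult power_mult_distrib sum_distrib_left algebra_simps)

lemma sum_cadj: "(\<Sum>i\<in>UNIV. cnj ((A *v u) $ i) * w $ i) = (\<Sum>j\<in>UNIV. cnj (u $ j) * (cadj A *v w) $ j)"
proof -
  have "(\<Sum>i\<in>UNIV. cnj ((A *v u) $ i) * w $ i) = (\<Sum>i\<in>UNIV. \<Sum>j\<in>UNIV. cnj (A $ i $ j) * cnj (u $ j) * w $ i)"
    by (simp add: matrix_vector_mult_def cnj_sum sum_distrib_right)
  also have "\<dots> = (\<Sum>j\<in>UNIV. \<Sum>i\<in>UNIV. cnj (A $ i $ j) * cnj (u $ j) * w $ i)" by (rule sum.swap)
  also have "\<dots> = (\<Sum>j\<in>UNIV. cnj (u $ j) * (cadj A *v w) $ j)"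
    by (simp add: matrix_vector_mult_def cadj_def sum_distrib_left mult_ac)
  finally show ?thesis .
qed

lemma herm_form_vec: "(herm_form *v v) $ i = (if i = None then - v $ i else v $ i)"
proof -
  have "(herm_form *v v) $ i = (\<Sum>j\<in>UNIV. if j = i then (if i = None then - v $ i else v $ i) else 0)"
    unfolding matrix_vector_mult_def herm_form_def vec_lambda_beta
    by (rule sum.cong[OF refl]) auto
  then show ?thesis by simp
qed

lemma sum_herm_form: "(\<Sum>i\<in>UNIV. cnj (v $ i) * (herm_form *v v) $ i) = of_real (hq v)"
  unfolding herm_form_vec hq_def sum_UNIV_option
  by (simp add: complex_norm_square mult.commute del: of_real_power)

lemma hq_Un1:
  assumes "g \<in> Un1"
  shows "hq (g *v v) = hq v"
proof -
  have "of_real (hq (g *v v)) = (\<Sum>j\<in>UNIV. cnj (v $ j) * (cadj g *v (herm_form *v (g *v v))) $ j)"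
    unfolding sum_herm_form[symmetric] by (rule sum_cadj)
  also have "cadj g *v (herm_form *v (g *v v)) = herm_form *v v"
  proof -
    have "cadj g ** herm_form ** g = herm_form" using assms by (simp add: Un1_def)
    then show ?thesis by (simp only: matrix_vector_mul_assoc matrix_mul_assoc)
  qed
  also have "(\<Sum>j\<in>UNIV. cnj (v $ j) * (herm_form *v v) $ j) = of_real (hq v)" by (rule sum_herm_form)
  finally show ?thesis by simp
qed

lemma ball_B_iff: "z \<in> ball_B \<longleftrightarrow> hq (hcoord z) < 0"
  by (simp add: ball_B_def hcoord_hpt hq_hpt)

lemma hq_neg_imp: "hq v < 0 \<Longrightarrow> v $ None \<noteq> 0"
proof
  assume "hq v < 0" "v $ None = 0"
  moreover have "0 \<le> (norm (v $ Some None))\<^sup>2 + (\<Sum>p\<in>UNIV. (norm (v $ Some (Some p)))\<^sup>2)"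
    by (intro add_nonneg_nonneg sum_nonneg) auto
  ultimately show False by (simp add: hq_def)
qed

text \<open>The right side is -Delta' w. Membership in H, membership in B and nonvanishing of
  denominators can thus all be derived from the sign of \<open>hq\<close>.\<close>

lemma hq_R_inv: "hq (R_inv *v hcoord w) = (norm (snd w))\<^sup>2 - 2 * Re (fst w)"
proof -
  have e: "(norm (a / of_real (sqrt 2)))\<^sup>2 = (norm a)\<^sup>2 / 2" for a :: complex
    by (simp add: norm_divide power_divide)
  have "(norm (a - 1))\<^sup>2 / 2 + y - (norm (a + 1))\<^sup>2 / 2 = y - 2 * Re a" for a :: complex and y
    unfolding cmod_power2 by (simp add: power2_eq_square algebra_simps add_divide_distrib diff_divide_distrib)
  then show ?thesis by (simp only: hcoord_hpt R_inv_hpt hq_hpt e)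
qed

text \<open>Image point and factor of automorphy are read off a single homogeneous identity, whose
  scalar is the denominator.\<close>

lemma act_eqI:
  assumes "g *v hcoord z = c *s hcoord p" "c \<noteq> 0"
  shows "act g z = p" "jfac g z = inverse c" "(g *v hcoord z) $ None \<noteq> 0"
  using assms by (auto simp: act_def jfac_def hcoord_hpt prod_eq_iff cart_eq_iff)

lemma hcoord_act:
  assumes "(g *v hcoord z) $ None \<noteq> 0"
  shows "g *v hcoord z = (g *v hcoord z) $ None *s hcoord (act g z)"
  by (rule vec_option_eqI) (use assms in \<open>simp_all add: act_def jfac_def hcoord_hpt\<close>)

text \<open>The cocycle identity. It suffices that the inner denominator is nonzero: if the outer
  one vanishes, both sides agree because the inverse of 0 is 0.\<close>

lemma act_mult:
  assumes nz: "(h *v hcoord z) $ None \<noteq> 0"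
  shows "act (g ** h) z = act g (act h z)" "jfac (g ** h) z = jfac g (act h z) * jfac h z"
proof -
  let ?c = "(h *v hcoord z) $ None"
  have eq: "(g ** h) *v hcoord z = ?c *s (g *v hcoord (act h z))"
    by (subst matrix_vector_mul_assoc[symmetric], subst hcoord_act[OF nz], rule vector_scalar_commute)
  show "jfac (g ** h) z = jfac g (act h z) * jfac h z"
    unfolding jfac_def eq by simp
  show "act (g ** h) z = act g (act h z)"
    unfolding act_def jfac_def eq using nz
    by (simp add: cart_eq_iff mult_ac)
qed

lemma act_ball:
  assumes "hq (g *v hcoord z) < 0"
  shows "(g *v hcoord z) $ None \<noteq> 0" "act g z \<in> ball_B"
proof -
  show nz: "(g *v hcoord z) $ None \<noteq> 0" by (rule hq_neg_imp[OF assms])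
  have "(norm ((g *v hcoord z) $ None))\<^sup>2 * hq (hcoord (act g z)) < 0"
    using assms hcoord_act[OF nz] hq_scale by metis
  then show "act g z \<in> ball_B" using nz by (simp add: ball_B_iff mult_less_0_iff)
qed

section \<open>Complex differentiability of the slashed components\<close>

definition cdiff_at :: "('m::finite pt \<Rightarrow> complex) \<Rightarrow> 'm pt \<Rightarrow> bool" where
  "cdiff_at f x \<longleftrightarrow> (\<exists>f'. (f has_derivative f') (at x) \<and> (\<forall>a v. f' (pt_smul a v) = a * f' v))"

lemma holo_on_cdiff: "holo_on pt_smul f S \<longleftrightarrow> (\<forall>x\<in>S. cdiff_at f x)"
  by (simp add: holo_on_def cdiff_at_def)

lemma cdiff_at_mult:
  assumes "cdiff_at f x" "cdiff_at g x"
  shows "cdiff_at (\<lambda>w. f w * g w) x"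
proof -
  obtain f' where f': "(f has_derivative f') (at x)" "\<And>a v. f' (pt_smul a v) = a * f' v"
    using assms(1) by (auto simp: cdiff_at_def)
  obtain g' where g': "(g has_derivative g') (at x)" "\<And>a v. g' (pt_smul a v) = a * g' v"
    using assms(2) by (auto simp: cdiff_at_def)
  show ?thesis unfolding cdiff_at_def
    by (intro exI[of _ "\<lambda>h. f x * g' h + f' h * g x"] conjI has_derivative_mult f' g')
      (simp add: f'(2) g'(2) algebra_simps)
qed

lemma cdiff_at_inverse:
  assumes "cdiff_at f x" "f x \<noteq> 0"
  shows "cdiff_at (\<lambda>w. inverse (f w)) x"
proof -
  obtain f' where f': "(f has_derivative f') (at x)" "\<And>a v. f' (pt_smul a v) = a * f' v"
    using assms(1) by (auto simp: cdiff_at_def)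
  show ?thesis unfolding cdiff_at_def
    by (intro exI[of _ "\<lambda>h. - (inverse (f x) * f' h * inverse (f x))"] conjI Deriv.has_derivative_inverse assms(2) f')
      (simp add: f'(2) algebra_simps)
qed

lemma cdiff_at_power_int:
  assumes "cdiff_at f x" "f x \<noteq> 0"
  shows "cdiff_at (\<lambda>w. f w powi n) x"
proof -
  obtain f' where f': "(f has_derivative f') (at x)" "\<And>a v. f' (pt_smul a v) = a * f' v"
    using assms(1) by (auto simp: cdiff_at_def)
  show ?thesis unfolding cdiff_at_def
    by (intro exI[of _ "\<lambda>h. f' h * (of_int n * f x powi (n - 1))"] conjI has_derivative_power_int assms(2) f')
      (simp add: f'(2) algebra_simps)
qed

lemma cdiff_at_linear: "cdiff_at (\<lambda>w. (M *v hcoord w) $ i) x"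
proof -
  define L where "L = (\<lambda>v. M $ i $ Some None * fst v + (\<Sum>p\<in>UNIV. M $ i $ Some (Some p) * snd v $ p))"
  have eq: "(\<lambda>w. (M *v hcoord w) $ i) = (\<lambda>w. M $ i $ None + L w)"
    by (rule ext) (simp add: L_def matrix_vector_mult_def sum_UNIV_option hcoord_hpt)
  have "linear L"
    by (rule linearI) (simp_all add: L_def algebra_simps sum.distrib scaleR_sum_right)
  then have "(L has_derivative L) (at x)"
    by (simp add: linear_conv_bounded_linear bounded_linear_imp_has_derivative)
  from has_derivative_add[OF has_derivative_const this]
  have "((\<lambda>w. M $ i $ None + L w) has_derivative L) (at x)" by simp
  moreover have "L (pt_smul a v) = a * L v" for a v
    by (simp add: L_def pt_smul_def algebra_simps sum_distrib_left)
  ultimately show ?thesis unfolding cdiff_at_def eq by (intro exI[of _ L]) simp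
qed

lemma cdiff_at_jfac:
  assumes "(M *v hcoord x) $ None \<noteq> 0"
  shows "cdiff_at (jfac M) x"
  unfolding jfac_def[abs_def] by (rule cdiff_at_inverse[OF cdiff_at_linear assms])

lemma has_derivative_vec:
  fixes F :: "'a::real_normed_vector \<Rightarrow> complex ^ 'm::finite"
  assumes "\<And>p. ((\<lambda>x. F x $ p) has_derivative (\<lambda>h. F' h $ p)) (at x)"
  shows "(F has_derivative F') (at x)"
  unfolding has_derivative_componentwise_within[of F F']
proof
  fix i :: "complex ^ 'm" assume "i \<in> Basis"
  then obtain p b where i: "i = axis p b" by (auto simp: Basis_vec_def)
  have "((\<lambda>x. F x $ p \<bullet> b) has_derivative (\<lambda>h. F' h $ p \<bullet> b)) (at x)"
    by (rule has_derivative_inner_left[OF assms])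
  then show "((\<lambda>x. F x \<bullet> i) has_derivative (\<lambda>h. F' h \<bullet> i)) (at x)" by (simp add: i inner_axis)
qed

text \<open>Chain rule. Each coordinate of \<open>act M\<close> is an affine function times the
  factor of automorphy, hence complex differentiable; the derivative assembled from the components
  commutes with \<open>pt_smul\<close> because each of them is complex linear.\<close>

lemma cdiff_at_act:
  assumes F: "cdiff_at F (act M x)" and nz: "(M *v hcoord x) $ None \<noteq> 0"
  shows "cdiff_at (\<lambda>w. F (act M w)) x"
proof -
  obtain F' where F': "(F has_derivative F') (at (act M x))" "\<And>a v. F' (pt_smul a v) = a * F' v"
    using F by (auto simp: cdiff_at_def)
  have comp: "\<forall>i. \<exists>d. ((\<lambda>w. (M *v hcoord w) $ i * jfac M w) has_derivative d) (at x) \<and> (\<forall>a v. d (pt_smul a v) = a * d v)"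
    using cdiff_at_mult[OF cdiff_at_linear cdiff_at_jfac[OF nz]] unfolding cdiff_at_def by blast
  obtain d where d0: "\<forall>i. ((\<lambda>w. (M *v hcoord w) $ i * jfac M w) has_derivative d i) (at x) \<and> (\<forall>a v. d i (pt_smul a v) = a * d i v)"
    using choice[OF comp] ..
  note d = d0[rule_format, THEN conjunct1] d0[rule_format, THEN conjunct2, rule_format]
  let ?A = "\<lambda>h. (d (Some None) h, \<chi> p. d (Some (Some p)) h)"
  have "((\<lambda>w. \<chi> p. (M *v hcoord w) $ Some (Some p) * jfac M w) has_derivative (\<lambda>h. \<chi> p. d (Some (Some p)) h)) (at x)"
    by (rule has_derivative_vec) (simp add: d)
  from has_derivative_Pair[OF d(1) this]
  have "((\<lambda>w. act M w) has_derivative ?A) (at x)" unfolding act_def .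
  from has_derivative_compose[OF this F'(1)]
  have "((\<lambda>w. F (act M w)) has_derivative (\<lambda>h. F' (?A h))) (at x)" .
  moreover have "F' (?A (pt_smul a v)) = a * F' (?A v)" for a v
  proof -
    have "?A (pt_smul a v) = pt_smul a (?A v)"
    proof -
      have "(\<chi> p. a * d (Some (Some p)) v) = a *s (\<chi> p. d (Some (Some p)) v)"
        by (simp add: cart_eq_iff)
      then show ?thesis by (simp only: d(2) pt_smul_def[of a "?A v"] fst_conv snd_conv)
    qed
    then show ?thesis by (simp only: F'(2))
  qed
  ultimately show ?thesis unfolding cdiff_at_def by (intro exI[of _ "\<lambda>h. F' (?A h)"] conjI allI)
qed

lemma cdiff_at_slash:
  assumes "holo_on pt_smul F ball_B" "hq (M *v hcoord x) < 0"
  shows "cdiff_at (\<lambda>w. F (act M w) * jfac M w powi n) x"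
proof -
  note ab = act_ball[OF assms(2)]
  have "jfac M x \<noteq> 0" using ab(1) by (simp add: jfac_def)
  then show ?thesis
    using assms(1) ab by (intro cdiff_at_mult cdiff_at_act cdiff_at_power_int cdiff_at_jfac) (auto simp: holo_on_cdiff)
qed

section \<open>Coordinates of the cusp region\<close>

text \<open>Coordinates (lambda, u) on N. For the point n (h, 0) of H with h real they equal (Im
  w_1, w_2), so they also parametrize every horosphere.\<close>

definition nel :: "nat \<Rightarrow> real \<times> (complex ^ 'm) \<Rightarrow> 'm::finite gel" where
  "nel r p = emb r (R_inv ** n_mat (fst p) (snd p) ** R_mat)"

lemma N_grp_nel: "N_grp r = range (nel r)"
  by (rule Set.set_eqI) (simp add: N_grp_def nel_def matrix_inv_R image_iff split_paired_Ex)

definition cusp_coords :: "nat \<Rightarrow> ('m::finite gel) set \<Rightarrow> (real \<times> (complex ^ 'm)) set" where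
  "cusp_coords r \<eta> = nel r -` \<eta>"

lemma R_conj_nel: "R_mat ** fst (nel r p) ** R_inv = n_mat (fst p) (snd p)"
proof -
  have "R_mat ** fst (nel r p) ** R_inv = (R_mat ** R_inv) ** n_mat (fst p) (snd p) ** (R_mat ** R_inv)"
    by (simp only: nel_def emb_def fst_conv matrix_mul_assoc)
  then show ?thesis by (simp only: R_R_inv matrix_mul_lid matrix_mul_rid')
qed

lemma continuous_on_matrix_mult:
  fixes F :: "'a::topological_space \<Rightarrow> complex ^ 'n::finite ^ 'k::finite" and G :: "'a \<Rightarrow> complex ^ 'l::finite ^ 'n"
  assumes "continuous_on S F" "continuous_on S G"
  shows "continuous_on S (\<lambda>x. F x ** G x)"
  unfolding matrix_matrix_mult_def
  by (intro continuous_on_vec_lambda continuous_intros assms)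

lemma option2_cases:
  "(x = None \<Longrightarrow> P) \<Longrightarrow> (x = Some None \<Longrightarrow> P) \<Longrightarrow> (\<And>p. x = Some (Some p) \<Longrightarrow> P) \<Longrightarrow> P"
  by (metis option.exhaust)

lemma continuous_on_n_mat: "continuous_on S (\<lambda>p. n_mat (fst p) (snd p) :: 'm::finite mat1)"
  unfolding n_mat_def blk3_def
proof (intro continuous_on_vec_lambda)
  fix i j :: "'m option option"
  show "continuous_on S (\<lambda>p. case i of
       Some None \<Rightarrow> (case j of Some None \<Rightarrow> 1 | Some (Some q) \<Rightarrow> (\<chi> j. cnj (snd p $ j)) $ q
           | None \<Rightarrow> \<i> * of_real (fst p) + of_real ((norm (snd p))\<^sup>2) / 2)
     | Some (Some p') \<Rightarrow>
         (case j of Some None \<Rightarrow> 0 $ p' | Some (Some q) \<Rightarrow> cmat 1 $ p' $ q | None \<Rightarrow> snd p $ p')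
     | None \<Rightarrow> (case j of Some None \<Rightarrow> 0 | Some (Some q) \<Rightarrow> 0 $ q | None \<Rightarrow> 1))"
    by (rule option2_cases[of i]; rule option2_cases[of j]; simp; intro continuous_intros; simp)
qed

text \<open>Openness is pulled back along the continuous map \<open>nel\<close>, after the pullback
  topology on the group has been unfolded to an open set of the ambient product space.\<close>

lemma open_cusp_coords:
  fixes \<eta> :: "('m::finite gel) set"
  assumes "openin (subtopology (gel_top r) (N_grp r)) \<eta>"
  shows "open (cusp_coords r \<eta>)"
proof -
  let ?\<phi> = "\<lambda>(g, E :: complex mat). (g, \<lambda>i j. if i < r \<and> j < r then E $$ (i, j) else 0)"
  obtain O' where O': "openin (gel_top r) O'" "\<eta> = O' \<inter> N_grp r" using assms by (auto simp: openin_subtopology)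
  obtain U where U: "open U" "O' = ?\<phi> -` U \<inter> (UNIV \<times> carrier_mat r r)"
    using O'(1) unfolding gel_top_def openin_pullback_topology by auto
  have "cusp_coords r \<eta> = (\<lambda>p. ?\<phi> (nel r p)) -` U"
  proof (rule Set.set_eqI)
    fix p :: "real \<times> (complex ^ 'm)"
    have "nel r p \<in> UNIV \<times> carrier_mat r r" by (simp add: nel_def emb_def)
    then show "p \<in> cusp_coords r \<eta> \<longleftrightarrow> p \<in> (\<lambda>p. ?\<phi> (nel r p)) -` U"
      unfolding cusp_coords_def O'(2) U(2) N_grp_nel by (simp only: vimage_eq Int_iff rangeI simp_thms)
  qed
  moreover have "continuous_on UNIV (\<lambda>p. ?\<phi> (nel r p))"
    unfolding nel_def emb_def case_prod_conv
    by (intro continuous_on_Pair continuous_on_matrix_mult continuous_on_n_mat continuous_on_const)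
  then have "open ((\<lambda>p. ?\<phi> (nel r p)) -` U)" by (rule open_vimage[OF U(1)])
  ultimately show ?thesis by simp
qed

lemma n_mat_simps:
  "n_mat l u $ Some None $ None = \<i> * of_real l + of_real ((norm u)\<^sup>2) / 2"
  "n_mat l u $ Some (Some p) $ None = u $ p"
  by (simp_all add: n_mat_def blk3_def)

lemma bounded_cusp_coords:
  fixes \<eta> :: "('m::finite gel) set"
  assumes sub: "openin (subtopology (gel_top r) (N_grp r)) \<eta>"
    and comp: "compactin (subtopology (gel_top r) (N_grp r)) (subtopology (gel_top r) (N_grp r) closure_of \<eta>)"
  shows "bounded (cusp_coords r \<eta>)"
proof -
  let ?NT = "subtopology (gel_top r) (N_grp r) :: 'm gel topology"
  let ?\<phi> = "\<lambda>(g, E :: complex mat). (g, \<lambda>i j. if i < r \<and> j < r then E $$ (i, j) else 0)"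
  \<comment> \<open>A left inverse of \<open>nel\<close>: lambda and u stand in the last column of R
    X R^-1. Being continuous on all matrices, it maps the compact closure of \<eta> to a compact
    set.\<close>
  define \<Theta> where "\<Theta> = (\<lambda>X :: 'm mat1. (Im ((R_mat ** X ** R_inv) $ Some None $ None), \<chi> p. (R_mat ** X ** R_inv) $ Some (Some p) $ None))"
  have "continuous_on UNIV \<Theta>"
    unfolding \<Theta>_def
    by (intro continuous_on_Pair continuous_on_Im continuous_on_vec_lambda continuous_on_component
        continuous_on_matrix_mult continuous_on_const continuous_on_id)
  then have "continuous_on UNIV (\<lambda>x :: 'm mat1 \<times> (nat \<Rightarrow> nat \<Rightarrow> complex). \<Theta> (fst x))"
    by (rule continuous_on_compose2[OF _ continuous_on_fst[OF continuous_on_id]]) simp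
  then have "continuous_map euclidean euclidean (\<lambda>x :: 'm mat1 \<times> (nat \<Rightarrow> nat \<Rightarrow> complex). \<Theta> (fst x))"
    by simp
  from continuous_map_pullback[OF this, of "UNIV \<times> carrier_mat r r" ?\<phi>]
  have "continuous_map (gel_top r) euclidean ((\<lambda>x. \<Theta> (fst x)) \<circ> ?\<phi>)" unfolding gel_top_def .
  then have "continuous_map ?NT euclidean ((\<lambda>x. \<Theta> (fst x)) \<circ> ?\<phi>)" by (rule continuous_map_from_subtopology)
  from image_compactin[OF comp this]
  have "compact (((\<lambda>x. \<Theta> (fst x)) \<circ> ?\<phi>) ` (?NT closure_of \<eta>))" by simp
  then have "bounded (((\<lambda>x. \<Theta> (fst x)) \<circ> ?\<phi>) ` (?NT closure_of \<eta>))" by (rule compact_imp_bounded)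
  moreover have "cusp_coords r \<eta> \<subseteq> ((\<lambda>x. \<Theta> (fst x)) \<circ> ?\<phi>) ` (?NT closure_of \<eta>)"
  proof
    fix p assume "p \<in> cusp_coords r \<eta>"
    then have "nel r p \<in> \<eta>" by (simp add: cusp_coords_def)
    then have mem: "nel r p \<in> ?NT closure_of \<eta>"
      by (rule subsetD[OF closure_of_subset[OF openin_subset[OF sub]]])
    have eq: "((\<lambda>x. \<Theta> (fst x)) \<circ> ?\<phi>) (nel r p) = p"
    proof -
      have "((\<lambda>x. \<Theta> (fst x)) \<circ> ?\<phi>) (nel r p) = \<Theta> (fst (nel r p))" by (simp add: case_prod_unfold)
      also have "\<dots> = p"
        unfolding \<Theta>_def R_conj_nel n_mat_simps by (simp add: prod_eq_iff vec_lambda_eta)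
      finally show ?thesis .
    qed
    show "p \<in> ((\<lambda>x. \<Theta> (fst x)) \<circ> ?\<phi>) ` (?NT closure_of \<eta>)" by (rule rev_image_eqI[OF mem]) (rule eq[symmetric])
  qed
  ultimately show ?thesis by (rule bounded_subset)
qed

lemma Delta'_nact_real: "2 * Re (fst (nact l u (of_real h, 0))) - (norm (snd (nact l u (of_real h, 0 :: complex ^ 'm::finite))))\<^sup>2 = 2 * h"
  by (simp add: nact_def Re_divide_of_real)

text \<open>R maps (sinh tau, 0, cosh tau) to (e^tau, 0, e^-tau) / sqrt 2, so the point a_tau 0 goes
  to e^(2 tau) on the real axis, at height Delta' = 2 e^(2 tau); elements of N preserve this
  height.\<close>

lemma R_nel_a_mat:
  fixes p :: "real \<times> (complex ^ 'm::finite)"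
  shows "R_mat *v ((fst (nel r p) ** a_mat \<tau>) *v hcoord (0, 0))
     = of_real (exp (- \<tau>) / sqrt 2) *s hcoord (nact (fst p) (snd p) (of_real (exp (2 * \<tau>)), 0))"
proof -
  let ?n = "n_mat (fst p) (snd p)"
  have eq: "R_mat *v (a_mat \<tau> *v hcoord (0, 0 :: complex ^ 'm)) = of_real (exp (- \<tau>) / sqrt 2) *s hcoord (of_real (exp (2 * \<tau>)), 0)"
  proof -
    have 1: "exp (- \<tau>) * exp (2 * \<tau>) = exp \<tau>" by (simp flip: exp_add)
    have 2: "cosh \<tau> + sinh \<tau> = exp \<tau>" "cosh \<tau> - sinh \<tau> = exp (- \<tau>)"
      by (simp_all add: cosh_plus_sinh cosh_minus_sinh)
    show ?thesis
      by (rule vec_option_eqI)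
        (simp_all add: hcoord_hpt a_mat_hpt R_mat_hpt 1 2 add.commute flip: of_real_add of_real_diff of_real_mult of_real_divide)
  qed
  have "?n *v (R_mat *v (a_mat \<tau> *v hcoord (0, 0))) = of_real (exp (- \<tau>) / sqrt 2) *s (?n *v hcoord (of_real (exp (2 * \<tau>)), 0))"
    unfolding eq by (rule vector_scalar_commute)
  moreover have "R_mat *v ((fst (nel r p) ** a_mat \<tau>) *v hcoord (0, 0)) = (R_mat ** R_inv) *v (?n *v (R_mat *v (a_mat \<tau> *v hcoord (0, 0))))"
    by (simp only: nel_def emb_def fst_conv matrix_vector_mul_assoc matrix_mul_assoc)
  ultimately show ?thesis by (simp only: R_R_inv matrix_vector_mul_lid n_mat_hcoord)
qed

lemma act_R_nel_a_mat:
  "act R_mat (act (fst (nel r p) ** a_mat \<tau>) (0, 0)) = nact (fst p) (snd p) (of_real (exp (2 * \<tau>)), 0)"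
proof -
  let ?X = "fst (nel r p) ** a_mat \<tau>" and ?w = "nact (fst p) (snd p) (of_real (exp (2 * \<tau>)), 0)"
  let ?c = "of_real (exp (- \<tau>) / sqrt 2) :: complex"
  have c: "?c \<noteq> 0" by simp
  have "?X *v hcoord (0, 0) = R_inv *v (R_mat *v (?X *v hcoord (0, 0)))"
    by (simp only: matrix_vector_mul_assoc matrix_mul_assoc R_inv_R matrix_mul_lid)
  also have "\<dots> = ?c *s (R_inv *v hcoord ?w)" by (simp only: R_nel_a_mat vector_scalar_commute)
  finally have "hq (?X *v hcoord (0, 0)) = (norm ?c)\<^sup>2 * hq (R_inv *v hcoord ?w)" by (simp only: hq_scale)
  also have "\<dots> < 0"
  proof (rule mult_pos_neg)
    show "hq (R_inv *v hcoord ?w) < 0"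
      using Delta'_nact_real[of "fst p" "snd p" "exp (2 * \<tau>)"] exp_gt_zero[of "2 * \<tau>"]
      unfolding hq_R_inv by linarith
  qed (use c in simp)
  finally have nz: "(?X *v hcoord (0, 0)) $ None \<noteq> 0" by (rule hq_neg_imp)
  have "act (R_mat ** ?X) (0, 0) = ?w"
    by (rule act_eqI(1)[OF _ c]) (simp only: matrix_vector_mul_assoc[symmetric] R_nel_a_mat[unfolded matrix_vector_mul_assoc[symmetric]])
  then show ?thesis using act_mult(1)[OF nz] by simp
qed

lemma nact_real: "nact l u (of_real h, 0) = (of_real (h + (norm u)\<^sup>2 / 2) + \<i> * of_real l, u)"
  by (simp add: nact_def)

lemma cusp_region_eq:
  assumes \<eta>: "\<eta> \<subseteq> N_grp r"
  shows "cusp_region r \<eta> t0 =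
    {w. (Im (fst w), snd w) \<in> cusp_coords r \<eta> \<and> 2 * Re (fst w) - (norm (snd w))\<^sup>2 > 2 * exp (2 * t0)}"
proof (intro Set.set_eqI iffI)
  fix w assume "w \<in> cusp_region r \<eta> t0"
  then obtain e \<tau> where e: "e \<in> \<eta>" "\<tau> > t0" and w: "w = act R_mat (act (fst e ** a_mat \<tau>) (0, 0))"
    by (auto simp: cusp_region_def set_mult_def A_gt_def sSU_simps emb_def)
  obtain p where p: "e = nel r p" using e(1) \<eta> by (auto simp: N_grp_nel)
  have "w = nact (fst p) (snd p) (of_real (exp (2 * \<tau>)), 0)" unfolding w p by (rule act_R_nel_a_mat)
  then show "w \<in> {w. (Im (fst w), snd w) \<in> cusp_coords r \<eta> \<and> 2 * Re (fst w) - (norm (snd w))\<^sup>2 > 2 * exp (2 * t0)}"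
    using e p by (simp add: nact_real cusp_coords_def)
next
  fix w assume w: "w \<in> {w. (Im (fst w), snd w) \<in> cusp_coords r \<eta> \<and> 2 * Re (fst w) - (norm (snd w))\<^sup>2 > 2 * exp (2 * t0)}"
  define p where "p = (Im (fst w), snd w)"
  define y where "y = Re (fst w) - (norm (snd w))\<^sup>2 / 2"
  \<comment> \<open>The number y is half of Delta' and must equal exp(2 \<tau>).\<close>
  define \<tau> where "\<tau> = ln y / 2"
  have p: "nel r p \<in> \<eta>" and y: "y > exp (2 * t0)" using w by (auto simp: p_def y_def cusp_coords_def)
  have y0: "y > 0" using y exp_gt_zero[of "2 * t0"] by linarith
  then have ey: "exp (2 * \<tau>) = y" by (simp add: \<tau>_def)
  then have "\<tau> > t0" using y by (metis exp_less_cancel_iff mult_less_cancel_left_pos zero_less_numeral)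
  then have "emb r (a_mat \<tau>) \<in> A_gt r t0" by (auto simp: A_gt_def)
  then have x: "nel r p \<otimes>\<^bsub>sSU r\<^esub> emb r (a_mat \<tau>) \<in> \<eta> <#>\<^bsub>sSU r\<^esub> A_gt r t0"
    using p by (auto simp: set_mult_def)
  have "act R_mat (act (fst (nel r p \<otimes>\<^bsub>sSU r\<^esub> emb r (a_mat \<tau>))) (0, 0)) = nact (fst p) (snd p) (of_real (exp (2 * \<tau>)), 0)"
    unfolding sSU_simps fst_conv emb_def by (rule act_R_nel_a_mat)
  also have "\<dots> = w" unfolding ey nact_real p_def y_def by (simp add: prod_eq_iff complex_eq_iff)
  finally show "w \<in> cusp_region r \<eta> t0" unfolding cusp_region_def using x by blast
qed

section \<open>Transformation law and boundedness on horospheres\<close>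

text \<open>The slash operation on one component for a matrix without odd part, which need not lie
  in the group; it will be used for g R^-1, where the components do not mix.\<close>

definition slash_H :: "nat \<Rightarrow> int \<Rightarrow> 'm::finite sfun \<Rightarrow> 'm mat1 \<Rightarrow> nat set \<Rightarrow> 'm pt \<Rightarrow> complex" where
  "slash_H r k f M J w = f (act M w) J * jfac M w powi (k + int (card J))"

lemma slash_Gprime:
  assumes g: "g \<in> Gprime r" and J: "J \<in> Pow {..<r}"
  shows "slash r k f g z J = slash_H r k f (fst g) J z"
proof -
  have "snd g = 1\<^sub>m r" using g by (auto simp: Gprime_def emb_def)
  have "slash r k f g z J = (\<Sum>I\<in>Pow {..<r}. if I = J then f (act (fst g) z) I * jfac (fst g) z powi (k + int (card I)) else 0)"
    unfolding slash_def
  proof (rule sum.cong[OF refl])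
    fix I assume I: "I \<in> Pow {..<r}"
    then have fin: "finite I" using finite_subset by blast
    have "gr_pow (mat_gr r (snd g)) I J = gr_pow gr_gen I J"
      by (rule fun_cong[OF gr_pow_cong[OF fin]]) (use I \<open>snd g = 1\<^sub>m r\<close> mat_gr_one in auto)
    then show "f (act (fst g) z) I * jfac (fst g) z powi (k + int (card I)) * gr_pow (mat_gr r (snd g)) I J
       = (if I = J then f (act (fst g) z) I * jfac (fst g) z powi (k + int (card I)) else 0)"
      using gr_pow_gen[OF fin, of J] by auto
  qed
  then show ?thesis using J by (simp add: slash_H_def)
qed

lemma jfac_R_inv: "jfac R_inv w = of_real (sqrt 2) / (1 + fst w)"
  by (simp add: jfac_def hcoord_hpt R_inv_hpt add.commute)

lemma hq_Un1_R_inv: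
  assumes "g \<in> Un1" "w \<in> H_dom"
  shows "hq ((g ** R_inv) *v hcoord w) < 0"
proof -
  have "hq ((g ** R_inv) *v hcoord w) = hq (g *v (R_inv *v hcoord w))" by (simp only: matrix_vector_mul_assoc)
  also have "\<dots> = (norm (snd w))\<^sup>2 - 2 * Re (fst w)" by (simp only: hq_Un1[OF assms(1)] hq_R_inv)
  finally show ?thesis using assms(2) by (simp add: H_dom_def)
qed

text \<open>Neither g in G' nor R^-1 mixes components, so the two successive slashes merge into one
  by the cocycle identity.\<close>

lemma slash_Rinv_eq:
  assumes g: "g \<in> Gprime r" and J: "J \<in> Pow {..<r}" and w: "w \<in> H_dom"
  shows "slash_Rinv r k (slash r k f g) w J = slash_H r k f (fst g ** R_inv) J w"
proof -
  have "hq ((cmat 1 ** R_inv) *v hcoord w) < 0" by (rule hq_Un1_R_inv[OF Un1_one w])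
  then have nz: "(R_inv *v hcoord w) $ None \<noteq> 0" by (intro hq_neg_imp) simp
  have "slash_Rinv r k (slash r k f g) w J = (\<Sum>I\<in>Pow {..<r}. if I = J then
      slash r k f g (act R_inv w) I * jfac R_inv w powi (k + int (card I)) else 0)"
    unfolding slash_Rinv_def matrix_inv_R
  proof (rule sum.cong[OF refl])
    fix I assume "I \<in> Pow {..<r}"
    then have "finite I" using finite_subset by blast
    then show "slash r k f g (act R_inv w) I * (of_real (sqrt 2) / (1 + fst w)) powi (k + int (card I)) * gr_pow gr_gen I J
       = (if I = J then slash r k f g (act R_inv w) I * jfac R_inv w powi (k + int (card I)) else 0)"
      using gr_pow_gen[of I J] by (auto simp: jfac_R_inv)
  qed
  also have "\<dots> = slash r k f g (act R_inv w) J * jfac R_inv w powi (k + int (card J))" using J by simp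
  also have "\<dots> = slash_H r k f (fst g ** R_inv) J w"
    unfolding slash_Gprime[OF g J] slash_H_def act_mult[OF nz] power_int_mult_distrib by (simp only: mult_ac)
  finally show ?thesis .
qed

section \<open>Transport of the Gamma-invariance to H\<close>

lemma conj_grp_elem:
  assumes \<Gamma>: "\<Gamma> \<subseteq> carrier (sSU r)" and g: "g \<in> Gprime r" and \<gamma>': "\<gamma>' \<in> conj_grp r g \<Gamma>"
  obtains \<gamma> where "\<gamma> \<in> \<Gamma>" "fst g ** fst \<gamma>' = fst \<gamma> ** fst g" "snd \<gamma>' = snd \<gamma>" "\<gamma>' \<in> carrier (sSU r)"
proof -
  interpret group "sSU r" by (rule group_sSU)
  have gc: "g \<in> carrier (sSU r)" using g Gprime_subset by blast
  obtain \<gamma> where \<gamma>: "\<gamma> \<in> \<Gamma>" "\<gamma>' = inv\<^bsub>sSU r\<^esub> g \<otimes>\<^bsub>sSU r\<^esub> \<gamma> \<otimes>\<^bsub>sSU r\<^esub> g"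
    using \<gamma>' by (auto simp: conj_grp_def)
  have \<gamma>c: "\<gamma> \<in> carrier (sSU r)" using \<gamma>(1) \<Gamma> by blast
  have \<gamma>'c: "\<gamma>' \<in> carrier (sSU r)" using gc \<gamma>c by (simp add: \<gamma>(2))
  have "g \<otimes>\<^bsub>sSU r\<^esub> \<gamma>' = \<gamma> \<otimes>\<^bsub>sSU r\<^esub> g"
    unfolding \<gamma>(2) using gc \<gamma>c by (simp add: m_assoc[symmetric])
  then have eq: "fst g ** fst \<gamma>' = fst \<gamma> ** fst g" "snd g * snd \<gamma>' = snd \<gamma> * snd g"
    by (simp_all add: sSU_simps)
  \<comment> \<open>An element of G' has trivial odd block, so conjugation by it leaves the unitary
    block unchanged.\<close>
  have "snd g = 1\<^sub>m r" using g by (auto simp: Gprime_def emb_def)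
  moreover have "snd \<gamma>' \<in> carrier_mat r r" "snd \<gamma> \<in> carrier_mat r r"
    using \<gamma>c \<gamma>'c by (auto simp: sSU_simps Umat_carrier)
  ultimately have "snd \<gamma>' = snd \<gamma>" using eq(2) by simp
  then show ?thesis using that \<gamma>(1) eq(1) \<gamma>'c by blast
qed

lemma conj_grp_inv:
  assumes \<Gamma>: "subgroup \<Gamma> (sSU r)" and g: "g \<in> Gprime r" and \<gamma>: "\<gamma> \<in> conj_grp r g \<Gamma>"
  shows "inv\<^bsub>sSU r\<^esub> \<gamma> \<in> conj_grp r g \<Gamma>"
proof -
  interpret group "sSU r" by (rule group_sSU)
  have gc: "g \<in> carrier (sSU r)" using g Gprime_subset by blast
  obtain h where h: "h \<in> \<Gamma>" "\<gamma> = inv\<^bsub>sSU r\<^esub> g \<otimes>\<^bsub>sSU r\<^esub> h \<otimes>\<^bsub>sSU r\<^esub> g"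
    using \<gamma> by (auto simp: conj_grp_def)
  have hc: "h \<in> carrier (sSU r)" using subgroup.mem_carrier[OF \<Gamma> h(1)] .
  have "inv\<^bsub>sSU r\<^esub> \<gamma> = inv\<^bsub>sSU r\<^esub> g \<otimes>\<^bsub>sSU r\<^esub> inv\<^bsub>sSU r\<^esub> h \<otimes>\<^bsub>sSU r\<^esub> g"
    unfolding h(2) using gc hc by (simp add: inv_mult_group m_assoc)
  then show ?thesis using subgroup.m_inv_closed[OF \<Gamma> h(1)] unfolding conj_grp_def by blast
qed

text \<open>With M = g R^-1 and h = R \<gamma>' R^-1 one has \<gamma> M = M h, so invariance of f at
  the point M w becomes a law for h at w. The weights k + |I| and k + |J| combine in the cocycle
  identity because the mixing preserves the degree.\<close>

lemma slash_H_transform: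
  assumes f: "f \<in> sM r k \<Gamma>" and \<Gamma>: "\<Gamma> \<subseteq> carrier (sSU r)" and g: "g \<in> Gprime r"
    and \<gamma>': "\<gamma>' \<in> conj_grp r g \<Gamma>" and w: "w \<in> H_dom" and J: "J \<in> Pow {..<r}"
    and nz: "((R_mat ** fst \<gamma>' ** R_inv) *v hcoord w) $ None \<noteq> 0"
  shows "slash_H r k f (fst g ** R_inv) J w = (\<Sum>I\<in>Pow {..<r}.
     slash_H r k f (fst g ** R_inv) I (act (R_mat ** fst \<gamma>' ** R_inv) w)
       * jfac (R_mat ** fst \<gamma>' ** R_inv) w powi (k + int (card I)) * gr_pow (mat_gr r (snd \<gamma>')) I J)"
proof -
  let ?M = "fst g ** R_inv" and ?h = "R_mat ** fst \<gamma>' ** R_inv"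
  obtain \<gamma> where \<gamma>: "\<gamma> \<in> \<Gamma>" "fst g ** fst \<gamma>' = fst \<gamma> ** fst g" "snd \<gamma>' = snd \<gamma>"
    using conj_grp_elem[OF \<Gamma> g \<gamma>'] by metis
  have gU: "fst g \<in> Un1" using g by (auto simp: Gprime_def emb_def)
  note ab = act_ball[OF hq_Un1_R_inv[OF gU w]]
  have M: "fst \<gamma> ** ?M = ?M ** ?h"
  proof -
    have "?M ** ?h = fst g ** (R_inv ** R_mat) ** fst \<gamma>' ** R_inv" by (simp only: matrix_mul_assoc)
    also have "\<dots> = fst \<gamma> ** fst g ** R_inv" by (simp only: R_inv_R matrix_mul_rid' \<gamma>(2))
    finally show ?thesis by (simp only: matrix_mul_assoc)
  qed
  let ?z = "act ?M w"
  have "f ?z J = slash r k f \<gamma> ?z J" using f \<gamma>(1) ab(2) by (simp add: sM_def)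
  then have "slash_H r k f ?M J w = (\<Sum>I\<in>Pow {..<r}. f (act (fst \<gamma>) ?z) I * jfac (fst \<gamma>) ?z powi (k + int (card I))
      * gr_pow (mat_gr r (snd \<gamma>)) I J * jfac ?M w powi (k + int (card J)))"
    by (simp add: slash_H_def slash_def sum_distrib_right)
  also have "\<dots> = (\<Sum>I\<in>Pow {..<r}. slash_H r k f ?M I (act ?h w) * jfac ?h w powi (k + int (card I)) * gr_pow (mat_gr r (snd \<gamma>)) I J)"
  proof (rule sum.cong[OF refl])
    fix I assume "I \<in> Pow {..<r}"
    then have fin: "finite I" using finite_subset by blast
    show "f (act (fst \<gamma>) ?z) I * jfac (fst \<gamma>) ?z powi (k + int (card I)) * gr_pow (mat_gr r (snd \<gamma>)) I J * jfac ?M w powi (k + int (card J))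
      = slash_H r k f ?M I (act ?h w) * jfac ?h w powi (k + int (card I)) * gr_pow (mat_gr r (snd \<gamma>)) I J"
    proof (cases "gr_pow (mat_gr r (snd \<gamma>)) I J = 0")
      case False
      then have card: "card J = card I" by (rule gr_pow_mat_gr_nonzero[OF _ fin])
      have 1: "act (fst \<gamma>) ?z = act ?M (act ?h w)" unfolding act_mult(1)[OF ab(1), symmetric] M by (rule act_mult(1)[OF nz])
      have 2: "jfac (fst \<gamma>) ?z * jfac ?M w = jfac ?M (act ?h w) * jfac ?h w"
        unfolding act_mult(2)[OF ab(1), symmetric] M by (rule act_mult(2)[OF nz])
      have "jfac (fst \<gamma>) ?z powi (k + int (card I)) * jfac ?M w powi (k + int (card J))
         = jfac ?M (act ?h w) powi (k + int (card I)) * jfac ?h w powi (k + int (card I))"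
        unfolding card power_int_mult_distrib[symmetric] 2 ..
      then show ?thesis unfolding slash_H_def 1 by (simp add: mult_ac)
    qed simp
  qed
  finally show ?thesis by (simp only: \<gamma>(3))
qed

lemma holo_slash_H:
  assumes f: "f \<in> sM r k \<Gamma>" and g: "g \<in> Gprime r" and J: "J \<in> Pow {..<r}"
  shows "holo_on pt_smul (slash_H r k f (fst g ** R_inv) J) H_dom"
  unfolding holo_on_cdiff
proof
  fix w :: "'a pt" assume w: "w \<in> H_dom"
  have gU: "fst g \<in> Un1" using g by (auto simp: Gprime_def emb_def)
  have "holo_on pt_smul (\<lambda>z. f z J) ball_B" using f J by (auto simp: sM_def sholo_def)
  from cdiff_at_slash[OF this hq_Un1_R_inv[OF gU w]]
  show "cdiff_at (slash_H r k f (fst g ** R_inv) J) w" unfolding slash_H_def[abs_def] .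
qed

lemma mat_scalar_vec: "(cmat c :: complex ^ 'n::finite ^ 'n) *v v = c *s v"
  by (simp add: matrix_vector_mult_def Finite_Cartesian_Product.mat_def cart_eq_iff
      if_distrib[of "\<lambda>x. x * _"] sum.delta cong: if_cong)

lemma ZGprime_one: "\<one>\<^bsub>sSU r\<^esub> \<in> (ZGprime r :: ('m::finite gel) set)"
proof -
  have "\<exists>\<epsilon> E. (cmat 1 :: 'm mat1, 1\<^sub>m r) = (cmat \<epsilon>, E) \<and>
     norm (\<epsilon>::complex) = 1 \<and> E \<in> Umat r \<and> \<epsilon> ^ (CARD('m) + 2) = Determinant.det E"
    by (intro exI[of _ 1] exI[of _ "1\<^sub>m r"]) (simp add: Umat_one)
  then show ?thesis unfolding ZGprime_def sSU_simps by simp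
qed

lemma nact_decompose:
  assumes "Delta' w = t"
  shows "w = nact (Im (fst w)) (snd w) (of_real (t / 2), 0)"
  unfolding nact_real using assms by (simp add: Delta'_eq prod_eq_iff complex_eq_iff)

text \<open>A point of the horosphere is \<open>n (h, 0)\<close> with \<open>n \<in> N\<close>; writing \<open>n = \<gamma> e z\<close> with \<open>e \<in> \<eta>\<close>
  and \<open>z\<close> acting trivially, \<open>\<gamma>\<inverse>\<close> moves it into the relatively compact set \<open>\<eta> (h, 0)\<close>.\<close>

lemma horosphere_bound:
  fixes \<Gamma> \<eta> \<Xi> :: "('m::finite gel) set"
  assumes \<Gamma>: "subgroup \<Gamma> (sSU r)" and data: "fundamental_data r \<Gamma> \<eta> t0 \<Xi>"
    and f: "f \<in> sM r k \<Gamma>" and g: "g \<in> \<Xi>" and J: "J \<in> Pow {..<r}" and t: "t > 0"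
  shows "\<exists>C. \<forall>w. Delta' w = t \<longrightarrow> norm (slash_H r k f (fst g ** R_inv) J w) \<le> C"
proof -
  interpret group "sSU r" by (rule group_sSU)
  let ?Q = "slash_H r k f (fst g ** R_inv)"
  let ?NZ = "N_grp r <#>\<^bsub>sSU r\<^esub> ZGprime r"
  have gG: "g \<in> Gprime r" using data g by (auto simp: fundamental_data_def Let_def)
  have \<eta>: "openin (subtopology (gel_top r) (N_grp r)) \<eta>"
    "compactin (subtopology (gel_top r) (N_grp r)) (subtopology (gel_top r) (N_grp r) closure_of \<eta>)"
    using data by (simp_all add: fundamental_data_def Let_def)
  have NZ: "?NZ = (conj_grp r g \<Gamma> \<inter> ?NZ) <#>\<^bsub>sSU r\<^esub> \<eta> <#>\<^bsub>sSU r\<^esub> ZGprime r"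
    using data g unfolding fundamental_data_def Let_def by blast
  have \<eta>N: "\<eta> \<subseteq> N_grp r" using \<eta>(1) by (metis openin_subset topspace_subtopology le_inf_iff)
  obtain \<beta> where \<beta>: "\<And>p. p \<in> cusp_coords r \<eta> \<Longrightarrow> norm p \<le> \<beta>"
    using bounded_cusp_coords[OF \<eta>] unfolding bounded_iff by blast
  let ?bp = "(of_real (t / 2), 0) :: 'm pt"
  let ?n = "\<lambda>p :: real \<times> (complex ^ 'm). nact (fst p) (snd p) ?bp"
  have nD: "Delta' (?n p) = t" for p
    using Delta'_nact_real[of "fst p" "snd p" "t / 2"] by (simp add: Delta'_eq)
  have nH: "?n p \<in> H_dom" for p using nD t by (simp add: H_dom_iff)
  \<comment> \<open>Bounded coordinates place the translates of the base point by \<eta> inside the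
    image of a closed ball, a compact piece of the horosphere on which every component is
    bounded.\<close>
  have "continuous_on (cball 0 \<beta>) ?n" unfolding nact_real by (intro continuous_intros) auto
  then have comp: "compact (?n ` cball 0 \<beta>)" by (intro compact_continuous_image) auto
  have "\<exists>C. \<forall>p\<in>cball 0 \<beta>. norm (?Q I (?n p)) \<le> C" if I: "I \<in> Pow {..<r}" for I
  proof -
    have "continuous_on H_dom (?Q I)" by (rule holo_on_imp_continuous_on[OF holo_slash_H[OF f gG I]])
    then have "continuous_on (?n ` cball 0 \<beta>) (?Q I)" by (rule continuous_on_subset) (use nH in auto)
    then have "bounded (?Q I ` ?n ` cball 0 \<beta>)" by (intro compact_imp_bounded compact_continuous_image comp)
    then show ?thesis unfolding bounded_iff by auto
  qed
  then obtain C where C: "\<And>I p. I \<in> Pow {..<r} \<Longrightarrow> p \<in> cball 0 \<beta> \<Longrightarrow> norm (?Q I (?n p)) \<le> C I" by metis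
  show ?thesis
  proof (intro exI allI impI)
    fix w :: "'m pt" assume w: "Delta' w = t"
    then have wH: "w \<in> H_dom" using t by (simp add: H_dom_iff)
    define p where "p = (Im (fst w), snd w)"
    have wp: "w = ?n p" using nact_decompose[OF w] by (simp add: p_def)
    have "nel r p = nel r p \<otimes>\<^bsub>sSU r\<^esub> \<one>\<^bsub>sSU r\<^esub>"
      by (simp add: sSU_simps nel_def emb_def matrix_mul_rid')
    then have "nel r p \<in> ?NZ" unfolding set_mult_def N_grp_nel using ZGprime_one by blast
    then have "nel r p \<in> (conj_grp r g \<Gamma> \<inter> ?NZ) <#>\<^bsub>sSU r\<^esub> \<eta> <#>\<^bsub>sSU r\<^esub> ZGprime r" using NZ by simp
    then obtain \<gamma> e z where \<gamma>: "\<gamma> \<in> conj_grp r g \<Gamma>" and e: "e \<in> \<eta>" and z: "z \<in> ZGprime r"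
      and dec: "nel r p = \<gamma> \<otimes>\<^bsub>sSU r\<^esub> e \<otimes>\<^bsub>sSU r\<^esub> z"
      unfolding set_mult_def by blast
    have "e \<in> range (nel r)" using e \<eta>N by (simp only: N_grp_nel subsetD)
    then obtain p' where p': "e = nel r p'" by (rule rangeE)
    have p'V: "p' \<in> cball 0 \<beta>" using \<beta>[of p'] e by (simp add: p' cusp_coords_def)
    obtain \<epsilon> where \<epsilon>: "fst z = cmat \<epsilon>" "norm (\<epsilon>::complex) = 1"
      using z by (auto simp: ZGprime_def)
    define \<gamma>i where "\<gamma>i = inv\<^bsub>sSU r\<^esub> \<gamma>"
    have \<gamma>i: "\<gamma>i \<in> conj_grp r g \<Gamma>" unfolding \<gamma>i_def by (rule conj_grp_inv[OF \<Gamma> gG \<gamma>])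
    have \<Gamma>c: "\<Gamma> \<subseteq> carrier (sSU r)" using \<Gamma> by (rule subgroup.subset)
    have \<gamma>c: "\<gamma> \<in> carrier (sSU r)" "\<gamma>i \<in> carrier (sSU r)"
      using conj_grp_elem[OF \<Gamma>c gG \<gamma>] conj_grp_elem[OF \<Gamma>c gG \<gamma>i] by metis+
    have "\<gamma>i \<otimes>\<^bsub>sSU r\<^esub> \<gamma> = \<one>\<^bsub>sSU r\<^esub>" unfolding \<gamma>i_def by (rule l_inv[OF \<gamma>c(1)])
    then have inv1: "fst \<gamma>i ** fst \<gamma> = cmat 1" by (simp add: sSU_simps)
    have fst_dec: "fst (nel r p) = fst \<gamma> ** fst e ** fst z" using arg_cong[OF dec, of fst] by (simp add: sSU_simps)
    let ?h = "R_mat ** fst \<gamma>i ** R_inv"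
    \<comment> \<open>Cancelling \<gamma> leaves e z, and the scalar block of z survives only as the
      denominator \<epsilon> of modulus 1.\<close>
    have "?h *v hcoord w = \<epsilon> *s hcoord (?n p')"
    proof -
      have "?h *v hcoord w = ?h *v ((R_mat ** fst (nel r p) ** R_inv) *v hcoord ?bp)"
        unfolding R_conj_nel n_mat_hcoord using wp by simp
      also have "\<dots> = (R_mat ** fst \<gamma>i ** (R_inv ** R_mat) ** fst (nel r p) ** R_inv) *v hcoord ?bp"
        by (simp only: matrix_vector_mul_assoc matrix_mul_assoc)
      also have "R_mat ** fst \<gamma>i ** (R_inv ** R_mat) ** fst (nel r p) ** R_inv
         = R_mat ** (fst \<gamma>i ** fst \<gamma>) ** fst e ** fst z ** R_inv"
        by (simp only: R_inv_R matrix_mul_rid' fst_dec matrix_mul_assoc)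
      also have "\<dots> *v hcoord ?bp = (R_mat ** fst e) *v (fst z *v (R_inv *v hcoord ?bp))"
        by (simp only: inv1 matrix_mul_rid' matrix_vector_mul_assoc matrix_mul_assoc)
      also have "\<dots> = \<epsilon> *s ((R_mat ** fst e) *v (R_inv *v hcoord ?bp))"
        unfolding \<epsilon>(1) mat_scalar_vec by (rule vector_scalar_commute)
      also have "(R_mat ** fst e) *v (R_inv *v hcoord ?bp) = hcoord (?n p')"
        unfolding matrix_vector_mul_assoc p' R_conj_nel n_mat_hcoord ..
      finally show ?thesis .
    qed
    note ae = act_eqI[OF this]
    have \<epsilon>0: "\<epsilon> \<noteq> 0" using \<epsilon>(2) by auto
    have sndU: "snd \<gamma>i \<in> Umat r" using \<gamma>c(2) by (auto simp: sSU_simps)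
    have "?Q J w = (\<Sum>I\<in>Pow {..<r}. ?Q I (?n p') * inverse \<epsilon> powi (k + int (card I)) * gr_pow (mat_gr r (snd \<gamma>i)) I J)"
      using slash_H_transform[OF f \<Gamma>c gG \<gamma>i wH J ae(3)[OF \<epsilon>0]] unfolding ae(1)[OF \<epsilon>0] ae(2)[OF \<epsilon>0] .
    \<comment> \<open>The element \<gamma> enters only through powers of a number of modulus 1 and
      through a matrix in U(r), so this constant does not depend on the point of the
      horosphere.\<close>
    also have "norm \<dots> \<le> (\<Sum>I\<in>Pow {..<r}. C I * (2 ^ r) ^ r)"
    proof (rule sum_norm_le)
      fix I assume I: "I \<in> Pow {..<r}"
      have "norm (?Q I (?n p') * inverse \<epsilon> powi (k + int (card I)) * gr_pow (mat_gr r (snd \<gamma>i)) I J)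
         = norm (?Q I (?n p')) * norm (gr_pow (mat_gr r (snd \<gamma>i)) I J)"
        using \<epsilon>(2) by (simp add: norm_mult norm_power_int norm_inverse)
      also have "\<dots> \<le> C I * (2 ^ r) ^ r"
      proof (rule mult_mono)
        show "norm (?Q I (?n p')) \<le> C I" by (rule C[OF I p'V])
        then show "0 \<le> C I" using norm_ge_zero order_trans by blast
        show "norm (gr_pow (mat_gr r (snd \<gamma>i)) I J) \<le> (2 ^ r) ^ r" using norm_gr_pow_le[OF sndU] I by simp
      qed simp
      finally show "norm (?Q I (?n p') * inverse \<epsilon> powi (k + int (card I)) * gr_pow (mat_gr r (snd \<gamma>i)) I J) \<le> C I * (2 ^ r) ^ r" .
    qed
    finally show "norm (?Q J w) \<le> (\<Sum>I\<in>Pow {..<r}. C I * (2 ^ r) ^ r)" .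
  qed
qed

text \<open>After conjugation gamma_0 is the translation by i lambda_0 with denominator \<epsilon>,
  which contributes the phase (k + |J|) chi; the diagonal matrix E multiplies the monomial of index
  J by the phase tr_J D and does not mix components.\<close>

lemma slash_H_quasi_periodic:
  fixes \<Gamma> :: "('m::finite gel) set"
  assumes \<Gamma>: "\<Gamma> \<subseteq> carrier (sSU r)" and f: "f \<in> sM r k \<Gamma>" and g: "g \<in> Gprime r" and J: "J \<in> Pow {..<r}"
    and \<gamma>0: "\<gamma>0 \<in> conj_grp r g \<Gamma>"
    and \<gamma>0_eq: "emb r R_mat \<otimes>\<^bsub>sSU r\<^esub> \<gamma>0 \<otimes>\<^bsub>sSU r\<^esub> emb r (matrix_inv R_mat) =
                emb r (n_mat lam0 0) \<otimes>\<^bsub>sSU r\<^esub> (cmat \<epsilon>, E)"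
    and chi: "inverse \<epsilon> = exp (2 * of_real pi * \<i> * of_real chi)"
    and D: "E = mat_diag r (\<lambda>j. exp (2 * of_real pi * \<i> * of_real (d j)))"
    and w: "w \<in> H_dom"
  shows "slash_H r k f (fst g ** R_inv) J (fst w + \<i> * of_real lam0, snd w)
    = exp (- (2 * of_real pi * \<i> * of_real (shift k chi d J))) * slash_H r k f (fst g ** R_inv) J w"
proof -
  let ?Q = "slash_H r k f (fst g ** R_inv)"
  let ?e = "\<lambda>x :: real. exp (2 * of_real pi * \<i> * of_real x)"
  let ?w' = "(fst w + \<i> * of_real lam0, snd w)"
  have fst_eq: "R_mat ** fst \<gamma>0 ** R_inv = n_mat lam0 0 ** cmat \<epsilon>"
    using arg_cong[OF \<gamma>0_eq, of fst] by (simp add: sSU_simps emb_def matrix_inv_R)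
  have "\<gamma>0 \<in> carrier (sSU r)" by (rule conj_grp_elem[OF \<Gamma> g \<gamma>0])
  then have "snd \<gamma>0 \<in> carrier_mat r r" by (auto simp: sSU_simps Umat_carrier)
  moreover have "E \<in> carrier_mat r r" unfolding D by simp
  ultimately have snd_eq: "snd \<gamma>0 = E"
    using arg_cong[OF \<gamma>0_eq, of snd] by (simp add: sSU_simps emb_def)
  have "inverse \<epsilon> \<noteq> 0" unfolding chi by (rule exp_not_eq_zero)
  then have \<epsilon>0: "\<epsilon> \<noteq> 0" by simp
  have "nact lam0 0 w = ?w'" by (simp add: nact_def)
  then have "(R_mat ** fst \<gamma>0 ** R_inv) *v hcoord w = \<epsilon> *s hcoord ?w'"
    unfolding fst_eq matrix_vector_mul_assoc[symmetric] mat_scalar_vec vector_scalar_commute n_mat_hcoord by simp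
  note ae = act_eqI[OF this \<epsilon>0]
  have "?Q J w = (\<Sum>I\<in>Pow {..<r}. ?Q I ?w' * inverse \<epsilon> powi (k + int (card I)) * gr_pow (mat_gr r E) I J)"
    using slash_H_transform[OF f \<Gamma> g \<gamma>0 w J ae(3)] unfolding ae(1,2) snd_eq .
  also have "\<dots> = (\<Sum>I\<in>Pow {..<r}. if I = J then ?Q I ?w' * inverse \<epsilon> powi (k + int (card I)) * (\<Prod>i\<in>I. ?e (d i)) else 0)"
  proof (rule sum.cong[OF refl])
    fix I assume I: "I \<in> Pow {..<r}"
    then have "finite I" using finite_subset by blast
    then show "?Q I ?w' * inverse \<epsilon> powi (k + int (card I)) * gr_pow (mat_gr r E) I J
       = (if I = J then ?Q I ?w' * inverse \<epsilon> powi (k + int (card I)) * (\<Prod>i\<in>I. ?e (d i)) else 0)"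
      unfolding D using I by (simp add: gr_pow_diag gr_pow_gen)
  qed
  also have "\<dots> = ?Q J ?w' * inverse \<epsilon> powi (k + int (card J)) * (\<Prod>i\<in>J. ?e (d i))" using J by simp
  also have "\<dots> = ?Q J ?w' * ?e (shift k chi d J)"
  proof -
    have fin: "finite J" using J finite_subset by blast
    have "(\<Prod>i\<in>J. ?e (d i)) = exp (\<Sum>i\<in>J. 2 * of_real pi * \<i> * of_real (d i))"
      using exp_sum[OF fin, of "\<lambda>i. 2 * of_real pi * \<i> * of_real (d i)"] by simp
    also have "(\<Sum>i\<in>J. 2 * of_real pi * \<i> * of_real (d i)) = 2 * of_real pi * \<i> * of_real (\<Sum>i\<in>J. d i)"
      by (simp add: sum_distrib_left)
    finally have prod: "(\<Prod>i\<in>J. ?e (d i)) = exp (2 * of_real pi * \<i> * of_real (\<Sum>i\<in>J. d i))" .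
    have "of_int (k + int (card J)) * (2 * of_real pi * \<i> * of_real chi) + 2 * of_real pi * \<i> * of_real (\<Sum>i\<in>J. d i)
      = 2 * of_real pi * \<i> * of_real (shift k chi d J)"
      by (simp add: shift_def algebra_simps)
    then have "inverse \<epsilon> powi (k + int (card J)) * (\<Prod>i\<in>J. ?e (d i)) = ?e (shift k chi d J)"
      unfolding chi exp_power_int prod exp_add[symmetric] by (simp only:)
    then show ?thesis by (simp only: mult.assoc)
  qed
  finally have eq: "?Q J w = ?Q J ?w' * ?e (shift k chi d J)" .
  have "exp (- a) * (y * exp a) = y" for a y :: complex by (simp add: exp_minus)
  then show ?thesis unfolding eq by (simp only:)
qed

theorem theorem2p4:
  fixes n r :: nat and k :: int
    and \<Gamma> \<eta> \<Xi> :: "('m::finite gel) set" and t0 :: real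
    and f :: "'m sfun" and g \<gamma>0 :: "'m gel"
    and q :: "nat set \<Rightarrow> 'm pt \<Rightarrow> complex"
    and lam0 chi :: real and \<epsilon> :: complex and E :: "complex mat" and d :: "nat \<Rightarrow> real"
  assumes n: "n = CARD('m) + 1"
    and lattice: "lattice_in (sSU r) (subtopology (gel_top r) (carrier (sSU r))) \<Gamma>"
    and noncompact: "\<not> compact_space (coset_space r \<Gamma>)"
    and data: "fundamental_data r \<Gamma> \<eta> t0 \<Xi>"
    and f: "f \<in> sM r k \<Gamma>"
    and g: "g \<in> \<Xi>"
    and q: "\<And>w. w \<in> H_dom \<Longrightarrow>
              slash_Rinv r k (slash r k f g) w = (\<lambda>J. \<Sum>I\<in>Pow {..<r}. q I w * gr_pow gr_gen I J)"
    and \<gamma>0: "\<gamma>0 \<in> (conj_grp r g \<Gamma> \<inter> (N'_grp r <#>\<^bsub>sSU r\<^esub> ZGprime r)) - ZGprime r"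
    and \<gamma>0_eq: "emb r R_mat \<otimes>\<^bsub>sSU r\<^esub> \<gamma>0 \<otimes>\<^bsub>sSU r\<^esub> emb r (matrix_inv R_mat) =
                emb r (n_mat lam0 0) \<otimes>\<^bsub>sSU r\<^esub> (Finite_Cartesian_Product.mat \<epsilon>, E)"
    and lam0: "lam0 \<noteq> 0"
    and \<epsilon>: "norm \<epsilon> = 1"
    and E: "E \<in> Umat r" "\<epsilon> ^ (n + 1) = Determinant.det E" "diagonal_mat E"
    and chi: "inverse \<epsilon> = exp (2 * of_real pi * \<i> * of_real chi)"
    and D: "E = mat_diag r (\<lambda>j. exp (2 * of_real pi * \<i> * of_real (d j)))"
  shows "\<exists>c.
      \<comment> \<open>(i)\<close>
      fourier_expansion r lam0 (shift k chi d) q c \<and>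
      (\<forall>c'. fourier_expansion r lam0 (shift k chi d) q c' \<longrightarrow>
         (\<forall>I\<in>Pow {..<r}. \<forall>m\<in>fourier_exps lam0 (shift k chi d I). c' I m = c I m)) \<and>
      (\<forall>w\<in>H_dom. slash_Rinv r k (slash r k f g) w =
         (\<lambda>J. \<Sum>I\<in>Pow {..<r}.
            (\<Sum>\<^sub>\<infinity>m\<in>fourier_exps lam0 (shift k chi d I). fourier_term (c I) w m)
              * gr_pow gr_gen I J)) \<and>
      (\<forall>I\<in>Pow {..<r}.
         (\<forall>w\<in>H_dom. (\<lambda>m. norm (fourier_term (c I) w m))
                       summable_on fourier_exps lam0 (shift k chi d I)) \<and>
         (\<forall>C. compact C \<and> C \<subseteq> H_dom \<longrightarrow>
            uniform_limit C
              (\<lambda>F w. \<Sum>m\<in>F. fourier_term (c I) w m)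
              (q I) (finite_subsets_at_top (fourier_exps lam0 (shift k chi d I))))) \<and>
      \<comment> \<open>(ii)\<close>
      (\<forall>I\<in>Pow {..<r}. \<forall>m\<in>fourier_exps lam0 (shift k chi d I). m > 0 \<longrightarrow> (\<forall>v. c I m v = 0)) \<and>
      (\<forall>I\<in>Pow {..<r}. shift k chi d I \<in> \<int> \<longrightarrow> (\<exists>a. \<forall>v. c I 0 v = a)) \<and>
      \<comment> \<open>(iii)\<close>
      (\<forall>I\<in>Pow {..<r}. \<forall>s::ennreal. 1 \<le> s \<longrightarrow>
         (shift k chi d I \<notin> \<int> \<longrightarrow>
            in_Lp s (restrict_space H_measure (cusp_region r \<eta> t0))
              (\<lambda>w. q I w * of_real (Delta' w powr ((of_int k + of_nat (card I)) / 2)))) \<and>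
         (shift k chi d I \<in> \<int> \<and> k \<ge> 2 * int n - int (card I) \<longrightarrow>
            (in_Lp s (restrict_space H_measure (cusp_region r \<eta> t0))
               (\<lambda>w. q I w * of_real (Delta' w powr ((of_int k + of_nat (card I)) / 2)))
             \<longleftrightarrow> (\<forall>v. c I 0 v = 0))))"
proof -
  have \<Gamma>: "subgroup \<Gamma> (sSU r)" using lattice by (simp add: lattice_in_def)
  then have \<Gamma>c: "\<Gamma> \<subseteq> carrier (sSU r)" by (rule subgroup.subset)
  have gG: "g \<in> Gprime r" using data g by (auto simp: fundamental_data_def Let_def)
  let ?X = "\<lambda>I. fourier_exps lam0 (shift k chi d I)"
  \<comment> \<open>The coefficients depend only on q_I and lambda_0; the shift determines which
    exponents are admissible.\<close>
  let ?c = "\<lambda>I. koecher.coef (q I) lam0"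
  \<comment> \<open>The family \<open>q\<close> is prescribed on H only, so properties are
    transferred between it and \<open>slash_H\<close> inside this open set.\<close>
  have q_eq: "q J w = slash_H r k f (fst g ** R_inv) J w" if J: "J \<in> Pow {..<r}" and w: "w \<in> H_dom" for J w
  proof -
    have "slash_Rinv r k (slash r k f g) w J = (\<Sum>I\<in>Pow {..<r}. if I = J then q I w else 0)"
      unfolding q[OF w]
    proof (rule sum.cong[OF refl])
      fix I assume "I \<in> Pow {..<r}"
      then have "finite I" using finite_subset by blast
      then show "q I w * gr_pow gr_gen I J = (if I = J then q I w else 0)" by (auto simp: gr_pow_gen)
    qed
    then show ?thesis using J slash_Rinv_eq[OF gG J w] by simp
  qed
  have K: "koecher (q J) lam0 (shift k chi d J)" if J: "J \<in> Pow {..<r}" for J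
  proof
    show "lam0 \<noteq> 0" by (rule lam0)
    show "holo_on pt_smul (q J) H_dom"
      unfolding holo_on_def
    proof
      fix w :: "'m pt" assume w: "w \<in> H_dom"
      have "\<exists>D. (slash_H r k f (fst g ** R_inv) J has_derivative D) (at w) \<and> (\<forall>a v. D (pt_smul a v) = a * D v)"
        by (rule bspec[OF holo_slash_H[OF f gG J, unfolded holo_on_def] w])
      then obtain D where D: "(slash_H r k f (fst g ** R_inv) J has_derivative D) (at w)" "\<forall>a v. D (pt_smul a v) = a * D v"
        by (elim exE conjE)
      have "(q J has_derivative D) (at w)"
        by (rule has_derivative_transform_within_open[OF D(1) open_H_dom w]) (simp add: q_eq[OF J])
      then show "\<exists>D. (q J has_derivative D) (at w) \<and> (\<forall>a v. D (pt_smul a v) = a * D v)"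
        using D(2) by (intro exI[of _ D] conjI)
    qed
    show "q J (fst w + \<i> * of_real lam0, snd w) = exp (- (2 * of_real pi * \<i> * of_real (shift k chi d J))) * q J w"
      if w: "w \<in> H_dom" for w
    proof -
      have w': "(fst w + \<i> * of_real lam0, snd w) \<in> H_dom" using w by (simp add: H_dom_def)
      have "\<gamma>0 \<in> conj_grp r g \<Gamma>" using \<gamma>0 by simp
      from slash_H_quasi_periodic[OF \<Gamma>c f gG J this \<gamma>0_eq chi D w]
      show ?thesis unfolding q_eq[OF J w] q_eq[OF J w'] .
    qed
    show "\<exists>C. \<forall>w. Delta' w = t \<longrightarrow> norm (q J w) \<le> C" if t: "t > 0" for t
    proof -
      obtain C where C: "\<forall>w. Delta' w = t \<longrightarrow> norm (slash_H r k f (fst g ** R_inv) J w) \<le> C"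
        using horosphere_bound[OF \<Gamma> data f g J t] ..
      have "norm (q J w) \<le> C" if "Delta' w = t" for w
        using C[rule_format, OF that] q_eq[OF J, of w] t that by (simp add: H_dom_iff)
      then show ?thesis by (intro exI[of _ C] allI impI)
    qed
  qed
  have expansion: "fourier_expansion r lam0 (shift k chi d) q ?c"
    unfolding fourier_expansion_def
  proof (intro ballI conjI)
    fix I m assume I: "I \<in> Pow {..<r}" and m: "m \<in> ?X I"
    show "holo_on (*s) (?c I m) UNIV" by (rule koecher.coef_holo[OF K[OF I] m])
  next
    fix I and w :: "'m pt" assume I: "I \<in> Pow {..<r}" and w: "w \<in> H_dom"
    show "(fourier_term (?c I) w has_sum q I w) (?X I)" by (rule koecher.term_has_sum[OF K[OF I] w])
  qed
  have \<eta>: "openin (subtopology (gel_top r) (N_grp r)) \<eta>"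
    "compactin (subtopology (gel_top r) (N_grp r)) (subtopology (gel_top r) (N_grp r) closure_of \<eta>)"
    using data by (simp_all add: fundamental_data_def Let_def)
  have \<eta>N: "\<eta> \<subseteq> N_grp r" using \<eta>(1) by (metis openin_subset topspace_subtopology le_inf_iff)
  have "N_grp r <#>\<^bsub>sSU r\<^esub> ZGprime r =
      (conj_grp r g \<Gamma> \<inter> (N_grp r <#>\<^bsub>sSU r\<^esub> ZGprime r)) <#>\<^bsub>sSU r\<^esub> \<eta> <#>\<^bsub>sSU r\<^esub> ZGprime r"
    using data g unfolding fundamental_data_def Let_def by blast
  moreover have "N_grp r <#>\<^bsub>sSU r\<^esub> ZGprime r \<noteq> {}"
    using ZGprime_one unfolding set_mult_def N_grp_nel by blast
  \<comment> \<open>With \<eta> empty the covering of N Z(G') would be empty. A nonempty coordinate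
    set is what allows balls to be packed into the cusp region.\<close>
  ultimately have "\<eta> \<noteq> {}" by (auto simp: set_mult_def)
  then obtain e where e: "e \<in> \<eta>" by blast
  then have "e \<in> range (nel r)" using \<eta>N by (simp only: N_grp_nel subsetD)
  then obtain p where "e = nel r p" by (rule rangeE)
  then have Vne: "cusp_coords r \<eta> \<noteq> {}" using e unfolding cusp_coords_def by blast
  \<comment> \<open>The value 2 e^(2 t0) is the height Delta' of the point a_t0 0.\<close>
  interpret cn: cusp_neighbourhood "cusp_coords r \<eta>" "2 * exp (2 * t0)"
    by unfold_locales (use open_cusp_coords[OF \<eta>(1)] bounded_cusp_coords[OF \<eta>] Vne in auto)
  have region: "cusp_region r \<eta> t0 = cn.P"
    unfolding cusp_region_eq[OF \<eta>N] cn.P_def Delta'_eq ..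
  have t1: "2 * exp (2 * t0) > 0" by simp
  let ?h = "\<lambda>I w. q I w * of_real (Delta' w powr ((of_int k + of_nat (card I)) / 2))"
  let ?L = "\<lambda>s I. in_Lp s (restrict_space H_measure (cusp_region r \<eta> t0)) (?h I)"
  let ?a = "\<lambda>I. if shift k chi d I \<in> \<int> then ?c I 0 0 else 0"
  have cont: "continuous_on H_dom (q I)" if "I \<in> Pow {..<r}" for I
    by (rule holo_on_imp_continuous_on[OF koecher.holo[OF K[OF that]]])
  have Lp: "?L s I"
    if I: "I \<in> Pow {..<r}" and s: "1 \<le> s" and a: "?a I = 0" for I and s :: ennreal
  proof -
    obtain \<kappa> C where \<kappa>: "\<kappa> > 0" and decay: "\<forall>w. Delta' w \<ge> 2 * exp (2 * t0) \<longrightarrow>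
        norm (q I w - ?a I) \<le> C * exp (- (\<kappa> * Delta' w))"
      using koecher.exponential_decay[OF K[OF I] t1] by (elim exE conjE)
    note d = \<kappa> decay[rule_format]
    from cn.in_Lp_cusp[OF cont[OF I] d a s] show ?thesis unfolding region .
  qed
  have not_Lp: "\<not> ?L s I"
    if I: "I \<in> Pow {..<r}" and s: "1 \<le> s" and a: "?a I \<noteq> 0"
      and k: "k \<ge> 2 * int n - int (card I)" for I and s :: ennreal
  proof -
    obtain \<kappa> C where \<kappa>: "\<kappa> > 0" and decay: "\<forall>w. Delta' w \<ge> 2 * exp (2 * t0) \<longrightarrow>
        norm (q I w - ?a I) \<le> C * exp (- (\<kappa> * Delta' w))"
      using koecher.exponential_decay[OF K[OF I] t1] by (elim exE conjE)
    note d = \<kappa> decay[rule_format]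
    have "2 * int n \<le> k + int (card I)" using k by simp
    then have "real_of_int (2 * int n) \<le> real_of_int (k + int (card I))" by (simp only: of_int_le_iff)
    \<comment> \<open>As \<open>CARD('m) + 1\<close> is n, the hypothesis on k says that the
      exponent of Delta' is at least n, one less than the exponent of the density.\<close>
    then have "(of_int k + of_nat (card I)) / 2 \<ge> real CARD('m) + 1" using n by simp
    from cn.not_in_Lp_cusp[OF cont[OF I] d a s this] show ?thesis unfolding region .
  qed
  have c0: "(\<forall>v. ?c I 0 v = 0) \<longleftrightarrow> ?c I 0 0 = 0" if I: "I \<in> Pow {..<r}" and x: "shift k chi d I \<in> \<int>" for I
  proof -
    have "0 \<in> ?X I" using x zero_in_fourier_exps[OF lam0] by blast
    then show ?thesis using koecher.coef_const[OF K[OF I], of 0] by auto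
  qed
  show ?thesis
  proof (intro exI[of _ ?c] conjI ballI allI impI)
    show "fourier_expansion r lam0 (shift k chi d) q ?c" by (rule expansion)
  next
    fix c' I m assume c': "fourier_expansion r lam0 (shift k chi d) q c'" and I: "I \<in> Pow {..<r}" and m: "m \<in> ?X I"
    show "c' I m = ?c I m"
    proof
      fix v show "c' I m v = ?c I m v"
        by (rule koecher.coef_unique[OF K[OF I] _ m]) (use c' I in \<open>simp add: fourier_expansion_def\<close>)
    qed
  next
    fix w :: "'m pt" assume w: "w \<in> H_dom"
    have "(\<Sum>\<^sub>\<infinity>m\<in>?X I. fourier_term (?c I) w m) = q I w" if "I \<in> Pow {..<r}" for I
      by (rule infsumI[OF koecher.term_has_sum[OF K[OF that] w]])
    then show "slash_Rinv r k (slash r k f g) w =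
        (\<lambda>J. \<Sum>I\<in>Pow {..<r}. (\<Sum>\<^sub>\<infinity>m\<in>?X I. fourier_term (?c I) w m) * gr_pow gr_gen I J)"
      unfolding q[OF w] by (intro ext sum.cong refl) simp
  next
    fix I and w :: "'m pt" assume "I \<in> Pow {..<r}" "w \<in> H_dom"
    then show "(\<lambda>m. norm (fourier_term (?c I) w m)) summable_on ?X I" by (intro koecher.term_summable K)
  next
    fix I and C :: "'m pt set" assume "I \<in> Pow {..<r}" "compact C \<and> C \<subseteq> H_dom"
    then show "uniform_limit C (\<lambda>F w. \<Sum>m\<in>F. fourier_term (?c I) w m) (q I) (finite_subsets_at_top (?X I))"
      by (intro koecher.term_uniform_limit K) auto
  next
    fix I m v assume "I \<in> Pow {..<r}" "m \<in> ?X I" "m > 0"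
    then show "?c I m v = 0" by (rule koecher.coef_pos_zero[OF K])
  next
    fix I assume I: "I \<in> Pow {..<r}" and x: "shift k chi d I \<in> \<int>"
    have "0 \<in> ?X I" using x zero_in_fourier_exps[OF lam0] by blast
    from koecher.coef_const[OF K[OF I] this] show "\<exists>a. \<forall>v. ?c I 0 v = a" by (intro exI[of _ "?c I 0 0"]) simp
  next
    fix I and s :: ennreal assume "I \<in> Pow {..<r}" "1 \<le> s" "shift k chi d I \<notin> \<int>"
    then show "?L s I"
      by (intro Lp) (simp_all only: if_False)
  next
    fix I and s :: ennreal
    assume I: "I \<in> Pow {..<r}" and s: "1 \<le> s" and x: "shift k chi d I \<in> \<int> \<and> 2 * int n - int (card I) \<le> k"
    show "?L s I \<longleftrightarrow> (\<forall>v. ?c I 0 v = 0)"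
      unfolding c0[OF I conjunct1[OF x]]
    proof (cases "?c I 0 0 = 0")
      case True
      have "?L s I"
        by (rule Lp[OF I s]) (simp only: True if_cancel)
      then show "?L s I \<longleftrightarrow> ?c I 0 0 = 0"
        using True by blast
    next
      case False
      have "\<not> ?L s I"
        by (rule not_Lp[OF I s _ conjunct2[OF x]]) (simp only: if_P[OF conjunct1[OF x]] False not_False_eq_True)
      then show "?L s I \<longleftrightarrow> ?c I 0 0 = 0"
        using False by (simp only:)
    qed
  qed
qed

end
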